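(* Fix $d\ge2$ and let $\mu$ be the product probability measure of the measures $\mu_\ell$, $\ell\ge1$, on the product space $\prod_{\ell\ge1}S^{n_{\ell d}-1}$. For all positive sequences $(\varepsilon_\ell)$ such that $$\sum_{\ell=1}^\infty\frac{1}{n_{\ell d}\,\varepsilon_\ell^3}<\infty,$$ it holds that $$\mu\Bigl(\bigl\{(\alpha_\ell)_{\ell=1}^\infty : d_{Kol}(h_{\alpha,\ell}(X),Z)>\varepsilon_\ell\text{ for infinitely many }\ell\bigr\}\Bigr)=0.$$
   Context: Let $S^d\subset\mathbb R^{d+1}$ be the unit sphere with normalized (total mass one) Lebesgue measure $dx$. For $\ell\ge1$ let $\{Y_{\ell m}: 1\le m\le n_{\ell d}\}$ be a real orthonormal basis (in $L^2$ of the normalized measure) of the eigenspace $\{f:\Delta_{S^d}f=-\ell(\ell+d-1)f\}$ of the Laplace--Beltrami operator, where $n_{\ell d}=\frac{2\ell+d-1}{\ell}\binom{\ell+d-2}{\ell-1}$ is its dimension. For $\alpha_\ell=(\alpha_{\ell1},\dots,\alpha_{\ell n_{\ell d}})$ in the unit sphere $S^{n_{\ell d}-1}\subset\mathbb R^{n_{\ell d}}$ put $h_{\alpha,\ell}=\sum_{m=1}^{n_{\ell d}}\alpha_{\ell m}Y_{\ell m}$; $\mu_\ell$ is the normalized Lebesgue (uniform) probability measure on the Borel sets of $S^{n_{\ell d}-1}$. $X$ is uniformly distributed on $S^d$, $Z$ is a standard Gaussian variable with distribution function $\Phi$, and for fixed $\alpha_\ell$ the Kolmogorov distance is $$d_{Kol}(h_{\alpha,\ell}(X),Z)=\sup_{u\in\mathbb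 R}\left|\int_{S^d}1_{(-\infty,u]}(h_{\alpha,\ell}(x))\,dx-\Phi(u)\right|.$$ *)

theory Defs
  imports "HOL-Probability.Probability"
begin

text \<open>
  The rotation-invariant probability measure on the unit sphere of a Euclidean space, obtained by
  projecting the uniform distribution on the punctured unit ball radially onto the sphere: the mass
  of \<open>A\<close> is the Lebesgue measure of the cone \<open>{r x | x \<in> A, 0 < r \<le> 1}\<close> divided by that of the ball.
  This is surface measure normalized to total mass one.
\<close>

definition sphere_measure :: "'a::euclidean_space measure" where
  "sphere_measure =
     (let B = cball 0 1 - {0}
      in distr (restrict_space (uniform_measure lborel B) B) (restrict_space borel (sphere 0 1)) sgn)"

lemma prob_space_sphere_measure: "prob_space (sphere_measure :: 'a::euclidean_space measure)"
proof -
  define B :: "'a set" where "B = cball 0 1 - {0}"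
  have B[measurable]: "B \<in> sets borel" by (simp add: B_def)
  have e: "emeasure lborel B = emeasure lborel (cball (0::'a) 1)"
    unfolding B_def by (rule emeasure_Diff_null_set) auto
  have pos: "emeasure lborel B \<noteq> 0" "emeasure lborel B \<noteq> \<infinity>"
    unfolding e by (simp_all add: emeasure_cball ennreal_eq_0_iff not_le)
  have "prob_space (uniform_measure lborel B)"
    using pos by (intro prob_space_uniform_measure) auto
  moreover have "emeasure (uniform_measure lborel B) B = 1"
    using pos by (simp add: emeasure_uniform_measure ennreal_divide_self top.not_eq_extremum)
  ultimately have "prob_space (restrict_space (uniform_measure lborel B) B)"
    by (intro prob_space_restrict_space) auto
  moreover have "sgn \<in> measurable (restrict_space (uniform_measure lborel B) B) (restrict_space borel (sphere 0 1))"
  proof (rule measurable_restrict_space3)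
    show "(sgn :: 'a \<Rightarrow> 'a) \<in> measurable (uniform_measure lborel B) borel"
      by (simp add: sgn_div_norm)
    show "sgn \<in> B \<rightarrow> sphere (0::'a) 1" by (auto simp: B_def norm_sgn)
  qed
  ultimately show ?thesis
    unfolding sphere_measure_def Let_def B_def[symmetric] by (rule prob_space.prob_space_distr)
qed

text \<open>
  The same for the unit sphere of \<open>\<real>\<^sup>n\<close> when \<open>n\<close> is a number rather than a type: points are
  functions on \<open>{1..n}\<close> (undefined elsewhere) and Lebesgue measure is the product measure.
\<close>

definition coord_sphere :: "nat \<Rightarrow> (nat \<Rightarrow> real) set" where
  "coord_sphere n = {a \<in> {1..n} \<rightarrow>\<^sub>E UNIV. L2_set a {1..n} = 1}"

definition coord_sphere_measure :: "nat \<Rightarrow> (nat \<Rightarrow> real) measure" where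
  "coord_sphere_measure n =
     (let B = {a \<in> {1..n} \<rightarrow>\<^sub>E UNIV. 0 < L2_set a {1..n} \<and> L2_set a {1..n} \<le> 1}
      in distr (restrict_space (uniform_measure (PiM {1..n} (\<lambda>_. lborel)) B) B)
           (restrict_space (PiM {1..n} (\<lambda>_. borel)) (coord_sphere n))
           (\<lambda>a. \<lambda>i\<in>{1..n}. a i / L2_set a {1..n}))"

lemma prob_space_coord_sphere_measure:
  assumes "n \<ge> 1"
  shows "prob_space (coord_sphere_measure n)"
proof -
  let ?L = "PiM {1..n} (\<lambda>_. lborel) :: (nat \<Rightarrow> real) measure"
  interpret P: product_sigma_finite "\<lambda>_::nat. lborel :: real measure" ..
  define B where "B = {a \<in> {1..n} \<rightarrow>\<^sub>E (UNIV::real set). 0 < L2_set a {1..n} \<and> L2_set a {1..n} \<le> 1}"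
  have L2m[measurable]: "(\<lambda>a. L2_set a {1..n}) \<in> borel_measurable ?L"
    unfolding L2_set_def by measurable
  have Beq: "B = {a \<in> space ?L. 0 < L2_set a {1..n} \<and> L2_set a {1..n} \<le> 1}"
    by (simp add: B_def space_PiM)
  have B[measurable]: "B \<in> sets ?L"
    unfolding Beq by measurable
  have sub: "PiE {1..n} (\<lambda>_. {0<..1/real n}) \<subseteq> B"
  proof
    fix a assume a: "a \<in> PiE {1..n} (\<lambda>_. {0<..1/real n})"
    then have *: "0 < a i \<and> a i \<le> 1 / real n" if "i \<in> {1..n}" for i using that by (auto simp: PiE_iff)
    have "L2_set a {1..n} \<le> (\<Sum>i\<in>{1..n}. a i)"
      by (rule L2_set_le_sum) (use * in force)
    also have "\<dots> \<le> (\<Sum>i\<in>{1..n}. 1 / real n)" by (rule sum_mono) (use * in blast)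
    also have "\<dots> = 1" using assms by simp
    finally have 1: "L2_set a {1..n} \<le> 1" .
    have "a 1 \<le> L2_set a {1..n}" by (rule member_le_L2_set) (use assms in auto)
    moreover have "a 1 > 0" using *[of 1] assms by auto
    ultimately show "a \<in> B" using 1 a by (auto simp: B_def PiE_iff)
  qed
  have sup: "B \<subseteq> PiE {1..n} (\<lambda>_. {-1..1})"
  proof
    fix a assume a: "a \<in> B"
    have "\<bar>a i\<bar> \<le> 1" if "i \<in> {1..n}" for i
    proof -
      have "\<bar>a i\<bar> \<le> L2_set (\<lambda>i. \<bar>a i\<bar>) {1..n}" by (rule member_le_L2_set) (use that in auto)
      also have "\<dots> = L2_set a {1..n}" by (simp add: L2_set_def)
      finally show ?thesis using a by (auto simp: B_def)
    qed
    then show "a \<in> PiE {1..n} (\<lambda>_. {-1..1})" using a by (force simp: B_def PiE_iff abs_le_iff)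
  qed
  have "0 < emeasure ?L (PiE {1..n} (\<lambda>_. {0<..1/real n}))"
    by (subst P.emeasure_PiM) (use assms in \<open>simp_all add: ennreal_power\<close>)
  also have "\<dots> \<le> emeasure ?L B" by (rule emeasure_mono[OF sub B])
  finally have p1: "emeasure ?L B \<noteq> 0" by simp
  have "emeasure ?L B \<le> emeasure ?L (PiE {1..n} (\<lambda>_. {-1..1}))"
    by (rule emeasure_mono[OF sup]) (auto intro!: sets_PiM_I_finite)
  also have "\<dots> < \<infinity>"
    by (subst P.emeasure_PiM) (auto simp: power_less_top_ennreal)
  finally have p2: "emeasure ?L B \<noteq> \<infinity>" by simp
  have "prob_space (uniform_measure ?L B)"
    using p1 p2 by (intro prob_space_uniform_measure) auto
  moreover have "emeasure (uniform_measure ?L B) B = 1"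
    unfolding emeasure_uniform_measure[OF B B] Int_absorb
    using p1 p2 by (intro ennreal_divide_self) (auto simp: top.not_eq_extremum)
  ultimately have "prob_space (restrict_space (uniform_measure ?L B) B)"
    by (intro prob_space_restrict_space) (simp_all only: sets_uniform_measure B)
  moreover have "(\<lambda>a. \<lambda>i\<in>{1..n}. a i / L2_set a {1..n}) \<in>
    measurable (restrict_space (uniform_measure ?L B) B) (restrict_space (PiM {1..n} (\<lambda>_. borel)) (coord_sphere n))"
  proof (rule measurable_restrict_space3)
    have "(\<lambda>a. \<lambda>i\<in>{1..n}. a i / L2_set a {1..n}) \<in> measurable ?L (PiM {1..n} (\<lambda>_. borel))"
      by (intro measurable_restrict borel_measurable_divide L2m) measurable
    then show "(\<lambda>a. \<lambda>i\<in>{1..n}. a i / L2_set a {1..n}) \<in> measurable (uniform_measure ?L B) (PiM {1..n} (\<lambda>_. borel))"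
      by simp
    have "L2_set (\<lambda>i\<in>{1..n}. a i / L2_set a {1..n}) {1..n} = 1" if "a \<in> B" for a
    proof -
      have p: "L2_set a {1..n} > 0" using that by (simp add: B_def)
      have "L2_set (\<lambda>i\<in>{1..n}. a i / L2_set a {1..n}) {1..n} = L2_set (\<lambda>i. 1 / L2_set a {1..n} * a i) {1..n}"
        by (rule L2_set_cong) auto
      also have "\<dots> = 1 / L2_set a {1..n} * L2_set a {1..n}"
        using p by (subst L2_set_right_distrib) auto
      finally show ?thesis using p by simp
    qed
    then show "(\<lambda>a. \<lambda>i\<in>{1..n}. a i / L2_set a {1..n}) \<in> B \<rightarrow> coord_sphere n"
      by (auto simp: coord_sphere_def)
  qed
  ultimately show ?thesis
    unfolding coord_sphere_measure_def Let_def B_def[symmetric] by (rule prob_space.prob_space_distr)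
qed

definition C2_on :: "'a::euclidean_space set \<Rightarrow> ('a \<Rightarrow> real) \<Rightarrow> bool" where
  "C2_on U f \<longleftrightarrow>
     (\<exists>f' :: 'a \<Rightarrow> 'a \<Rightarrow>\<^sub>L real. \<exists>f'' :: 'a \<Rightarrow> 'a \<Rightarrow>\<^sub>L 'a \<Rightarrow>\<^sub>L real.
        (\<forall>x\<in>U. (f has_derivative blinfun_apply (f' x)) (at x)) \<and>
        (\<forall>x\<in>U. (f' has_derivative blinfun_apply (f'' x)) (at x)) \<and>
        continuous_on U f'')"

definition laplacian :: "('a::euclidean_space \<Rightarrow> real) \<Rightarrow> 'a \<Rightarrow> real" where
  "laplacian f x = (\<Sum>b\<in>Basis. (deriv ^^ 2) (\<lambda>t. f (x + t *\<^sub>R b)) 0)"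

text \<open>
  A function on the sphere is represented by a function on the whole space of which only the values
  on the sphere matter. Its Laplace--Beltrami operator is the Euclidean Laplacian of the extension
  \<open>x \<mapsto> f (x / |x|)\<close>, homogeneous of degree 0, and it is of class \<open>C\<^sup>2\<close> on the sphere iff this
  extension is of class \<open>C\<^sup>2\<close> away from the origin.
\<close>

definition laplace_beltrami :: "('a::euclidean_space \<Rightarrow> real) \<Rightarrow> 'a \<Rightarrow> real" where
  "laplace_beltrami f = laplacian (\<lambda>x. f (sgn x))"

definition laplace_beltrami_eigenspace :: "real \<Rightarrow> ('a::euclidean_space \<Rightarrow> real) set" where
  "laplace_beltrami_eigenspace c =
     {f. C2_on (- {0}) (\<lambda>x. f (sgn x)) \<and> (\<forall>x\<in>sphere 0 1. laplace_beltrami f x = c * f x)}"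

text \<open>Orthonormality is in \<open>L\<^sup>2\<close> of the normalized measure.\<close>

definition orthonormal_basis_on_sphere ::
    "nat \<Rightarrow> (nat \<Rightarrow> 'a::euclidean_space \<Rightarrow> real) \<Rightarrow> ('a \<Rightarrow> real) set \<Rightarrow> bool" where
  "orthonormal_basis_on_sphere n y V \<longleftrightarrow>
     (\<forall>m\<in>{1..n}. y m \<in> V) \<and>
     (\<forall>m\<in>{1..n}. \<forall>k\<in>{1..n}.
        (\<integral>x. y m x * y k x \<partial>sphere_measure) = (if m = k then 1 else 0)) \<and>
     (\<forall>f\<in>V. \<exists>c. \<forall>x\<in>sphere 0 1. f x = (\<Sum>m=1..n. c m * y m x))"

text \<open>The division is exact, as the lemma following the definition shows.\<close>

definition eigenspace_dim :: "nat \<Rightarrow> nat \<Rightarrow> nat" where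
  "eigenspace_dim l d = ((2 * l + d - 1) * ((l + d - 2) choose (l - 1))) div l"

lemma real_eigenspace_dim:
  assumes "l \<ge> 1" "d \<ge> 2"
  shows "real (eigenspace_dim l d) =
           (2 * real l + real d - 1) / real l * real ((l + d - 2) choose (l - 1))"
proof -
  define k where "k = l - 1"
  define m where "m = l + d - 2"
  have l: "l = Suc k" and m: "2 * l + d - 1 = l + Suc m" "m = l + d - 2"
    using assms by (auto simp: k_def m_def)
  have "l * (Suc m choose l) = Suc m * (m choose k)"
    unfolding l by (rule Suc_times_binomial)
  then have "(2 * l + d - 1) * (m choose k) = l * ((m choose k) + (Suc m choose l))"
    unfolding m(1) by (simp only: distrib_left distrib_right)
  then have "l dvd (2 * l + d - 1) * (m choose k)" by (rule dvdI)
  moreover have "real (2 * l + d - 1) = 2 * real l + real d - 1"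
    using assms by (simp add: of_nat_diff)
  ultimately show ?thesis
    unfolding eigenspace_dim_def k_def[symmetric] m_def[symmetric]
    by (simp only: real_of_nat_div of_nat_mult) simp
qed

definition coeff_measure :: "nat \<Rightarrow> (nat \<Rightarrow> nat \<Rightarrow> real) measure" where
  "coeff_measure d = PiM {1..} (\<lambda>l. coord_sphere_measure (eigenspace_dim l d))"

definition spherical_comb ::
    "nat \<Rightarrow> (nat \<Rightarrow> 'a \<Rightarrow> real) \<Rightarrow> (nat \<Rightarrow> real) \<Rightarrow> 'a \<Rightarrow> real" where
  "spherical_comb n y a x = (\<Sum>m=1..n. a m * y m x)"

definition d_Kol :: "('a::euclidean_space \<Rightarrow> real) \<Rightarrow> real" where
  "d_Kol h =
     (SUP u. \<bar>(\<integral>x. indicator {..u} (h x) \<partial>sphere_measure) - cdf std_normal_distribution u\<bar>)"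

end

theory Submission
  imports Defs
begin

text \<open>
  By Borel--Cantelli it suffices to bound the probability that the Kolmogorov distance of
  \<open>h\<^sub>\<alpha> (X)\<close> and \<open>Z\<close> exceeds \<open>\<epsilon>\<close> by \<open>C / (n \<epsilon>\<^sup>3)\<close> for a single eigenspace of dimension \<open>n\<close>,
  with \<open>C\<close> an absolute constant.

  For one eigenspace, realize the uniform point as \<open>\<alpha> = g / |g|\<close> with \<open>g\<close> a standard Gaussian vector
  (\<open>emeasure_coord_sphere_measure\<close>). Then \<open>h\<^sub>\<alpha> = W / R\<close>, where \<open>W (x) = n\<^sup>-\<^sup>1\<^sup>/\<^sup>2 \<Sum> g\<^sub>m Y\<^sub>m (x)\<close> and
  \<open>R = |g| / n\<^sup>1\<^sup>/\<^sup>2\<close>. Rescaling the argument of \<open>\<Phi>\<close> by \<open>R\<close> costs at most \<open>2 |R\<^sup>2 - 1|\<close>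
  (\<open>Phi_scale\<close>), and \<open>R\<^sup>2\<close> has variance \<open>2 / n\<close>, so that \<open>h\<^sub>\<alpha>\<close> may be replaced by \<open>W\<close>.

  The addition theorem \<open>\<Sum> Y\<^sub>m (x)\<^sup>2 = n\<close> says that every \<open>W (x)\<close> is standard Gaussian. The covariance
  of \<open>W (x)\<close> and \<open>W (z)\<close> is \<open>\<rho> (x, z) = n\<^sup>-\<^sup>1 \<Sum> Y\<^sub>m (x) Y\<^sub>m (z)\<close>, and the events \<open>W (x) \<le> u\<close>,
  \<open>W (z) \<le> u\<close> have covariance \<open>\<kappa> \<rho> + O (\<rho>\<^sup>2)\<close> with \<open>\<kappa>\<close> depending on \<open>u\<close> only
  (\<open>gauss_level_covariance\<close>). Integrated over \<open>x\<close> and \<open>z\<close>, the linear term vanishes because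
  eigenfunctions have mean zero, and \<open>\<rho>\<^sup>2\<close> contributes \<open>1 / n\<close> by orthonormality. Hence the random
  distribution function of \<open>W\<close> at \<open>u\<close> has mean square deviation \<open>O (1 / n)\<close> from \<open>\<Phi> (u)\<close>
  (\<open>gauss_field_cdf_second_moment\<close>). Chebyshev's inequality at \<open>O (1 / \<epsilon>)\<close> quantiles of \<open>\<Phi>\<close>, between
  which monotonicity controls the difference (\<open>uniform_bound_from_quantiles\<close>), gives the bound
  \<open>O (1 / \<epsilon>) \<cdot> O (1 / (n \<epsilon>\<^sup>2))\<close> (\<open>d_Kol_tail\<close>).

  The addition theorem and the vanishing means both come from symmetry. Reflections preserve the sphere
  measure and the eigenspace, hence also the reproducing kernel \<open>\<Sum> Y\<^sub>m (x) Y\<^sub>m (z)\<close>. As they act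
  transitively on the sphere, the kernel is constant on the diagonal, and its integral over \<open>z\<close> is a
  constant function of \<open>x\<close>. That constant function lies in an eigenspace with nonzero eigenvalue, so it
  is \<open>0\<close>.
\<close>

section \<open>The standard normal distribution function\<close>

abbreviation Phi :: "real \<Rightarrow> real" where "Phi \<equiv> cdf std_normal_distribution"

interpretation std_normal: real_distribution std_normal_distribution
  by (rule real_dist_normal_dist)

lemma std_normal_density_le_1: "std_normal_density x \<le> 1"
proof -
  have "std_normal_density x = 1 / sqrt (2 * pi) * exp (- x\<^sup>2 / 2)"
    by (simp add: std_normal_density_def)
  also have "\<dots> \<le> 1 * 1"
    using pi_ge_two by (intro mult_mono) auto
  finally show ?thesis by simp
qed

lemma abs_mult_std_normal_density_le_1: "\<bar>x * std_normal_density x\<bar> \<le> 1"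
proof -
  have "\<bar>x\<bar> \<le> 1 + x\<^sup>2 / 2" using sum_squares_ge_zero[of "\<bar>x\<bar> - 1" 0] by (simp add: power2_eq_square algebra_simps)
  also have "\<dots> \<le> exp (x\<^sup>2 / 2)" by (rule exp_ge_add_one_self)
  finally have 1: "\<bar>x\<bar> * exp (- x\<^sup>2 / 2) \<le> 1"
    by (simp add: exp_minus field_simps)
  have "\<bar>x * std_normal_density x\<bar> = 1 / sqrt (2 * pi) * (\<bar>x\<bar> * exp (- x\<^sup>2 / 2))"
    by (simp add: std_normal_density_def abs_mult)
  also have "\<dots> \<le> 1 * 1"
    using pi_ge_two 1 by (intro mult_mono) auto
  finally show ?thesis by simp
qed

lemma continuous_on_std_normal_density: "continuous_on A std_normal_density"
  unfolding normal_density_def by (intro continuous_intros) auto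

lemma Phi_diff:
  assumes "a \<le> b"
  shows "Phi b - Phi a = integral {a..b} std_normal_density"
proof (cases "a = b")
  case False
  with assms have "a < b" by simp
  have "integrable lborel (\<lambda>x. std_normal_density x * x ^ 0)"
    by (rule integrable_std_normal_moment)
  then have int: "set_integrable lborel {a..b} std_normal_density"
    unfolding set_integrable_def by (intro integrable_mult_indicator) auto
  have "Phi b - Phi a = measure std_normal_distribution {a<..b}"
    using std_normal.cdf_diff_eq[OF \<open>a < b\<close>] by simp
  also have "\<dots> = measure std_normal_distribution {a..b}"
  proof (rule std_normal.finite_measure_eq_AE)
    show "AE x in std_normal_distribution. (x \<in> {a<..b}) = (x \<in> {a..b})"
      by (subst AE_density) (auto intro!: AE_I'[of "{a}"])
  qed auto
  also have "\<dots> = (\<integral>x. indicator {a..b} x \<partial>std_normal_distribution)"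
    by simp
  also have "\<dots> = (LINT x:{a..b}|lborel. std_normal_density x)"
    unfolding set_lebesgue_integral_def
    by (subst integral_density) (auto intro!: Bochner_Integration.integral_cong simp: normal_density_nonneg mult.commute)
  also have "\<dots> = integral {a..b} std_normal_density"
    by (rule set_borel_integral_eq_integral(2)[OF int])
  finally show ?thesis .
qed auto

lemma Phi_has_real_derivative: "(Phi has_real_derivative std_normal_density x) (at x)"
proof -
  have "((\<lambda>u. integral {x - 1..u} std_normal_density) has_real_derivative std_normal_density x)
          (at x within {x - 1..x + 1})"
    by (rule integral_has_real_derivative) (auto intro: continuous_on_std_normal_density)
  then have "((\<lambda>u. integral {x - 1..u} std_normal_density + Phi (x - 1)) has_real_derivative std_normal_density x)
          (at x within {x - 1..x + 1})"
    by (auto intro!: derivative_eq_intros)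
  then have "(Phi has_real_derivative std_normal_density x) (at x within {x - 1..x + 1})"
    by (rule has_field_derivative_transform_within[of _ _ _ _ 1]) (simp_all flip: Phi_diff)
  moreover have "at x within {x - 1..x + 1} = at x"
    by (rule at_within_Icc_at) auto
  ultimately show ?thesis by simp
qed

lemma std_normal_density_has_real_derivative:
  "(std_normal_density has_real_derivative - (x * std_normal_density x)) (at x)"
  unfolding normal_density_def by (auto intro!: derivative_eq_intros simp: field_simps)

lemma isCont_Phi: "isCont Phi x"
  by (rule DERIV_isCont[OF Phi_has_real_derivative])

lemma Phi_bounds: "0 \<le> Phi x" "Phi x \<le> 1"
  by (simp_all add: std_normal.cdf_nonneg std_normal.cdf_bounded_prob)

lemma abs_Phi_diff_le_1: "\<bar>Phi x - Phi y\<bar> \<le> 1"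
  using Phi_bounds[of x] Phi_bounds[of y] by linarith

text \<open>
  For \<open>R \<ge> 1/2\<close>, the mean value theorem yields a point \<open>z\<close> between \<open>u\<close> and \<open>u R\<close> with
  \<open>|u| \<le> 2 |z|\<close>, and \<open>z \<phi> (z)\<close> is bounded; this makes the estimate uniform in \<open>u\<close>. For smaller \<open>R\<close> the
  right-hand side exceeds 1. The error is measured by \<open>R\<^sup>2 - 1\<close> because \<open>R\<^sup>2\<close> will be an average of
  squares, or of the form \<open>1 / (1 - \<rho>\<^sup>2)\<close>.
\<close>

lemma Phi_scale:
  assumes "R > 0"
  shows "\<bar>Phi (u * R) - Phi u\<bar> \<le> 2 * \<bar>R\<^sup>2 - 1\<bar>"
proof (cases "R < 1 / 2")
  case True
  then have "R\<^sup>2 \<le> (1/2)\<^sup>2" using assms by (intro power_mono) auto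
  then have "2 * \<bar>R\<^sup>2 - 1\<bar> \<ge> 1" by (simp add: power2_eq_square)
  then show ?thesis using abs_Phi_diff_le_1[of "u * R" u] by linarith
next
  case False
  obtain z where z: "Phi (u * R) - Phi u = std_normal_density z * (u * R - u)" "\<bar>u\<bar> / 2 \<le> \<bar>z\<bar>"
  proof -
    consider "u * R < u" | "u < u * R" | "u * R = u" by linarith
    then show thesis
    proof cases
      case 1
      from MVT2[OF this, of Phi std_normal_density] Phi_has_real_derivative
      obtain z where z: "u * R < z" "z < u" "Phi u - Phi (u * R) = (u - u * R) * std_normal_density z" by auto
      have "\<bar>u\<bar> / 2 \<le> \<bar>z\<bar>"
      proof (cases "u \<ge> 0")
        case True
        then have "u * (1/2) \<le> u * R" using False by (intro mult_left_mono) auto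
        then show ?thesis using z True by auto
      qed (use z in auto)
      then show thesis using z by (intro that[of z]) (auto simp: algebra_simps)
    next
      case 2
      from MVT2[OF this, of Phi std_normal_density] Phi_has_real_derivative
      obtain z where z: "u < z" "z < u * R" "Phi (u * R) - Phi u = (u * R - u) * std_normal_density z" by auto
      have "\<bar>u\<bar> / 2 \<le> \<bar>z\<bar>"
      proof (cases "u \<ge> 0")
        case u: False
        then have "u * R \<le> u * (1/2)" using False by (intro mult_left_mono_neg) auto
        then show ?thesis using z u by linarith
      qed (use z in auto)
      then show thesis using z by (intro that[of z]) (auto simp: algebra_simps)
    next
      case 3
      then show thesis by (intro that[of u]) auto
    qed
  qed
  have "\<bar>Phi (u * R) - Phi u\<bar> = std_normal_density z * \<bar>u\<bar> * \<bar>R - 1\<bar>"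
  proof -
    have "u * R - u = u * (R - 1)" by (simp add: algebra_simps)
    then show ?thesis by (simp only: z(1) abs_mult) (simp add: normal_density_nonneg)
  qed
  also have "\<dots> \<le> std_normal_density z * (2 * \<bar>z\<bar>) * \<bar>R - 1\<bar>"
    using z(2) by (intro mult_right_mono mult_left_mono) (auto simp: normal_density_nonneg)
  also have "\<dots> = 2 * (\<bar>z * std_normal_density z\<bar> * \<bar>R - 1\<bar>)"
    by (simp add: abs_mult normal_density_nonneg)
  also have "\<dots> \<le> 2 * (1 * \<bar>R - 1\<bar>)"
    by (intro mult_left_mono mult_right_mono abs_mult_std_normal_density_le_1) auto
  also have "\<bar>R - 1\<bar> \<le> \<bar>R\<^sup>2 - 1\<bar>"
  proof -
    have "\<bar>R\<^sup>2 - 1\<bar> = \<bar>R - 1\<bar> * (R + 1)"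
    proof -
      have "R\<^sup>2 - 1 = (R - 1) * (R + 1)" by (simp add: power2_eq_square algebra_simps)
      then show ?thesis using assms by (simp add: abs_mult)
    qed
    moreover have "\<bar>R - 1\<bar> * 1 \<le> \<bar>R - 1\<bar> * (R + 1)" using assms by (intro mult_left_mono) auto
    ultimately show ?thesis by simp
  qed
  finally show ?thesis by simp
qed

lemma Phi_taylor: "\<bar>Phi (u - t) - Phi u + t * std_normal_density u\<bar> \<le> t\<^sup>2 / 2"
proof (cases "t = 0")
  case False
  define D where "D k = (case k of 0 \<Rightarrow> Phi | Suc 0 \<Rightarrow> std_normal_density | _ \<Rightarrow> (\<lambda>x. - (x * std_normal_density x)))"
    for k :: nat
  have D: "D 0 = Phi" "D 1 = std_normal_density" "D 2 = (\<lambda>x. - (x * std_normal_density x))"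
    by (simp_all add: D_def fun_eq_iff numeral_2_eq_2)
  have "DERIV (D m) x :> D (Suc m) x" if "m < 2" for m x
    using that Phi_has_real_derivative std_normal_density_has_real_derivative
    by (auto simp: less_2_cases_iff D(1) D(2)[unfolded One_nat_def] D(3)[unfolded numeral_2_eq_2])
  then obtain z where
    "Phi (u - t) = (\<Sum>m<2. D m u / fact m * (u - t - u) ^ m) + D 2 z / fact 2 * (u - t - u) ^ 2"
    using Taylor[of 2 D Phi "min u (u - t)" "max u (u - t)" u "u - t"] D(1) False by auto
  then have "Phi (u - t) - Phi u + t * std_normal_density u = - (z * std_normal_density z) * t\<^sup>2 / 2"
    by (simp add: D numeral_2_eq_2 D(2)[unfolded One_nat_def] D(3)[unfolded numeral_2_eq_2])
  then have "\<bar>Phi (u - t) - Phi u + t * std_normal_density u\<bar> = \<bar>z * std_normal_density z\<bar> * (t\<^sup>2 / 2)"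
    by (simp add: abs_mult)
  also have "\<dots> \<le> 1 * (t\<^sup>2 / 2)"
    by (intro mult_right_mono abs_mult_std_normal_density_le_1) auto
  finally show ?thesis by simp
qed simp

section \<open>Two linear forms of a Gaussian vector\<close>

lemma std_normal_density_rotate:
  assumes "c\<^sup>2 + s\<^sup>2 = 1"
  shows "std_normal_density (c * x - s * y) * std_normal_density (s * x + c * y) =
         std_normal_density x * std_normal_density y"
proof -
  have "(c * x - s * y)\<^sup>2 + (s * x + c * y)\<^sup>2 = (c\<^sup>2 + s\<^sup>2) * (x\<^sup>2 + y\<^sup>2)"
    by (simp add: power2_eq_square algebra_simps)
  then have e: "(c * x - s * y)\<^sup>2 + (s * x + c * y)\<^sup>2 = x\<^sup>2 + y\<^sup>2" using assms by simp
  have "exp (- (c * x - s * y)\<^sup>2 / 2) * exp (- (s * x + c * y)\<^sup>2 / 2) =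
      exp (- ((c * x - s * y)\<^sup>2 + (s * x + c * y)\<^sup>2) / 2)"
    by (simp add: exp_add[symmetric] add_divide_distrib)
  also have "\<dots> = exp (- x\<^sup>2 / 2) * exp (- y\<^sup>2 / 2)"
    unfolding e by (simp add: exp_add[symmetric] add_divide_distrib)
  finally show ?thesis by (simp add: std_normal_density_def)
qed

text \<open>
  Both coordinate changes are one-dimensional and affine: first the inner variable is replaced by the
  new first coordinate with the outer one held fixed, then, after exchanging the integrals, the outer
  variable by the new second coordinate. The Jacobians \<open>1 / |s|\<close> and \<open>|s|\<close> cancel.
\<close>

lemma nn_integral_lborel_rotate:
  fixes f :: "real \<Rightarrow> real \<Rightarrow> ennreal"
  assumes cs: "c\<^sup>2 + s\<^sup>2 = 1"
    and f[measurable]: "case_prod f \<in> borel_measurable (borel \<Otimes>\<^sub>M borel)"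
  shows "(\<integral>\<^sup>+x. \<integral>\<^sup>+y. f (c * x - s * y) (s * x + c * y) \<partial>lborel \<partial>lborel) = (\<integral>\<^sup>+x. \<integral>\<^sup>+y. f x y \<partial>lborel \<partial>lborel)"
proof (cases "s = 0")
  case True
  with cs have c: "c \<noteq> 0" "\<bar>c\<bar> = 1" by (auto simp: power2_eq_1_iff)
  have "(\<integral>\<^sup>+x. \<integral>\<^sup>+y. f x y \<partial>lborel \<partial>lborel) = (\<integral>\<^sup>+x. \<integral>\<^sup>+y. f x (0 + c * y) \<partial>lborel \<partial>lborel)"
    using c by (subst nn_integral_real_affine[of _ c 0]) (auto intro!: nn_integral_cong)
  also have "\<dots> = (\<integral>\<^sup>+x. \<integral>\<^sup>+y. f (0 + c * x) (0 + c * y) \<partial>lborel \<partial>lborel)"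
    using c by (subst nn_integral_real_affine[of _ c 0]) (auto intro!: nn_integral_cong)
  finally show ?thesis using True by simp
next
  case False
  have "(\<integral>\<^sup>+x. \<integral>\<^sup>+y. f x y \<partial>lborel \<partial>lborel) =
        (\<integral>\<^sup>+u. (\<integral>\<^sup>+x. ennreal \<bar>1 / s\<bar> * f u (- c * u / s + 1 / s * x) \<partial>lborel) \<partial>lborel)"
  proof (rule nn_integral_cong)
    fix u
    show "(\<integral>\<^sup>+y. f u y \<partial>lborel) = (\<integral>\<^sup>+x. ennreal \<bar>1 / s\<bar> * f u (- c * u / s + 1 / s * x) \<partial>lborel)"
      using False by (subst nn_integral_real_affine[of _ "1 / s" "- c * u / s"]) (auto simp: nn_integral_cmult)
  qed
  also have "\<dots> = (\<integral>\<^sup>+x. (\<integral>\<^sup>+u. ennreal \<bar>1 / s\<bar> * f u (- c * u / s + 1 / s * x) \<partial>lborel) \<partial>lborel)"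
    by (rule lborel_pair.Fubini') measurable
  also have "\<dots> = (\<integral>\<^sup>+x. \<integral>\<^sup>+y. f (c * x - s * y) (s * x + c * y) \<partial>lborel \<partial>lborel)"
  proof (rule nn_integral_cong)
    fix x
    have "(\<integral>\<^sup>+u. ennreal \<bar>1 / s\<bar> * f u (- c * u / s + 1 / s * x) \<partial>lborel) =
        ennreal \<bar>- s\<bar> * (\<integral>\<^sup>+y. ennreal \<bar>1 / s\<bar> * f (c * x + - s * y) (- c * (c * x + - s * y) / s + 1 / s * x) \<partial>lborel)"
      using False by (subst nn_integral_real_affine[of _ "- s" "c * x"]) auto
    also have "\<dots> = (\<integral>\<^sup>+y. ennreal \<bar>- s\<bar> * (ennreal \<bar>1 / s\<bar> * f (c * x + - s * y) (- c * (c * x + - s * y) / s + 1 / s * x)) \<partial>lborel)"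
      by (rule nn_integral_cmult[symmetric]) measurable
    also have "\<dots> = (\<integral>\<^sup>+y. f (c * x - s * y) (s * x + c * y) \<partial>lborel)"
    proof (rule nn_integral_cong)
      fix y
      have "- c * (c * x + - s * y) / s + 1 / s * x = ((1 - c\<^sup>2) * x + c * s * y) / s"
        using False by (simp add: field_simps power2_eq_square)
      also have "1 - c\<^sup>2 = s * s" using cs by (simp add: power2_eq_square)
      also have "(s * s * x + c * s * y) / s = s * x + c * y" using False by (simp add: field_simps)
      finally have e: "- c * (c * x + - s * y) / s + 1 / s * x = s * x + c * y" .
      have "ennreal \<bar>- s\<bar> * ennreal \<bar>1 / s\<bar> = 1"
        using False by (simp add: ennreal_mult[symmetric])
      then show "ennreal \<bar>- s\<bar> * (ennreal \<bar>1 / s\<bar> * f (c * x + - s * y) (- c * (c * x + - s * y) / s + 1 / s * x))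
          = f (c * x - s * y) (s * x + c * y)"
        unfolding e by (simp add: mult.assoc[symmetric])
    qed
    finally show "(\<integral>\<^sup>+u. ennreal \<bar>1 / s\<bar> * f u (- c * u / s + 1 / s * x) \<partial>lborel) = (\<integral>\<^sup>+y. f (c * x - s * y) (s * x + c * y) \<partial>lborel)" .
  qed
  finally show ?thesis by simp
qed

lemma nn_integral_std_normal_iterated:
  fixes f :: "real \<Rightarrow> real \<Rightarrow> ennreal"
  assumes f[measurable]: "case_prod f \<in> borel_measurable (borel \<Otimes>\<^sub>M borel)"
  shows "(\<integral>\<^sup>+x. \<integral>\<^sup>+y. f x y \<partial>std_normal_distribution \<partial>std_normal_distribution) =
    (\<integral>\<^sup>+x. \<integral>\<^sup>+y. ennreal (std_normal_density x * std_normal_density y) * f x y \<partial>lborel \<partial>lborel)"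
proof -
  have "(\<integral>\<^sup>+x. \<integral>\<^sup>+y. f x y \<partial>std_normal_distribution \<partial>std_normal_distribution) =
    (\<integral>\<^sup>+x. ennreal (std_normal_density x) * (\<integral>\<^sup>+y. ennreal (std_normal_density y) * f x y \<partial>lborel) \<partial>lborel)"
    by (subst nn_integral_density, measurable) (subst nn_integral_density, measurable)
  also have "\<dots> = (\<integral>\<^sup>+x. \<integral>\<^sup>+y. ennreal (std_normal_density x * std_normal_density y) * f x y \<partial>lborel \<partial>lborel)"
    by (subst nn_integral_cmult[symmetric], measurable)
       (simp add: ennreal_mult normal_density_nonneg mult.assoc)
  finally show ?thesis .
qed

lemma std_normal_rotate:
  fixes f :: "real \<Rightarrow> real \<Rightarrow> ennreal"
  assumes cs: "c\<^sup>2 + s\<^sup>2 = 1"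
    and f[measurable]: "case_prod f \<in> borel_measurable (borel \<Otimes>\<^sub>M borel)"
  shows "(\<integral>\<^sup>+x. \<integral>\<^sup>+y. f (c * x - s * y) (s * x + c * y) \<partial>std_normal_distribution \<partial>std_normal_distribution) =
         (\<integral>\<^sup>+x. \<integral>\<^sup>+y. f x y \<partial>std_normal_distribution \<partial>std_normal_distribution)"
proof -
  have "(\<integral>\<^sup>+x. \<integral>\<^sup>+y. f (c * x - s * y) (s * x + c * y) \<partial>std_normal_distribution \<partial>std_normal_distribution) =
    (\<integral>\<^sup>+x. \<integral>\<^sup>+y. ennreal (std_normal_density x * std_normal_density y) * f (c * x - s * y) (s * x + c * y) \<partial>lborel \<partial>lborel)"
    by (rule nn_integral_std_normal_iterated) measurable
  also have "\<dots> = (\<integral>\<^sup>+x. \<integral>\<^sup>+y. ennreal (std_normal_density (c * x - s * y) * std_normal_density (s * x + c * y)) * f (c * x - s * y) (s * x + c * y) \<partial>lborel \<partial>lborel)"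
    by (simp add: std_normal_density_rotate[OF cs])
  also have "\<dots> = (\<integral>\<^sup>+x. \<integral>\<^sup>+y. ennreal (std_normal_density x * std_normal_density y) * f x y \<partial>lborel \<partial>lborel)"
    by (rule nn_integral_lborel_rotate[OF cs, of "\<lambda>x y. ennreal (std_normal_density x * std_normal_density y) * f x y"]) measurable
  finally show ?thesis by (simp only: nn_integral_std_normal_iterated[OF f])
qed

lemma polar_coordinates:
  fixes a b :: real
  obtains r c s where "r \<ge> 0" "r\<^sup>2 = a\<^sup>2 + b\<^sup>2" "c\<^sup>2 + s\<^sup>2 = 1" "a = r * c" "b = r * s"
proof (cases "a\<^sup>2 + b\<^sup>2 = 0")
  case True
  then show thesis by (intro that[of 0 1 0]) (auto simp: sum_power2_eq_zero_iff)
next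
  case False
  define r where "r = sqrt (a\<^sup>2 + b\<^sup>2)"
  have r: "r\<^sup>2 = a\<^sup>2 + b\<^sup>2" "r \<noteq> 0" "r \<ge> 0" using False by (simp_all add: r_def)
  then have "(a / r)\<^sup>2 + (b / r)\<^sup>2 = 1"
    using False by (simp add: power_divide add_divide_distrib[symmetric])
  then show thesis using r by (intro that[of r "a / r" "b / r"]) auto
qed

abbreviation gauss :: "'i set \<Rightarrow> ('i \<Rightarrow> real) measure" where
  "gauss I \<equiv> PiM I (\<lambda>_. std_normal_distribution)"

lemma prob_space_gauss: "prob_space (gauss I)"
  by (intro prob_space_PiM std_normal.prob_space_axioms)

text \<open>
  The joint law of two linear forms is found by adding one coordinate \<open>z\<close> at a time. If the law so
  far is that of \<open>(p x, q x + r y)\<close>, the new pair is \<open>(p x + a z, q x + r y + b z)\<close>; a rotation of the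
  \<open>(x, z)\<close> plane removes \<open>z\<close> from the first component, and a rotation of the \<open>(z, y)\<close> plane merges the
  two remaining variables in the second. The three quadratic identities say that the covariance matrix is
  preserved; they determine \<open>p\<close>, \<open>q\<close>, \<open>r\<close> when the first form is nonzero.
\<close>

lemma gauss_two_linear_forms_exists:
  fixes a b :: "'i \<Rightarrow> real"
  assumes "finite I"
  shows "\<exists>p q r. p \<ge> 0 \<and> r \<ge> 0 \<and> p\<^sup>2 = (\<Sum>i\<in>I. (a i)\<^sup>2) \<and> p * q = (\<Sum>i\<in>I. a i * b i) \<and>
      q\<^sup>2 + r\<^sup>2 = (\<Sum>i\<in>I. (b i)\<^sup>2) \<and>
      (\<forall>f :: real \<Rightarrow> real \<Rightarrow> ennreal. case_prod f \<in> borel_measurable (borel \<Otimes>\<^sub>M borel) \<longrightarrow>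
        (\<integral>\<^sup>+g. f (\<Sum>i\<in>I. a i * g i) (\<Sum>i\<in>I. b i * g i) \<partial>gauss I) =
        (\<integral>\<^sup>+x. \<integral>\<^sup>+y. f (p * x) (q * x + r * y) \<partial>std_normal_distribution \<partial>std_normal_distribution))"
  using assms
proof (induction I)
  case empty
  show ?case
    using std_normal.emeasure_space_1 prob_space.emeasure_space_1[OF prob_space_gauss, of "{} :: 'i set"]
    by (intro exI[of _ 0]) auto
next
  case (insert i I)
  interpret product_sigma_finite "\<lambda>_::'i. std_normal_distribution"
    by unfold_locales
  from insert.IH obtain p q r where pqr: "p \<ge> 0" "r \<ge> 0" "p\<^sup>2 = (\<Sum>i\<in>I. (a i)\<^sup>2)" "p * q = (\<Sum>i\<in>I. a i * b i)"
      "q\<^sup>2 + r\<^sup>2 = (\<Sum>i\<in>I. (b i)\<^sup>2)"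
    and IH: "\<And>f :: real \<Rightarrow> real \<Rightarrow> ennreal. case_prod f \<in> borel_measurable (borel \<Otimes>\<^sub>M borel) \<Longrightarrow>
        (\<integral>\<^sup>+g. f (\<Sum>i\<in>I. a i * g i) (\<Sum>i\<in>I. b i * g i) \<partial>gauss I) =
        (\<integral>\<^sup>+x. \<integral>\<^sup>+y. f (p * x) (q * x + r * y) \<partial>std_normal_distribution \<partial>std_normal_distribution)"
    by blast
  obtain p' c s where p': "p' \<ge> 0" "p'\<^sup>2 = p\<^sup>2 + (a i)\<^sup>2" "c\<^sup>2 + s\<^sup>2 = 1" "p = p' * c" "a i = p' * s"
    by (rule polar_coordinates)
  define q' where "q' = q * c + b i * s"
  define t where "t = b i * c - q * s"
  obtain r' c' s' where r': "r' \<ge> 0" "r'\<^sup>2 = t\<^sup>2 + r\<^sup>2" "c'\<^sup>2 + s'\<^sup>2 = 1" "t = r' * c'" "r = r' * s'"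
    by (rule polar_coordinates)
  show ?case
  proof (intro exI conjI allI impI)
    show "p' \<ge> 0" "r' \<ge> 0" by fact+
    show "p'\<^sup>2 = (\<Sum>i\<in>insert i I. (a i)\<^sup>2)" using insert.hyps p' pqr by simp
    have "p' * q' = q * (p' * c) + b i * (p' * s)" by (simp add: q'_def algebra_simps)
    also have "\<dots> = (\<Sum>i\<in>insert i I. a i * b i)"
      unfolding p'(4,5)[symmetric] using insert.hyps pqr(4) by (simp add: mult.commute)
    finally show "p' * q' = (\<Sum>i\<in>insert i I. a i * b i)" .
    have "q'\<^sup>2 + r'\<^sup>2 = (c\<^sup>2 + s\<^sup>2) * (q\<^sup>2 + (b i)\<^sup>2) + r\<^sup>2"
      unfolding r'(2) q'_def t_def by (simp add: power2_eq_square algebra_simps)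
    then show "q'\<^sup>2 + r'\<^sup>2 = (\<Sum>i\<in>insert i I. (b i)\<^sup>2)" using insert.hyps pqr(5) p'(3) by simp
  next
    fix f :: "real \<Rightarrow> real \<Rightarrow> ennreal"
    assume f[measurable]: "case_prod f \<in> borel_measurable (borel \<Otimes>\<^sub>M borel)"
    let ?N = "std_normal_distribution"
    define f1 where "f1 = (\<lambda>s t. \<integral>\<^sup>+z. f (s + a i * z) (t + b i * z) \<partial>?N)"
    have f1[measurable]: "case_prod f1 \<in> borel_measurable (borel \<Otimes>\<^sub>M borel)"
      unfolding f1_def by measurable
    have "(\<integral>\<^sup>+g. f (\<Sum>i\<in>insert i I. a i * g i) (\<Sum>i\<in>insert i I. b i * g i) \<partial>gauss (insert i I)) =
        (\<integral>\<^sup>+g. \<integral>\<^sup>+z. f (\<Sum>j\<in>insert i I. a j * (g(i := z)) j) (\<Sum>j\<in>insert i I. b j * (g(i := z)) j) \<partial>?N \<partial>gauss I)"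
      using insert.hyps by (intro product_nn_integral_insert) measurable
    also have "\<dots> = (\<integral>\<^sup>+g. f1 (\<Sum>i\<in>I. a i * g i) (\<Sum>i\<in>I. b i * g i) \<partial>gauss I)"
    proof -
      have "(\<Sum>j\<in>insert i I. a j * (g(i := z)) j) = (\<Sum>j\<in>I. a j * g j) + a i * z" for a :: "'i \<Rightarrow> real" and g z
        using insert.hyps by (simp add: add.commute) (intro sum.cong, auto)
      then show ?thesis unfolding f1_def by simp
    qed
    also have "\<dots> = (\<integral>\<^sup>+x. \<integral>\<^sup>+y. f1 (p * x) (q * x + r * y) \<partial>?N \<partial>?N)"
      by (rule IH[OF f1])
    also have "\<dots> = (\<integral>\<^sup>+x. \<integral>\<^sup>+z. \<integral>\<^sup>+y. f (p * x + a i * z) (q * x + r * y + b i * z) \<partial>?N \<partial>?N \<partial>?N)"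
    proof (rule nn_integral_cong)
      fix x
      interpret pair_sigma_finite ?N ?N by unfold_locales
      show "(\<integral>\<^sup>+y. f1 (p * x) (q * x + r * y) \<partial>?N) = (\<integral>\<^sup>+z. \<integral>\<^sup>+y. f (p * x + a i * z) (q * x + r * y + b i * z) \<partial>?N \<partial>?N)"
        unfolding f1_def by (rule Fubini') measurable
    qed
    also have "\<dots> = (\<integral>\<^sup>+x. \<integral>\<^sup>+z. \<integral>\<^sup>+y. f (p * (c * x - s * z) + a i * (s * x + c * z))
         (q * (c * x - s * z) + r * y + b i * (s * x + c * z)) \<partial>?N \<partial>?N \<partial>?N)"
      by (rule std_normal_rotate[OF p'(3), symmetric]) measurable
    also have "\<dots> = (\<integral>\<^sup>+x. \<integral>\<^sup>+z. \<integral>\<^sup>+y. f (p' * x) (q' * x + (t * z + r * y)) \<partial>?N \<partial>?N \<partial>?N)"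
    proof -
      have 1: "p * (c * x - s * z) + a i * (s * x + c * z) = p' * x" for x z
      proof -
        have "p * (c * x - s * z) + a i * (s * x + c * z) = p' * ((c\<^sup>2 + s\<^sup>2) * x)"
          unfolding p'(4,5) by (simp add: power2_eq_square algebra_simps)
        then show ?thesis using p'(3) by simp
      qed
      have 2: "q * (c * x - s * z) + r * y + b i * (s * x + c * z) = q' * x + (t * z + r * y)" for x y z
        by (simp add: q'_def t_def algebra_simps)
      show ?thesis unfolding 1 2 ..
    qed
    also have "\<dots> = (\<integral>\<^sup>+x. \<integral>\<^sup>+z. f (p' * x) (q' * x + r' * z) \<partial>?N \<partial>?N)"
    proof (rule nn_integral_cong)
      fix x
      have "(\<integral>\<^sup>+z. \<integral>\<^sup>+y. f (p' * x) (q' * x + (t * z + r * y)) \<partial>?N \<partial>?N) =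
         (\<integral>\<^sup>+z. \<integral>\<^sup>+y. f (p' * x) (q' * x + (t * (c' * z - s' * y) + r * (s' * z + c' * y))) \<partial>?N \<partial>?N)"
        by (rule std_normal_rotate[OF r'(3), symmetric]) measurable
      also have "\<dots> = (\<integral>\<^sup>+z. \<integral>\<^sup>+y. f (p' * x) (q' * x + r' * z) \<partial>?N \<partial>?N)"
      proof -
        have "t * (c' * z - s' * y) + r * (s' * z + c' * y) = r' * z" for z y
        proof -
          have "t * (c' * z - s' * y) + r * (s' * z + c' * y) = r' * ((c'\<^sup>2 + s'\<^sup>2) * z)"
            unfolding r'(4,5) by (simp add: power2_eq_square algebra_simps)
          then show ?thesis using r'(3) by simp
        qed
        then show ?thesis by simp
      qed
      also have "\<dots> = (\<integral>\<^sup>+z. f (p' * x) (q' * x + r' * z) \<partial>?N)"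
        using std_normal.emeasure_space_1 by simp
      finally show "(\<integral>\<^sup>+z. \<integral>\<^sup>+y. f (p' * x) (q' * x + (t * z + r * y)) \<partial>?N \<partial>?N) = (\<integral>\<^sup>+z. f (p' * x) (q' * x + r' * z) \<partial>?N)" .
    qed
    finally show "(\<integral>\<^sup>+g. f (\<Sum>i\<in>insert i I. a i * g i) (\<Sum>i\<in>insert i I. b i * g i) \<partial>gauss (insert i I)) =
        (\<integral>\<^sup>+x. \<integral>\<^sup>+y. f (p' * x) (q' * x + r' * y) \<partial>?N \<partial>?N)" .
  qed
qed

lemma gauss_two_linear_forms:
  fixes a b :: "'i \<Rightarrow> real"
  assumes "finite I" and a: "(\<Sum>i\<in>I. (a i)\<^sup>2) = 1" and b: "(\<Sum>i\<in>I. (b i)\<^sup>2) = 1"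
  defines "\<rho> \<equiv> (\<Sum>i\<in>I. a i * b i)"
  shows "\<bar>\<rho>\<bar> \<le> 1"
    and "distr (gauss I) (borel \<Otimes>\<^sub>M borel) (\<lambda>g. (\<Sum>i\<in>I. a i * g i, \<Sum>i\<in>I. b i * g i)) =
      distr (std_normal_distribution \<Otimes>\<^sub>M std_normal_distribution) (borel \<Otimes>\<^sub>M borel)
        (\<lambda>(x, y). (x, \<rho> * x + sqrt (1 - \<rho>\<^sup>2) * y))"
proof -
  let ?N = "std_normal_distribution"
  obtain p q r where pqr: "p \<ge> 0" "r \<ge> 0" "p\<^sup>2 = 1" "p * q = \<rho>" "q\<^sup>2 + r\<^sup>2 = 1"
    and eq: "\<And>f :: real \<Rightarrow> real \<Rightarrow> ennreal. case_prod f \<in> borel_measurable (borel \<Otimes>\<^sub>M borel) \<Longrightarrow>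
        (\<integral>\<^sup>+g. f (\<Sum>i\<in>I. a i * g i) (\<Sum>i\<in>I. b i * g i) \<partial>gauss I) =
        (\<integral>\<^sup>+x. \<integral>\<^sup>+y. f (p * x) (q * x + r * y) \<partial>?N \<partial>?N)"
    using gauss_two_linear_forms_exists[OF assms(1), of a b] unfolding a b \<rho>_def by blast
  have "p = 1" using pqr(1,3) by (simp add: power2_eq_1_iff)
  have "q = \<rho>" using pqr \<open>p = 1\<close> by simp
  have r: "r = sqrt (1 - \<rho>\<^sup>2)" using pqr \<open>q = \<rho>\<close> by (intro real_sqrt_unique[symmetric]) auto
  have "\<rho>\<^sup>2 \<le> 1" using pqr(5) zero_le_power2[of r] unfolding \<open>q = \<rho>\<close> by linarith
  then show "\<bar>\<rho>\<bar> \<le> 1" by (simp add: abs_square_le_1)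
  have m1[measurable]: "(\<lambda>g. (\<Sum>i\<in>I. a i * g i, \<Sum>i\<in>I. b i * g i)) \<in> gauss I \<rightarrow>\<^sub>M borel \<Otimes>\<^sub>M borel" by measurable
  interpret N: pair_sigma_finite ?N ?N by unfold_locales
  show "distr (gauss I) (borel \<Otimes>\<^sub>M borel) (\<lambda>g. (\<Sum>i\<in>I. a i * g i, \<Sum>i\<in>I. b i * g i)) =
      distr (?N \<Otimes>\<^sub>M ?N) (borel \<Otimes>\<^sub>M borel) (\<lambda>(x, y). (x, \<rho> * x + sqrt (1 - \<rho>\<^sup>2) * y))"
  proof (rule measure_eqI)
    fix A assume "A \<in> sets (distr (gauss I) (borel \<Otimes>\<^sub>M borel) (\<lambda>g. (\<Sum>i\<in>I. a i * g i, \<Sum>i\<in>I. b i * g i)))"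
    then have A[measurable]: "A \<in> sets (borel \<Otimes>\<^sub>M borel)" by simp
    have "emeasure (distr (gauss I) (borel \<Otimes>\<^sub>M borel) (\<lambda>g. (\<Sum>i\<in>I. a i * g i, \<Sum>i\<in>I. b i * g i))) A =
       (\<integral>\<^sup>+z. indicator A z \<partial>distr (gauss I) (borel \<Otimes>\<^sub>M borel) (\<lambda>g. (\<Sum>i\<in>I. a i * g i, \<Sum>i\<in>I. b i * g i)))"
      by simp
    also have "\<dots> = (\<integral>\<^sup>+g. indicator A (\<Sum>i\<in>I. a i * g i, \<Sum>i\<in>I. b i * g i) \<partial>gauss I)"
      by (rule nn_integral_distr) auto
    also have "\<dots> = (\<integral>\<^sup>+x. \<integral>\<^sup>+y. indicator A (x, \<rho> * x + sqrt (1 - \<rho>\<^sup>2) * y) \<partial>?N \<partial>?N)"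
      using eq[of "\<lambda>x y. indicator A (x, y)"] unfolding \<open>p = 1\<close> \<open>q = \<rho>\<close> r by simp
    also have "\<dots> = (\<integral>\<^sup>+z. indicator A (case z of (x, y) \<Rightarrow> (x, \<rho> * x + sqrt (1 - \<rho>\<^sup>2) * y)) \<partial>(?N \<Otimes>\<^sub>M ?N))"
      by (subst std_normal.nn_integral_fst[symmetric]) auto
    also have "\<dots> = (\<integral>\<^sup>+z. indicator A z \<partial>distr (?N \<Otimes>\<^sub>M ?N) (borel \<Otimes>\<^sub>M borel) (\<lambda>(x, y). (x, \<rho> * x + sqrt (1 - \<rho>\<^sup>2) * y)))"
      by (rule nn_integral_distr[symmetric]) auto
    finally show "emeasure (distr (gauss I) (borel \<Otimes>\<^sub>M borel) (\<lambda>g. (\<Sum>i\<in>I. a i * g i, \<Sum>i\<in>I. b i * g i))) A =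
       emeasure (distr (?N \<Otimes>\<^sub>M ?N) (borel \<Otimes>\<^sub>M borel) (\<lambda>(x, y). (x, \<rho> * x + sqrt (1 - \<rho>\<^sup>2) * y))) A" by simp
  qed simp
qed

section \<open>Covariance of Gaussian level sets\<close>

lemma std_normal_moments:
  "integrable std_normal_distribution (\<lambda>x. x)"
  "integrable std_normal_distribution (\<lambda>x. x\<^sup>2)" "(\<integral>x. x\<^sup>2 \<partial>std_normal_distribution) = 1"
  "integrable std_normal_distribution (\<lambda>x. x ^ 4)" "(\<integral>x. x ^ 4 \<partial>std_normal_distribution) = 3"
  using integrable_std_normal_distribution_moment[of 1] integrable_std_normal_distribution_moment[of 2]
    std_normal_distribution_even_moments[of 1] std_normal_distribution_even_moments[of 2]
  by (simp_all add: fact_numeral)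

lemma std_normal_affine_cdf:
  assumes "s > 0"
  shows "(\<integral>y. (indicator {..u} (t + s * y) :: real) \<partial>std_normal_distribution) = Phi ((u - t) / s)"
proof -
  have "(\<integral>y. (indicator {..u} (t + s * y) :: real) \<partial>std_normal_distribution) =
      (\<integral>y. (indicator {..(u - t) / s} y :: real) \<partial>std_normal_distribution)"
    using assms by (intro Bochner_Integration.integral_cong) (auto simp: indicator_def field_simps)
  then show ?thesis by (simp add: cdf_def)
qed

text \<open>
  The coefficient of the linear term in the expansion of a Gaussian level covariance in powers of the
  correlation. By partial integration it equals \<open>\<phi> (u)\<^sup>2\<close>.
\<close>

definition level_coeff :: "real \<Rightarrow> real" where
  "level_coeff u = - std_normal_density u * (\<integral>x. (indicator {..u} x - Phi u) * x \<partial>std_normal_distribution)"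

lemma abs_indicator_minus_Phi_le_1: "\<bar>indicator A x - Phi u\<bar> \<le> 1"
  using Phi_bounds[of u] by (auto simp: indicator_def)

lemma abs_mult_le_1: "\<bar>x\<bar> \<le> 1 \<Longrightarrow> \<bar>y\<bar> \<le> 1 \<Longrightarrow> \<bar>x * y\<bar> \<le> 1" for x y :: real
  unfolding abs_mult by (rule mult_le_one) auto

lemma integrable_level_coeff:
  "integrable std_normal_distribution (\<lambda>x. (indicator {..u} x - Phi u) * x)"
proof (rule Bochner_Integration.integrable_bound[OF std_normal_moments(1)])
  show "AE x in std_normal_distribution. norm ((indicator {..u} x - Phi u) * x) \<le> norm x"
    by (intro AE_I2) (simp add: abs_mult mult_left_le_one_le abs_indicator_minus_Phi_le_1)
qed simp

lemma abs_level_coeff_le_1: "\<bar>level_coeff u\<bar> \<le> 1"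
proof -
  have "\<bar>\<integral>x. (indicator {..u} x - Phi u) * x \<partial>std_normal_distribution\<bar> \<le> (\<integral>x. (1 + x\<^sup>2) / 2 \<partial>std_normal_distribution)"
  proof (rule order.trans[OF integral_abs_bound], rule integral_mono)
    fix x :: real
    have "\<bar>(indicator {..u} x - Phi u) * x\<bar> \<le> 1 * \<bar>x\<bar>"
      unfolding abs_mult by (intro mult_right_mono abs_indicator_minus_Phi_le_1) auto
    also have "\<dots> \<le> (1 + x\<^sup>2) / 2"
      using zero_le_power2[of "\<bar>x\<bar> - 1"] by (simp add: power2_eq_square algebra_simps)
    finally show "\<bar>(indicator {..u} x - Phi u) * x\<bar> \<le> (1 + x\<^sup>2) / 2" .
  qed (use std_normal_moments integrable_level_coeff[of u] in auto)
  also have "\<dots> = 1" using std_normal_moments std_normal.prob_space by simp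
  finally have "\<bar>level_coeff u\<bar> \<le> 1 * 1"
    unfolding level_coeff_def abs_mult using std_normal_density_le_1[of u]
    by (intro mult_mono) (auto simp: normal_density_nonneg)
  then show ?thesis by simp
qed

text \<open>
  Given \<open>X = x\<close>, the variable \<open>\<rho> X + (1 - \<rho>\<^sup>2)\<^sup>1\<^sup>/\<^sup>2 Y\<close> is at most \<open>u\<close> with probability
  \<open>\<Phi> ((u - \<rho> x) / (1 - \<rho>\<^sup>2)\<^sup>1\<^sup>/\<^sup>2)\<close>. The denominator changes this by \<open>O (\<rho>\<^sup>2)\<close> only, uniformly in
  the argument, so a Taylor expansion of \<open>\<Phi> (u - \<rho> x)\<close> is enough.
\<close>

lemma Phi_conditional_expansion:
  assumes "\<bar>\<rho>\<bar> \<le> 1 / 2"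
  shows "\<bar>Phi ((u - \<rho> * x) / sqrt (1 - \<rho>\<^sup>2)) - Phi u + \<rho> * x * std_normal_density u\<bar> \<le> (3 + x\<^sup>2 / 2) * \<rho>\<^sup>2"
proof -
  have "\<rho>\<^sup>2 \<le> (1 / 2)\<^sup>2" using power_mono[OF assms, of 2] by simp
  then have r: "\<rho>\<^sup>2 \<le> 1 / 4" by (simp add: power2_eq_square)
  define R where "R = 1 / sqrt (1 - \<rho>\<^sup>2)"
  have R: "R > 0" "R\<^sup>2 = 1 / (1 - \<rho>\<^sup>2)" using r by (simp_all add: R_def power_divide)
  have "R\<^sup>2 - 1 = \<rho>\<^sup>2 / (1 - \<rho>\<^sup>2)" unfolding R(2) using r by (simp add: field_simps)
  then have "\<bar>R\<^sup>2 - 1\<bar> = \<rho>\<^sup>2 / (1 - \<rho>\<^sup>2)" using r by simp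
  moreover have "\<rho>\<^sup>2 / (1 - \<rho>\<^sup>2) \<le> \<rho>\<^sup>2 / (3 / 4)" using r by (intro divide_left_mono) auto
  ultimately have "\<bar>R\<^sup>2 - 1\<bar> \<le> \<rho>\<^sup>2 * (3 / 2)" using zero_le_power2[of \<rho>] by simp
  then have "2 * \<bar>R\<^sup>2 - 1\<bar> \<le> 3 * \<rho>\<^sup>2" by simp
  with Phi_scale[OF R(1), of "u - \<rho> * x"]
  have "\<bar>Phi ((u - \<rho> * x) * R) - Phi (u - \<rho> * x)\<bar> \<le> 3 * \<rho>\<^sup>2" by linarith
  moreover have "\<bar>Phi (u - \<rho> * x) - Phi u + \<rho> * x * std_normal_density u\<bar> \<le> x\<^sup>2 / 2 * \<rho>\<^sup>2"
    using Phi_taylor[of u "\<rho> * x"] by (simp add: power_mult_distrib mult.commute)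
  ultimately have "\<bar>Phi ((u - \<rho> * x) * R) - Phi u + \<rho> * x * std_normal_density u\<bar> \<le> 3 * \<rho>\<^sup>2 + x\<^sup>2 / 2 * \<rho>\<^sup>2"
    by linarith
  then show ?thesis by (simp add: R_def distrib_right)
qed

text \<open>
  For correlation at most \<open>1/2\<close>, the conditional expansion is integrated against the first variable. For
  larger correlation both terms on the left are at most 1 in absolute value and \<open>8 \<rho>\<^sup>2 \<ge> 2\<close>.
\<close>

lemma gauss_level_covariance:
  fixes a b :: "'i \<Rightarrow> real"
  assumes "finite I" and a: "(\<Sum>i\<in>I. (a i)\<^sup>2) = 1" and b: "(\<Sum>i\<in>I. (b i)\<^sup>2) = 1"
  defines "\<rho> \<equiv> (\<Sum>i\<in>I. a i * b i)"
  shows "\<bar>(\<integral>g. (indicator {..u} (\<Sum>i\<in>I. a i * g i) - Phi u) * (indicator {..u} (\<Sum>i\<in>I. b i * g i) - Phi u) \<partial>gauss I)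
           - level_coeff u * \<rho>\<bar> \<le> 8 * \<rho>\<^sup>2" (is "\<bar>?C - _\<bar> \<le> _")
proof (cases "\<bar>\<rho>\<bar> \<le> 1 / 2")
  case False
  interpret G: prob_space "gauss I" by (rule prob_space_gauss)
  have "\<bar>?C\<bar> \<le> (\<integral>g. 1 \<partial>gauss I)"
  proof (rule order.trans[OF integral_abs_bound], rule integral_mono')
    fix g
    show "\<bar>(indicator {..u} (\<Sum>i\<in>I. a i * g i) - Phi u) * (indicator {..u} (\<Sum>i\<in>I. b i * g i) - Phi u)\<bar> \<le> 1"
      by (intro abs_mult_le_1 abs_indicator_minus_Phi_le_1)
  qed auto
  then have 1: "\<bar>?C\<bar> \<le> 1" by (simp add: G.prob_space)
  have r: "\<bar>\<rho>\<bar> \<le> 1" using gauss_two_linear_forms(1)[OF assms(1-3)] by (simp add: \<rho>_def)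
  have "\<bar>level_coeff u * \<rho>\<bar> \<le> 1 * 1"
    unfolding abs_mult using r abs_level_coeff_le_1[of u] by (intro mult_mono) auto
  moreover have "(1 / 2)\<^sup>2 \<le> \<bar>\<rho>\<bar>\<^sup>2" using False by (intro power_mono) auto
  then have "1 \<le> 4 * \<rho>\<^sup>2" by (simp add: power2_eq_square)
  ultimately show ?thesis using 1 by linarith
next
  case True
  let ?N = "std_normal_distribution"
  interpret N: pair_prob_space ?N ?N by unfold_locales
  have "\<rho>\<^sup>2 \<le> (1 / 2)\<^sup>2" using power_mono[OF True, of 2] by simp
  then have r: "\<rho>\<^sup>2 \<le> 1 / 4" by (simp add: power2_eq_square)
  define s where "s = sqrt (1 - \<rho>\<^sup>2)"
  have s: "s > 0" using r by (simp add: s_def)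
  let ?f = "\<lambda>(x, y). (indicator {..u} x - Phi u) * (indicator {..u} y - Phi u)"
  have bound: "\<bar>(indicator A x - Phi u) * (indicator B y - Phi u)\<bar> \<le> 1" for A B and x y :: real
    by (intro abs_mult_le_1 abs_indicator_minus_Phi_le_1)
  have "?C = (\<integral>z. ?f z \<partial>distr (gauss I) (borel \<Otimes>\<^sub>M borel) (\<lambda>g. (\<Sum>i\<in>I. a i * g i, \<Sum>i\<in>I. b i * g i)))"
    by (subst integral_distr) auto
  also have "\<dots> = (\<integral>z. ?f (case z of (x, y) \<Rightarrow> (x, \<rho> * x + s * y)) \<partial>(?N \<Otimes>\<^sub>M ?N))"
    unfolding gauss_two_linear_forms(2)[OF assms(1-3)] \<rho>_def[symmetric] s_def[symmetric]
    by (rule integral_distr) auto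
  also have "\<dots> = (\<integral>x. \<integral>y. ?f (x, \<rho> * x + s * y) \<partial>?N \<partial>?N)"
  proof -
    have "integrable (?N \<Otimes>\<^sub>M ?N) (\<lambda>z. ?f (case z of (x, y) \<Rightarrow> (x, \<rho> * x + s * y)))"
      by (rule N.integrable_const_bound[of _ 1]) (use bound in \<open>auto simp: case_prod_unfold\<close>)
    from N.integral_fst'[OF this] show ?thesis by simp
  qed
  also have "\<dots> = (\<integral>x. (indicator {..u} x - Phi u) * (Phi ((u - \<rho> * x) / s) - Phi u) \<partial>?N)"
  proof (rule Bochner_Integration.integral_cong)
    fix x
    have "integrable ?N (\<lambda>y. indicator {..u} (\<rho> * x + s * y) :: real)"
      by (rule std_normal.integrable_const_bound[of _ 1]) (auto simp: indicator_def)
    then show "(\<integral>y. ?f (x, \<rho> * x + s * y) \<partial>?N) = (indicator {..u} x - Phi u) * (Phi ((u - \<rho> * x) / s) - Phi u)"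
      using std_normal_affine_cdf[OF s, of u "\<rho> * x"] std_normal.prob_space by simp
  qed simp
  finally have C: "?C = \<dots>" .
  have mPhi[measurable]: "Phi \<in> borel_measurable borel"
    by (intro borel_measurable_continuous_onI) (auto simp: continuous_on_eq_continuous_at isCont_Phi)
  have int1: "integrable ?N (\<lambda>x. (indicator {..u} x - Phi u) * (Phi ((u - \<rho> * x) / s) - Phi u))"
  proof (rule std_normal.integrable_const_bound[of _ 1])
    show "AE x in ?N. norm ((indicator {..u} x - Phi u) * (Phi ((u - \<rho> * x) / s) - Phi u)) \<le> 1"
      unfolding real_norm_def by (intro AE_I2 abs_mult_le_1 abs_indicator_minus_Phi_le_1 abs_Phi_diff_le_1)
  qed measurable
  note int2 = integrable_mult_right[OF integrable_level_coeff, of "\<rho> * std_normal_density u" u]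
  have "?C - level_coeff u * \<rho> = (\<integral>x. (indicator {..u} x - Phi u) * (Phi ((u - \<rho> * x) / s) - Phi u) \<partial>?N) +
      (\<integral>x. \<rho> * std_normal_density u * ((indicator {..u} x - Phi u) * x) \<partial>?N)"
    unfolding C level_coeff_def by simp
  also have "\<dots> = (\<integral>x. (indicator {..u} x - Phi u) * (Phi ((u - \<rho> * x) / s) - Phi u + \<rho> * x * std_normal_density u) \<partial>?N)"
    by (subst Bochner_Integration.integral_add[OF int1 int2, symmetric])
       (auto intro!: Bochner_Integration.integral_cong simp: algebra_simps)
  finally have e: "?C - level_coeff u * \<rho> = \<dots>" .
  have "\<bar>?C - level_coeff u * \<rho>\<bar> \<le> (\<integral>x. (3 + x\<^sup>2 / 2) * \<rho>\<^sup>2 \<partial>?N)"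
    unfolding e
  proof (rule order.trans[OF integral_abs_bound], rule integral_mono')
    show "integrable ?N (\<lambda>x. (3 + x\<^sup>2 / 2) * \<rho>\<^sup>2)" using std_normal_moments by auto
    fix x
    have "\<bar>(indicator {..u} x - Phi u) * (Phi ((u - \<rho> * x) / s) - Phi u + \<rho> * x * std_normal_density u)\<bar>
        \<le> 1 * ((3 + x\<^sup>2 / 2) * \<rho>\<^sup>2)"
      unfolding abs_mult using Phi_conditional_expansion[OF True, of u x]
      by (intro mult_mono abs_indicator_minus_Phi_le_1) (auto simp: s_def)
    then show "\<bar>(indicator {..u} x - Phi u) * (Phi ((u - \<rho> * x) / s) - Phi u + \<rho> * x * std_normal_density u)\<bar>
        \<le> (3 + x\<^sup>2 / 2) * \<rho>\<^sup>2" by simp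
  qed simp
  also have "\<dots> = (3 + 1 / 2) * \<rho>\<^sup>2"
    using std_normal_moments std_normal.prob_space by simp
  also have "\<dots> \<le> 8 * \<rho>\<^sup>2" by (intro mult_right_mono) auto
  finally show ?thesis .
qed

text \<open>
  The variables \<open>(g i)\<^sup>2 - 1\<close> are independent and centred, so only the diagonal of the squared sum
  contributes, each entry being \<open>3 - 2 + 1 = 2\<close>.
\<close>

lemma gauss_centered_norm_second_moment:
  assumes "finite I"
  shows "integrable (gauss I) (\<lambda>g. (\<Sum>i\<in>I. (g i)\<^sup>2 - 1)\<^sup>2)"
    and "(\<integral>g. (\<Sum>i\<in>I. (g i)\<^sup>2 - 1)\<^sup>2 \<partial>gauss I) = 2 * real (card I)"
proof -
  let ?N = "std_normal_distribution"
  interpret product_sigma_finite "\<lambda>_::'a. ?N" by unfold_locales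
  define h :: "'a \<Rightarrow> 'a \<Rightarrow> 'a \<Rightarrow> real \<Rightarrow> real" where
    \<comment> \<open>the factor of coordinate \<open>k\<close> in the product of the \<open>i\<close>-th and the \<open>j\<close>-th summand\<close>
    "h i j k x = (if k = i then x\<^sup>2 - 1 else 1) * (if k = j then x\<^sup>2 - 1 else 1)" for i j k x
  have int_h: "integrable ?N (h i j k)" for i j k
  proof -
    have 1: "integrable ?N (\<lambda>x. x\<^sup>2 - 1)" using std_normal_moments by simp
    have "integrable ?N (\<lambda>x. x ^ 4 - 2 * x\<^sup>2 + 1)" using std_normal_moments by simp
    moreover have "(\<lambda>x::real. x ^ 4 - 2 * x\<^sup>2 + 1) = (\<lambda>x. (x\<^sup>2 - 1) * (x\<^sup>2 - 1))"
      by (simp add: fun_eq_iff power2_eq_square power4_eq_xxxx algebra_simps)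
    ultimately have 2: "integrable ?N (\<lambda>x. (x\<^sup>2 - 1) * (x\<^sup>2 - 1))" by simp
    show ?thesis
      unfolding h_def using 1 2 by (cases "k = i"; cases "k = j") simp_all
  qed
  have eq: "(\<Prod>k\<in>I. h i j k (g k)) = ((g i)\<^sup>2 - 1) * ((g j)\<^sup>2 - 1)" if "i \<in> I" "j \<in> I" for i j g
    unfolding h_def prod.distrib using that assms by (simp add: prod.delta)
  have sq: "(\<Sum>i\<in>I. (g i)\<^sup>2 - 1)\<^sup>2 = (\<Sum>i\<in>I. \<Sum>j\<in>I. \<Prod>k\<in>I. h i j k (g k))" for g
    by (simp add: power2_eq_square[of "sum _ _"] sum_product eq)
  have int: "integrable (gauss I) (\<lambda>g. \<Prod>k\<in>I. h i j k (g k))" for i j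
    using assms int_h by (intro product_integrable_prod) auto
  then show "integrable (gauss I) (\<lambda>g. (\<Sum>i\<in>I. (g i)\<^sup>2 - 1)\<^sup>2)" unfolding sq by auto
  have prod: "(\<integral>g. (\<Prod>k\<in>I. h i j k (g k)) \<partial>gauss I) = (if i = j then 2 else 0)" if "i \<in> I" "j \<in> I" for i j
  proof -
    have E1: "(\<integral>x. x\<^sup>2 - 1 \<partial>?N) = 0" using std_normal_moments std_normal.prob_space by simp
    have E2: "(\<integral>x. (x\<^sup>2 - 1) * (x\<^sup>2 - 1) \<partial>?N) = 2"
    proof -
      have "(\<integral>x. (x\<^sup>2 - 1) * (x\<^sup>2 - 1) \<partial>?N) = (\<integral>x. x ^ 4 - 2 * x\<^sup>2 + 1 \<partial>?N)"
        by (intro Bochner_Integration.integral_cong) (auto simp: power2_eq_square power4_eq_xxxx algebra_simps)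
      then show ?thesis using std_normal_moments std_normal.prob_space by simp
    qed
    have "(\<integral>g. (\<Prod>k\<in>I. h i j k (g k)) \<partial>gauss I) = (\<Prod>k\<in>I. \<integral>x. h i j k x \<partial>?N)"
      using assms int_h by (intro product_integral_prod) auto
    also have "\<dots> = (if i = j then 2 else 0)"
    proof (cases "i = j")
      case True
      have "(\<integral>x. h i j k x \<partial>?N) = (if k = i then 2 else 1)" for k
        using True E2 std_normal.prob_space by (simp add: h_def)
      then show ?thesis using True that assms by (simp add: prod.delta')
    next
      case False
      have "(\<integral>x. h i j i x \<partial>?N) = 0" using False E1 by (simp add: h_def)
      then show ?thesis using False that assms by (auto simp: prod_zero_iff)
    qed
    finally show ?thesis .
  qed
  have "(\<integral>g. (\<Sum>i\<in>I. (g i)\<^sup>2 - 1)\<^sup>2 \<partial>gauss I) = (\<Sum>i\<in>I. \<Sum>j\<in>I. \<integral>g. (\<Prod>k\<in>I. h i j k (g k)) \<partial>gauss I)"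
    unfolding sq using int by simp
  also have "\<dots> = (\<Sum>i\<in>I. \<Sum>j\<in>I. if i = j then 2 else 0)"
    by (intro sum.cong refl prod)
  also have "\<dots> = 2 * real (card I)" using assms by simp
  finally show "(\<integral>g. (\<Sum>i\<in>I. (g i)\<^sup>2 - 1)\<^sup>2 \<partial>gauss I) = 2 * real (card I)" .
qed

section \<open>The uniform measure on the sphere as the direction of a Gaussian vector\<close>

lemma nn_integral_layer_cake_gauss:
  fixes s :: real
  assumes "s \<ge> 0"
  shows "(\<integral>\<^sup>+t. ennreal (t * exp (- t\<^sup>2 / 2)) * indicator {s..} t \<partial>lborel) = ennreal (exp (- s\<^sup>2 / 2))"
proof -
  have "(\<integral>\<^sup>+t. ennreal (t * exp (- t\<^sup>2 / 2)) * indicator {s..} t \<partial>lborel) = ennreal (0 - (- exp (- s\<^sup>2 / 2)))"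
  proof (rule nn_integral_FTC_atLeast)
    show "((\<lambda>t::real. - exp (- t\<^sup>2 / 2)) has_real_derivative t * exp (- t\<^sup>2 / 2)) (at t)" for t
      by (auto intro!: derivative_eq_intros)
    have "LIM t at_top. t\<^sup>2 / 2 :> (at_top :: real filter)"
    proof (rule filterlim_at_top_mono[OF filterlim_ident])
      show "\<forall>\<^sub>F t in at_top. t \<le> t\<^sup>2 / (2::real)"
        using eventually_ge_at_top[of 2] by eventually_elim (auto simp: power2_eq_square)
    qed
    then have "((\<lambda>t::real. exp (- (t\<^sup>2 / 2))) \<longlongrightarrow> 0) at_top"
      by (intro filterlim_compose[OF exp_at_bot]) (simp add: filterlim_uminus_at_bot)
    from tendsto_minus[OF this] show "((\<lambda>t::real. - exp (- t\<^sup>2 / 2)) \<longlongrightarrow> 0) at_top" by simp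
  qed (use assms in auto)
  then show ?thesis by simp
qed

lemma gauss_eq_density:
  fixes I :: "'i set"
  assumes I: "finite I"
  shows "gauss I = density (PiM I (\<lambda>_. lborel)) (\<lambda>g. ennreal ((1 / sqrt (2 * pi)) ^ card I * exp (- (L2_set g I)\<^sup>2 / 2)))"
proof -
  interpret N: product_sigma_finite "\<lambda>_::'i. std_normal_distribution" by unfold_locales
  interpret L: product_sigma_finite "\<lambda>_::'i. lborel :: real measure" by unfold_locales
  have dens: "ennreal ((1 / sqrt (2 * pi)) ^ card I * exp (- (L2_set g I)\<^sup>2 / 2)) = (\<Prod>i\<in>I. ennreal (std_normal_density (g i)))" for g
  proof -
    have "(\<Prod>i\<in>I. std_normal_density (g i)) = (1 / sqrt (2 * pi)) ^ card I * exp (\<Sum>i\<in>I. - (g i)\<^sup>2 / 2)"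
      using I by (simp add: std_normal_density_def prod_dividef exp_sum power_divide)
    also have "(\<Sum>i\<in>I. - (g i)\<^sup>2 / 2) = - (L2_set g I)\<^sup>2 / 2"
      by (simp add: L2_set_def sum_nonneg sum_negf sum_divide_distrib[symmetric])
    finally show ?thesis by (simp add: prod_ennreal normal_density_nonneg)
  qed
  show ?thesis
    unfolding dens
  proof (rule N.PiM_eqI[OF I, symmetric])
    show "sets (density (PiM I (\<lambda>_. lborel)) (\<lambda>g. \<Prod>i\<in>I. ennreal (std_normal_density (g i)))) = sets (gauss I)"
      by (auto intro!: sets_PiM_cong)
    fix A :: "'i \<Rightarrow> real set" assume A: "\<And>i. i \<in> I \<Longrightarrow> A i \<in> sets std_normal_distribution"
    then have A': "\<And>i. i \<in> I \<Longrightarrow> A i \<in> sets borel" by simp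
    have ind: "indicator (Pi\<^sub>E I A) g = (\<Prod>i\<in>I. indicator (A i) (g i) :: ennreal)" if "g \<in> space (PiM I (\<lambda>_. lborel :: real measure))" for g
      using that I by (auto simp: space_PiM PiE_iff indicator_def prod_zero_iff intro: prod.neutral)
    have "emeasure (density (PiM I (\<lambda>_. lborel)) (\<lambda>g. \<Prod>i\<in>I. ennreal (std_normal_density (g i)))) (Pi\<^sub>E I A) =
        (\<integral>\<^sup>+g. (\<Prod>i\<in>I. ennreal (std_normal_density (g i))) * indicator (Pi\<^sub>E I A) g \<partial>PiM I (\<lambda>_. lborel))"
      using A' I by (intro emeasure_density) (auto intro!: sets_PiM_I_finite)
    also have "\<dots> = (\<integral>\<^sup>+g. (\<Prod>i\<in>I. ennreal (std_normal_density (g i)) * indicator (A i) (g i)) \<partial>PiM I (\<lambda>_. lborel))"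
      by (intro nn_integral_cong) (simp add: ind prod.distrib)
    also have "\<dots> = (\<Prod>i\<in>I. \<integral>\<^sup>+x. ennreal (std_normal_density x) * indicator (A i) x \<partial>lborel)"
      using I A' by (intro L.product_nn_integral_prod) auto
    also have "\<dots> = (\<Prod>i\<in>I. emeasure std_normal_distribution (A i))"
      using A' by (intro prod.cong) (auto simp: emeasure_density)
    finally show "emeasure (density (PiM I (\<lambda>_. lborel)) (\<lambda>g. \<Prod>i\<in>I. ennreal (std_normal_density (g i)))) (Pi\<^sub>E I A) =
       (\<Prod>i\<in>I. emeasure std_normal_distribution (A i))" .
  qed
qed

lemma emeasure_lborel_divide:
  fixes A :: "real set"
  assumes "t > 0" and [measurable]: "A \<in> sets borel"
  shows "emeasure lborel {x. x / t \<in> A} = ennreal t * emeasure lborel A"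
proof -
  have [measurable]: "{x. x / t \<in> A} \<in> sets borel" by measurable
  have "emeasure lborel {x. x / t \<in> A} = (\<integral>\<^sup>+x. indicator A (x / t) \<partial>lborel)"
  proof -
    have "(\<lambda>x. indicator A (x / t) :: ennreal) = indicator {x. x / t \<in> A}"
      by (auto simp: indicator_def fun_eq_iff)
    then show ?thesis by simp
  qed
  also have "\<dots> = ennreal t * (\<integral>\<^sup>+x. indicator A x \<partial>lborel)"
    using assms(1) by (subst nn_integral_real_affine[of _ t 0]) auto
  finally show ?thesis by simp
qed

lemma emeasure_PiM_lborel_divide:
  fixes I :: "'i set" and S :: "('i \<Rightarrow> real) set"
  assumes I: "finite I" and t: "t > 0" and S[measurable]: "S \<in> sets (PiM I (\<lambda>_. lborel))"
  shows "emeasure (PiM I (\<lambda>_. lborel)) {a \<in> space (PiM I (\<lambda>_. lborel)). (\<lambda>i\<in>I. a i / t) \<in> S} =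
     ennreal (t ^ card I) * emeasure (PiM I (\<lambda>_. lborel)) S"
proof -
  let ?L = "PiM I (\<lambda>_. lborel) :: ('i \<Rightarrow> real) measure"
  interpret L: product_sigma_finite "\<lambda>_::'i. lborel :: real measure" by unfold_locales
  have m[measurable]: "(\<lambda>a. \<lambda>i\<in>I. a i / t) \<in> ?L \<rightarrow>\<^sub>M ?L" by measurable
  have "?L = scale_measure (ennreal (1 / t ^ card I)) (distr ?L ?L (\<lambda>a. \<lambda>i\<in>I. a i / t))"
  proof (rule L.PiM_eqI[OF I, symmetric])
    fix A :: "'i \<Rightarrow> real set" assume "\<And>i. i \<in> I \<Longrightarrow> A i \<in> sets lborel"
    then have A: "\<And>i. i \<in> I \<Longrightarrow> A i \<in> sets borel" by simp
    have "(\<lambda>a. \<lambda>i\<in>I. a i / t) -` (Pi\<^sub>E I A) \<inter> space ?L = Pi\<^sub>E I (\<lambda>i. {x. x / t \<in> A i})"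
      by (auto simp: space_PiM PiE_iff)
    moreover have "Pi\<^sub>E I A \<in> sets ?L" using A I by (intro sets_PiM_I_finite) auto
    ultimately have "emeasure (distr ?L ?L (\<lambda>a. \<lambda>i\<in>I. a i / t)) (Pi\<^sub>E I A) = emeasure ?L (Pi\<^sub>E I (\<lambda>i. {x. x / t \<in> A i}))"
      by (simp add: emeasure_distr)
    also have "\<dots> = (\<Prod>i\<in>I. emeasure lborel {x. x / t \<in> A i})"
    proof (rule L.emeasure_PiM[OF I])
      fix i assume "i \<in> I"
      then have [measurable]: "A i \<in> sets borel" by (rule A)
      show "{x. x / t \<in> A i} \<in> sets lborel" by measurable
    qed
    also have "\<dots> = (\<Prod>i\<in>I. ennreal t * emeasure lborel (A i))"
      using A t by (intro prod.cong emeasure_lborel_divide) auto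
    also have "\<dots> = ennreal (t ^ card I) * (\<Prod>i\<in>I. emeasure lborel (A i))"
      using t by (simp add: prod.distrib ennreal_power)
    finally show "emeasure (scale_measure (ennreal (1 / t ^ card I)) (distr ?L ?L (\<lambda>a. \<lambda>i\<in>I. a i / t))) (Pi\<^sub>E I A)
        = (\<Prod>i\<in>I. emeasure lborel (A i))"
      using t by (simp add: mult.assoc[symmetric] ennreal_mult[symmetric])
  qed simp
  then have "emeasure ?L S = ennreal (1 / t ^ card I) * emeasure (distr ?L ?L (\<lambda>a. \<lambda>i\<in>I. a i / t)) S"
    by (metis emeasure_scale_measure)
  then have "ennreal (t ^ card I) * emeasure ?L S = emeasure (distr ?L ?L (\<lambda>a. \<lambda>i\<in>I. a i / t)) S"
    using t by (simp add: mult.assoc[symmetric] ennreal_mult[symmetric])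
  also have "\<dots> = emeasure ?L ((\<lambda>a. \<lambda>i\<in>I. a i / t) -` S \<inter> space ?L)" by (rule emeasure_distr) measurable
  also have "(\<lambda>a. \<lambda>i\<in>I. a i / t) -` S \<inter> space ?L = {a \<in> space ?L. (\<lambda>i\<in>I. a i / t) \<in> S}" by auto
  finally show ?thesis by simp
qed

lemma L2_set_divide:
  assumes "t > 0"
  shows "L2_set (\<lambda>i. a i / t) I = L2_set a I / t"
proof -
  have "L2_set (\<lambda>i. 1 / t * a i) I = 1 / t * L2_set a I"
    using assms by (subst L2_set_right_distrib) auto
  then show ?thesis by simp
qed

text \<open>
  By the layer-cake formula the Gaussian measure is a mixture of the uniform measures on centred balls.
  On a cone all these balls have proportional content, so the Gaussian measure of a cone is a universal
  multiple of the Lebesgue measure of its part in the unit ball.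
\<close>

lemma gauss_cone:
  fixes C :: "('i \<Rightarrow> real) set"
  assumes I: "finite I" and C[measurable]: "C \<in> sets (PiM I (\<lambda>_. lborel))"
    and pos: "\<And>a. a \<in> C \<Longrightarrow> L2_set a I > 0"
    and cone: "\<And>a t. a \<in> space (PiM I (\<lambda>_. lborel :: real measure)) \<Longrightarrow> t > 0 \<Longrightarrow> (\<lambda>i\<in>I. a i / t) \<in> C \<longleftrightarrow> a \<in> C"
  shows "emeasure (gauss I) C =
      (\<integral>\<^sup>+t. ennreal ((1 / sqrt (2 * pi)) ^ card I) * (ennreal (t * exp (- t\<^sup>2 / 2)) * indicator {0<..} t * ennreal (t ^ card I)) \<partial>lborel) *
      emeasure (PiM I (\<lambda>_. lborel)) {a \<in> C. L2_set a I \<le> 1}"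
proof -
  let ?L = "PiM I (\<lambda>_. lborel) :: ('i \<Rightarrow> real) measure"
  let ?k = "(1 / sqrt (2 * pi)) ^ card I"
  interpret L: product_sigma_finite "\<lambda>_::'i. lborel :: real measure" by unfold_locales
  interpret PL: sigma_finite_measure ?L using I by (rule L.sigma_finite)
  interpret P: pair_sigma_finite ?L lborel by unfold_locales
  have L2[measurable]: "(\<lambda>a. L2_set a I) \<in> borel_measurable ?L"
    unfolding L2_set_def by measurable
  have sp: "C \<subseteq> space ?L" using sets.sets_into_space[OF C] .
  have sets1[measurable]: "{a \<in> C. L2_set a I \<le> t} \<in> sets ?L" for t
  proof -
    have "{a \<in> C. L2_set a I \<le> t} = {a \<in> space ?L. a \<in> C \<and> L2_set a I \<le> t}" using sp by auto
    also have "\<dots> \<in> sets ?L" by measurable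
    finally show ?thesis .
  qed
  have "emeasure (gauss I) C = (\<integral>\<^sup>+a. ennreal (?k * exp (- (L2_set a I)\<^sup>2 / 2)) * indicator C a \<partial>?L)"
    unfolding gauss_eq_density[OF I] by (rule emeasure_density) measurable
  also have "\<dots> = (\<integral>\<^sup>+a. \<integral>\<^sup>+t. ennreal ?k * (ennreal (t * exp (- t\<^sup>2 / 2)) * indicator {0<..} t * (indicator C a * indicator {..t} (L2_set a I))) \<partial>lborel \<partial>?L)"
  proof (rule nn_integral_cong)
    fix a
    show "ennreal (?k * exp (- (L2_set a I)\<^sup>2 / 2)) * indicator C a =
      (\<integral>\<^sup>+t. ennreal ?k * (ennreal (t * exp (- t\<^sup>2 / 2)) * indicator {0<..} t * (indicator C a * indicator {..t} (L2_set a I))) \<partial>lborel)"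
    proof (cases "a \<in> C")
      case True
      have "ennreal (?k * exp (- (L2_set a I)\<^sup>2 / 2)) = ennreal ?k * ennreal (exp (- (L2_set a I)\<^sup>2 / 2))"
        by (rule ennreal_mult) auto
      also have "\<dots> = ennreal ?k * (\<integral>\<^sup>+t. ennreal (t * exp (- t\<^sup>2 / 2)) * indicator {L2_set a I..} t \<partial>lborel)"
        by (subst nn_integral_layer_cake_gauss) simp_all
      also have "\<dots> = (\<integral>\<^sup>+t. ennreal ?k * (ennreal (t * exp (- t\<^sup>2 / 2)) * indicator {L2_set a I..} t) \<partial>lborel)"
        by (rule nn_integral_cmult[symmetric]) measurable
      finally show ?thesis using True pos[OF True]
        by (auto intro!: nn_integral_cong simp: indicator_def)
    qed simp
  qed
  also have "\<dots> = (\<integral>\<^sup>+t. \<integral>\<^sup>+a. ennreal ?k * (ennreal (t * exp (- t\<^sup>2 / 2)) * indicator {0<..} t * (indicator C a * indicator {..t} (L2_set a I))) \<partial>?L \<partial>lborel)"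
  proof (rule P.Fubini'[symmetric])
    have "(\<lambda>z. indicator {..snd z} (L2_set (fst z) I) :: ennreal) = (\<lambda>z. if L2_set (fst z) I \<le> snd z then 1 else 0)"
      by (auto simp: indicator_def)
    also have "\<dots> \<in> borel_measurable (?L \<Otimes>\<^sub>M lborel)" by measurable
    finally have [measurable]: "(\<lambda>z. indicator {..snd z} (L2_set (fst z) I) :: ennreal) \<in> borel_measurable (?L \<Otimes>\<^sub>M lborel)" .
    show "(\<lambda>(a, t). ennreal ?k * (ennreal (t * exp (- t\<^sup>2 / 2)) * indicator {0<..} t * (indicator C a * indicator {..t} (L2_set a I)))) \<in> borel_measurable (?L \<Otimes>\<^sub>M lborel)"
      unfolding case_prod_unfold by measurable
  qed
  also have "\<dots> = (\<integral>\<^sup>+t. ennreal ?k * (ennreal (t * exp (- t\<^sup>2 / 2)) * indicator {0<..} t * ennreal (t ^ card I)) * emeasure ?L {a \<in> C. L2_set a I \<le> 1} \<partial>lborel)"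
  proof (rule nn_integral_cong)
    fix t :: real
    show "(\<integral>\<^sup>+a. ennreal ?k * (ennreal (t * exp (- t\<^sup>2 / 2)) * indicator {0<..} t * (indicator C a * indicator {..t} (L2_set a I))) \<partial>?L) =
        ennreal ?k * (ennreal (t * exp (- t\<^sup>2 / 2)) * indicator {0<..} t * ennreal (t ^ card I)) * emeasure ?L {a \<in> C. L2_set a I \<le> 1}"
    proof (cases "t > 0")
      case True
      have "{a \<in> C. L2_set a I \<le> t} = {a \<in> space ?L. (\<lambda>i\<in>I. a i / t) \<in> {a \<in> C. L2_set a I \<le> 1}}"
      proof -
        have "L2_set (\<lambda>i\<in>I. a i / t) I = L2_set a I / t" for a
          using L2_set_divide[OF True, of a I] by (subst L2_set_cong[OF refl]) auto
        then have "L2_set (\<lambda>i\<in>I. a i / t) I \<le> 1 \<longleftrightarrow> L2_set a I \<le> t" for a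
          using True by (simp add: divide_le_eq)
        then show ?thesis using sp cone[OF _ True] by auto
      qed
      then have "emeasure ?L {a \<in> C. L2_set a I \<le> t} = ennreal (t ^ card I) * emeasure ?L {a \<in> C. L2_set a I \<le> 1}"
        using emeasure_PiM_lborel_divide[OF I True sets1] by simp
      moreover have "(\<integral>\<^sup>+a. ennreal ?k * (ennreal (t * exp (- t\<^sup>2 / 2)) * indicator {0<..} t * (indicator C a * indicator {..t} (L2_set a I))) \<partial>?L)
         = (\<integral>\<^sup>+a. ennreal ?k * ennreal (t * exp (- t\<^sup>2 / 2)) * indicator {a \<in> C. L2_set a I \<le> t} a \<partial>?L)"
        using True by (intro nn_integral_cong) (auto simp: indicator_def)
      ultimately show ?thesis using True by (simp add: nn_integral_cmult mult.assoc)
    qed simp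
  qed
  also have "\<dots> = (\<integral>\<^sup>+t. ennreal ?k * (ennreal (t * exp (- t\<^sup>2 / 2)) * indicator {0<..} t * ennreal (t ^ card I)) \<partial>lborel) *
      emeasure ?L {a \<in> C. L2_set a I \<le> 1}"
    by (rule nn_integral_multc) measurable
  finally show ?thesis .
qed

definition direction :: "nat \<Rightarrow> (nat \<Rightarrow> real) \<Rightarrow> nat \<Rightarrow> real" where
  "direction n a = (\<lambda>i\<in>{1..n}. a i / L2_set a {1..n})"

lemma AE_gauss_L2_set_pos:
  fixes n :: nat
  assumes "n \<ge> 1"
  shows "AE g in gauss {1..n}. L2_set g {1..n} > 0"
proof -
  have "AE x in std_normal_distribution. x \<noteq> 0"
    by (subst AE_density) (auto intro!: AE_I'[of "{0}"])
  then have "AE g in gauss {1..n}. g 1 \<noteq> 0"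
    by (rule AE_PiM_component[rotated 2]) (use assms in \<open>auto intro: std_normal.prob_space_axioms\<close>)
  then show ?thesis
  proof eventually_elim
    case (elim g)
    have "L2_set g {1..n} \<noteq> 0" using elim assms by (auto simp: L2_set_eq_0_iff)
    then show ?case using L2_set_nonneg[of g "{1..n}"] by linarith
  qed
qed

lemma ennreal_mult_eq_divide:
  fixes K b x :: ennreal
  assumes K: "K * b = 1"
  shows "K * x = x / b"
proof -
  have "b \<noteq> 0" using K by auto
  moreover have "b \<noteq> top"
  proof
    assume "b = top"
    then have "K \<noteq> 0" using K by auto
    then have "K * b = top" using \<open>b = top\<close> by (simp add: ennreal_mult_eq_top_iff)
    then show False using K by simp
  qed
  ultimately have "(K * x) * b / b = K * x" by (rule ennreal_mult_divide_eq)
  moreover have "(K * x) * b = x" using K by (simp add: mult.assoc mult.commute[of x] flip: mult.assoc[of K b])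
  ultimately show ?thesis by simp
qed

text \<open>
  Both sides are multiples of the Lebesgue measure of the cone over \<open>A\<close> intersected with the unit ball,
  with factors independent of \<open>A\<close>. The factors agree since both sides have total mass 1, the Gaussian
  vector being nonzero almost surely.
\<close>

lemma emeasure_coord_sphere_measure:
  assumes n: "n \<ge> 1" and A: "A \<in> sets (coord_sphere_measure n)"
  shows "emeasure (coord_sphere_measure n) A =
     emeasure (gauss {1..n}) {g \<in> space (gauss {1..n}). L2_set g {1..n} > 0 \<and> direction n g \<in> A}"
proof -
  let ?I = "{1..n}"
  let ?L = "PiM ?I (\<lambda>_. lborel) :: (nat \<Rightarrow> real) measure"
  let ?B = "{a \<in> ?I \<rightarrow>\<^sub>E (UNIV::real set). 0 < L2_set a ?I \<and> L2_set a ?I \<le> 1}"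
  let ?R = "restrict_space (uniform_measure ?L ?B) ?B"
  let ?S = "restrict_space (PiM ?I (\<lambda>_. borel)) (coord_sphere n)"
  have spL: "space ?L = ?I \<rightarrow>\<^sub>E UNIV" by (simp add: space_PiM)
  have sets_eq: "sets (gauss ?I) = sets ?L" "space (gauss ?I) = space ?L"
    by (auto intro!: sets_PiM_cong simp: space_PiM)
  have L2[measurable]: "(\<lambda>a. L2_set a ?I) \<in> borel_measurable ?L"
    unfolding L2_set_def by measurable
  have B[measurable]: "?B \<in> sets ?L"
  proof -
    have "?B = {a \<in> space ?L. 0 < L2_set a ?I \<and> L2_set a ?I \<le> 1}" by (simp only: spL)
    also have "\<dots> \<in> sets ?L" by measurable
    finally show ?thesis .
  qed
  have dir: "direction n \<in> ?L \<rightarrow>\<^sub>M PiM ?I (\<lambda>_. borel)"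
    unfolding direction_def by (intro measurable_restrict borel_measurable_divide L2) measurable
  have dir_norm: "L2_set (direction n a) ?I = 1" if "L2_set a ?I > 0" for a
  proof -
    have "L2_set (direction n a) ?I = L2_set (\<lambda>i. a i / L2_set a ?I) ?I"
      by (rule L2_set_cong) (auto simp: direction_def)
    then show ?thesis using that by (simp add: L2_set_divide)
  qed
  have dir_S: "direction n a \<in> coord_sphere n" if "L2_set a ?I > 0" for a
    using dir_norm[OF that] by (auto simp: coord_sphere_def direction_def)
  have setsA: "sets (coord_sphere_measure n) = sets ?S"
    by (simp add: coord_sphere_measure_def Let_def)
  define cone where "cone A = {a \<in> space ?L. L2_set a ?I > 0 \<and> direction n a \<in> A}" for A
  have cone_sets: "cone A \<in> sets ?L" if A: "A \<in> sets ?S" for A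
  proof -
    obtain A' where A': "A' \<in> sets (PiM ?I (\<lambda>_. borel))" "A = A' \<inter> coord_sphere n"
      using A by (auto simp: sets_restrict_space)
    have "cone A = {a \<in> space ?L. L2_set a ?I > 0} \<inter> (direction n -` A' \<inter> space ?L)"
      using dir_S by (auto simp: cone_def A'(2))
    also have "\<dots> \<in> sets ?L" using measurable_sets[OF dir A'(1)] by measurable
    finally show ?thesis .
  qed
  \<comment> \<open>the mixing constant of \<open>gauss_cone\<close>; \<open>A\<close> being the whole sphere shows \<open>K * emeasure ?L ?B = 1\<close>\<close>
  define K where "K = (\<integral>\<^sup>+t. ennreal ((1 / sqrt (2 * pi)) ^ card ?I) * (ennreal (t * exp (- t\<^sup>2 / 2)) * indicator {0<..} t * ennreal (t ^ card ?I)) \<partial>lborel)"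
  have gauss_K: "emeasure (gauss ?I) (cone A) = K * emeasure ?L (?B \<inter> cone A)" if A: "A \<in> sets ?S" for A
  proof -
    have "emeasure (gauss ?I) (cone A) = K * emeasure ?L {a \<in> cone A. L2_set a ?I \<le> 1}"
      unfolding K_def
    proof (rule gauss_cone[OF _ cone_sets[OF A]])
      fix a and t :: real assume a: "a \<in> space ?L" and t: "t > 0"
      have "L2_set (\<lambda>i\<in>?I. a i / t) ?I = L2_set a ?I / t"
        using L2_set_divide[OF t, of a ?I] by (subst L2_set_cong[OF refl]) auto
      moreover from this have "direction n (\<lambda>i\<in>?I. a i / t) = direction n a"
        using t by (auto simp: direction_def fun_eq_iff)
      moreover have "(\<lambda>i\<in>?I. a i / t) \<in> space ?L" by (simp only: spL) auto
      ultimately show "(\<lambda>i\<in>?I. a i / t) \<in> cone A \<longleftrightarrow> a \<in> cone A"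
        using a t by (simp add: cone_def zero_less_divide_iff)
    qed (auto simp: cone_def)
    also have "{a \<in> cone A. L2_set a ?I \<le> 1} = ?B \<inter> cone A"
      unfolding cone_def spL by auto
    finally show ?thesis .
  qed
  have whole: "coord_sphere n \<in> sets ?S"
  proof -
    have "coord_sphere n \<inter> space (PiM ?I (\<lambda>_. borel :: real measure)) = coord_sphere n"
      by (auto simp: coord_sphere_def space_PiM)
    then show ?thesis using sets.top[of ?S] by (simp add: space_restrict_space Int_commute)
  qed
  have coneS: "cone (coord_sphere n) = {a \<in> space ?L. L2_set a ?I > 0}"
    using dir_S by (auto simp: cone_def)
  have BS: "?B \<inter> cone (coord_sphere n) = ?B"
    unfolding coneS spL by auto
  have "emeasure (gauss ?I) (cone (coord_sphere n)) = 1"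
  proof (rule prob_space.emeasure_eq_1_AE[OF prob_space_gauss])
    show "cone (coord_sphere n) \<in> sets (gauss ?I)"
      unfolding sets_eq by (rule cone_sets[OF whole])
    show "AE g in gauss ?I. g \<in> cone (coord_sphere n)"
      using AE_gauss_L2_set_pos[OF n] AE_space unfolding coneS sets_eq[symmetric]
      by eventually_elim simp
  qed
  then have K: "K * emeasure ?L ?B = 1" using gauss_K[OF whole] unfolding BS by simp
  have csm: "emeasure (coord_sphere_measure n) A = emeasure ?L (?B \<inter> cone A) / emeasure ?L ?B" if A: "A \<in> sets ?S" for A
  proof -
    have "direction n \<in> ?R \<rightarrow>\<^sub>M ?S"
    proof (rule measurable_restrict_space3)
      show "direction n \<in> uniform_measure ?L ?B \<rightarrow>\<^sub>M PiM ?I (\<lambda>_. borel)" using dir by simp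
    qed (use dir_S in auto)
    then have "emeasure (coord_sphere_measure n) A = emeasure ?R (direction n -` A \<inter> space ?R)"
      using A unfolding coord_sphere_measure_def Let_def direction_def[symmetric]
      by (subst emeasure_distr) auto
    also have "direction n -` A \<inter> space ?R = ?B \<inter> cone A"
      unfolding space_restrict_space cone_def space_uniform_measure spL by auto
    also have "emeasure ?R (?B \<inter> cone A) = emeasure (uniform_measure ?L ?B) (?B \<inter> cone A)"
      using B by (intro emeasure_restrict_space) auto
    also have "\<dots> = emeasure ?L (?B \<inter> (?B \<inter> cone A)) / emeasure ?L ?B"
      using B cone_sets[OF A] by (intro emeasure_uniform_measure) auto
    finally show ?thesis by (simp add: Int_assoc[symmetric])
  qed
  have A': "A \<in> sets ?S" using A unfolding setsA .
  have "emeasure (coord_sphere_measure n) A = K * emeasure ?L (?B \<inter> cone A)"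
    unfolding csm[OF A'] by (rule ennreal_mult_eq_divide[OF K, symmetric])
  also have "\<dots> = emeasure (gauss ?I) (cone A)" by (rule gauss_K[OF A', symmetric])
  finally show "emeasure (coord_sphere_measure n) A =
     emeasure (gauss ?I) {g \<in> space (gauss ?I). L2_set g ?I > 0 \<and> direction n g \<in> A}"
    unfolding cone_def sets_eq .
qed

section \<open>Invariance of the sphere measure under reflections\<close>

lemma nn_integral_lborel_translate:
  fixes f :: "'a::euclidean_space \<Rightarrow> ennreal"
  assumes [measurable]: "f \<in> borel_measurable borel"
  shows "(\<integral>\<^sup>+x. f (c + x) \<partial>lborel) = (\<integral>\<^sup>+x. f x \<partial>lborel)"
proof -
  have "(\<integral>\<^sup>+x. f x \<partial>lborel) = (\<integral>\<^sup>+x. f x \<partial>distr lborel borel ((+) c))"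
    by (simp add: lborel_distr_plus)
  also have "\<dots> = (\<integral>\<^sup>+x. f (c + x) \<partial>lborel)" by (rule nn_integral_distr) auto
  finally show ?thesis by simp
qed

text \<open>
  Involutions suffice since reflections act transitively on the sphere. Such a map is its own transpose,
  so it induces a symmetric orthogonal matrix on each eigenspace.
\<close>

definition orthogonal_involution :: "('a::euclidean_space \<Rightarrow> 'a) \<Rightarrow> bool" where
  "orthogonal_involution R \<longleftrightarrow> orthogonal_transformation R \<and> (\<forall>x. R (R x) = x)"

lemma orthogonal_involutionD:
  assumes "orthogonal_involution R"
  shows "linear R" "R (R x) = x" "R x \<bullet> R y = x \<bullet> y" "R x \<bullet> y = x \<bullet> R y" "norm (R x) = norm x"
    "bounded_linear R" "R (x + y) = R x + R y" "sgn (R x) = R (sgn x)" "continuous_on A R"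
    "R \<in> borel_measurable borel" "R x = 0 \<longleftrightarrow> x = 0"
proof -
  show l: "linear R" and RR: "\<And>x. R (R x) = x" and inner: "\<And>x y. R x \<bullet> R y = x \<bullet> y"
    using assms by (auto simp: orthogonal_involution_def orthogonal_transformation_def)
  show "R x \<bullet> y = x \<bullet> R y" using inner[of "R x" y] RR[of x] by simp
  show n: "norm (R x) = norm x" for x using inner[of x x] by (simp add: norm_eq_sqrt_inner)
  show bl: "bounded_linear R" using l by (rule linear_conv_bounded_linear[THEN iffD1])
  show "R (x + y) = R x + R y" using l by (rule linear_add)
  show "sgn (R x) = R (sgn x)" using l by (simp add: sgn_div_norm n linear_cmul)
  show "continuous_on A R" by (rule linear_continuous_on[OF bl])
  have "continuous_on UNIV R" by (rule linear_continuous_on[OF bl])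
  then show "R \<in> borel_measurable borel" by (rule borel_measurable_continuous_onI)
  show "R x = 0 \<longleftrightarrow> x = 0" using n[of x] by (metis norm_eq_zero)
qed

text \<open>
  This is the argument for the uniqueness of Haar measure. The double integral of
  \<open>1\<^sub>B (R x) 1\<^sub>U (y - R x)\<close>, with \<open>U\<close> the unit ball, is evaluated in both orders using translation
  invariance: one order gives \<open>|R\<^sup>-\<^sup>1 B| |U|\<close>, the other \<open>|U| |B|\<close> because \<open>R\<close> preserves \<open>U\<close>.
\<close>

lemma emeasure_lborel_vimage_orthogonal_involution:
  fixes R :: "'a::euclidean_space \<Rightarrow> 'a"
  assumes R: "orthogonal_involution R" and B[measurable]: "B \<in> sets borel"
  shows "emeasure lborel (R -` B) = emeasure lborel B"
proof -
  note RD = orthogonal_involutionD[OF R]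
  have [measurable]: "R \<in> borel_measurable borel" by (rule RD)
  let ?U = "ball (0::'a) 1"
  have [measurable]: "?U \<in> sets borel" by simp
  have U: "emeasure lborel ?U \<noteq> 0" "emeasure lborel ?U \<noteq> top"
  proof -
    show "emeasure lborel ?U \<noteq> 0" using content_ball_pos[of 1 "0::'a"] by (auto simp: measure_def)
    show "emeasure lborel ?U \<noteq> top" using emeasure_lborel_ball_finite[of "0::'a" 1] by simp
  qed
  have [measurable]: "R -` B \<in> sets borel" using measurable_sets[of R borel borel B] by simp
  let ?g = "\<lambda>x y. indicator B (R x) * indicator ?U (y - R x) :: ennreal"
  have "emeasure lborel (R -` B) * emeasure lborel ?U = (\<integral>\<^sup>+x. indicator (R -` B) x * emeasure lborel ?U \<partial>lborel)"
    by (simp add: nn_integral_multc)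
  also have "\<dots> = (\<integral>\<^sup>+x. \<integral>\<^sup>+y. ?g x y \<partial>lborel \<partial>lborel)"
  proof (rule nn_integral_cong)
    fix x
    have "emeasure lborel ?U = (\<integral>\<^sup>+y. indicator ?U y \<partial>lborel)" by simp
    also have "\<dots> = (\<integral>\<^sup>+y. indicator ?U (- R x + y) \<partial>lborel)"
      by (rule nn_integral_lborel_translate[symmetric]) simp
    finally have "emeasure lborel ?U = (\<integral>\<^sup>+y. indicator ?U (y - R x) \<partial>lborel)" by simp
    then show "indicator (R -` B) x * emeasure lborel ?U = (\<integral>\<^sup>+y. ?g x y \<partial>lborel)"
      by (subst nn_integral_cmult) (auto simp: indicator_def)
  qed
  also have "\<dots> = (\<integral>\<^sup>+y. \<integral>\<^sup>+x. ?g x y \<partial>lborel \<partial>lborel)"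
    by (rule lborel_pair.Fubini'[symmetric]) measurable
  also have "\<dots> = (\<integral>\<^sup>+y. \<integral>\<^sup>+x. indicator ?U x * indicator B (R x + y) \<partial>lborel \<partial>lborel)"
  proof (rule nn_integral_cong)
    fix y
    \<comment> \<open>\<open>R (R y + x) = y + R x\<close>, so the ball condition becomes \<open>norm (R x) < 1\<close>\<close>
    have "(\<integral>\<^sup>+x. ?g x y \<partial>lborel) = (\<integral>\<^sup>+x. ?g (R y + x) y \<partial>lborel)"
      by (rule nn_integral_lborel_translate[symmetric]) measurable
    also have "\<dots> = (\<integral>\<^sup>+x. indicator ?U x * indicator B (R x + y) \<partial>lborel)"
      by (intro nn_integral_cong) (simp add: RD(2,5,7) indicator_def dist_norm add.commute mult.commute)
    finally show "(\<integral>\<^sup>+x. ?g x y \<partial>lborel) = (\<integral>\<^sup>+x. indicator ?U x * indicator B (R x + y) \<partial>lborel)" .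
  qed
  also have "\<dots> = (\<integral>\<^sup>+x. \<integral>\<^sup>+y. indicator ?U x * indicator B (R x + y) \<partial>lborel \<partial>lborel)"
    by (rule lborel_pair.Fubini') measurable
  also have "\<dots> = (\<integral>\<^sup>+x. indicator ?U x * emeasure lborel B \<partial>lborel)"
  proof (rule nn_integral_cong)
    fix x :: 'a
    have "(\<integral>\<^sup>+y. indicator B (R x + y) \<partial>lborel) = (\<integral>\<^sup>+y. indicator B y \<partial>lborel)"
      by (rule nn_integral_lborel_translate) measurable
    then show "(\<integral>\<^sup>+y. indicator ?U x * indicator B (R x + y) \<partial>lborel) = indicator ?U x * emeasure lborel B"
      by (simp add: nn_integral_cmult)
  qed
  also have "\<dots> = emeasure lborel B * emeasure lborel ?U"
    by (subst nn_integral_multc) (simp_all add: mult.commute)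
  finally have "emeasure lborel (R -` B) * emeasure lborel ?U / emeasure lborel ?U =
      emeasure lborel B * emeasure lborel ?U / emeasure lborel ?U" by (rule arg_cong)
  then show ?thesis unfolding ennreal_mult_divide_eq[OF U] .
qed

text \<open>
  The reflection in the hyperplane orthogonal to \<open>x - y\<close>. For \<open>x = y\<close> the vector \<open>v\<close> below is 0 and the
  map is the identity.
\<close>

lemma reflection_exists:
  fixes x y :: "'a::euclidean_space"
  assumes "norm x = norm y"
  obtains R where "orthogonal_involution R" "R x = y"
proof -
  define v where "v = sgn (x - y)"
  define R where "R z = z - (2 * (v \<bullet> z)) *\<^sub>R v" for z
  have "linear R"
    unfolding R_def by (intro linearI) (auto simp: algebra_simps inner_add_right)
  moreover have vv: "(v \<bullet> v) * a = a" if "x \<noteq> y" for a :: real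
    using that by (simp add: v_def dot_square_norm norm_sgn)
  have v0: "v = 0" if "x = y" using that by (simp add: v_def)
  have "R z \<bullet> R w = z \<bullet> w" for z w
  proof (cases "x = y")
    case False
    have "R z \<bullet> R w = z \<bullet> w - 4 * ((v \<bullet> z) * (v \<bullet> w)) + 4 * ((v \<bullet> v) * ((v \<bullet> z) * (v \<bullet> w)))"
      by (simp add: R_def inner_diff_left inner_diff_right inner_commute algebra_simps)
    then show ?thesis by (simp only: vv[OF False])
  qed (simp add: R_def v0)
  moreover have "R (R z) = z" for z
  proof (cases "x = y")
    case False
    have "v \<bullet> R z = - (v \<bullet> z)"
      using vv[OF False, of "v \<bullet> z"] by (simp add: R_def inner_diff_right algebra_simps)
    then show ?thesis by (simp add: R_def[of "R z"]) (simp add: R_def)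
  qed (simp add: R_def v0)
  ultimately have "orthogonal_involution R"
    by (auto simp: orthogonal_involution_def orthogonal_transformation_def)
  moreover have "R x = y"
  proof (cases "x = y")
    case False
    define r where "r = norm (x - y)"
    have r: "r \<noteq> 0" using False by (simp add: r_def)
    have xy: "x \<bullet> x = y \<bullet> y" using assms by (simp add: dot_square_norm)
    have r2: "r * r = 2 * ((x - y) \<bullet> x)"
      unfolding r_def power2_eq_square[symmetric] power2_norm_eq_inner
      using xy by (simp add: inner_diff_left inner_diff_right inner_commute)
    have "(2 * (v \<bullet> x)) *\<^sub>R v = ((2 * ((x - y) \<bullet> x)) / (r * r)) *\<^sub>R (x - y)"
      by (simp add: v_def sgn_div_norm r_def[symmetric] divide_inverse)
    also have "\<dots> = x - y" unfolding r2[symmetric] using r by simp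
    finally show ?thesis by (simp add: R_def)
  qed (simp add: R_def v0)
  ultimately show thesis by (rule that)
qed

lemma space_sphere_measure [simp]: "space sphere_measure = sphere (0::'a::euclidean_space) 1"
  and sets_sphere_measure [measurable_cong]:
    "sets (sphere_measure :: 'a measure) = sets (restrict_space borel (sphere 0 1))"
  by (simp_all add: sphere_measure_def Let_def space_restrict_space)

interpretation sphere: prob_space "sphere_measure :: 'a::euclidean_space measure"
  by (rule prob_space_sphere_measure)

lemma emeasure_sphere_measure:
  fixes A :: "'a::euclidean_space set"
  assumes A: "A \<in> sets sphere_measure"
  shows "{z \<in> cball 0 1 - {0}. sgn z \<in> A} \<in> sets borel"
    and "emeasure sphere_measure A =
      emeasure lborel {z \<in> cball 0 1 - {0}. sgn z \<in> A} / emeasure lborel (cball (0::'a) 1 - {0})"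
proof -
  define B :: "'a set" where "B = cball 0 1 - {0}"
  let ?S = "restrict_space borel (sphere 0 1) :: 'a measure"
  have B[measurable]: "B \<in> sets borel" by (simp add: B_def)
  have A': "A \<in> sets ?S" "A \<in> sets borel"
    using A by (auto simp: sets_sphere_measure sets_restrict_space)
  have [measurable]: "(sgn :: 'a \<Rightarrow> 'a) \<in> borel_measurable borel" by (simp add: sgn_div_norm)
  have "sgn -` A \<inter> space borel \<in> sets borel" by (rule measurable_sets[OF _ A'(2)]) measurable
  then have s: "B \<inter> sgn -` A \<in> sets borel" using B by auto
  have e: "{z \<in> cball 0 1 - {0}. sgn z \<in> A} = B \<inter> sgn -` A" by (auto simp: B_def)
  show "{z \<in> cball 0 1 - {0}. sgn z \<in> A} \<in> sets borel" unfolding e by (rule s)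
  have sgn_m: "sgn \<in> restrict_space (uniform_measure lborel B) B \<rightarrow>\<^sub>M ?S"
    by (rule measurable_restrict_space3) (auto simp: B_def norm_sgn)
  have "emeasure sphere_measure A = emeasure (restrict_space (uniform_measure lborel B) B) (sgn -` A \<inter> B)"
    unfolding sphere_measure_def Let_def B_def[symmetric]
    using emeasure_distr[OF sgn_m A'(1)] by (simp add: space_restrict_space)
  also have "\<dots> = emeasure (uniform_measure lborel B) (sgn -` A \<inter> B)"
    using B by (intro emeasure_restrict_space) auto
  also have "\<dots> = emeasure lborel (B \<inter> (sgn -` A \<inter> B)) / emeasure lborel B"
    using B s by (intro emeasure_uniform_measure) (auto simp: Int_commute)
  also have "B \<inter> (sgn -` A \<inter> B) = B \<inter> sgn -` A" by auto
  finally show "emeasure sphere_measure A =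
      emeasure lborel {z \<in> cball 0 1 - {0}. sgn z \<in> A} / emeasure lborel (cball (0::'a) 1 - {0})"
    unfolding e by (simp only: B_def)
qed

lemma measurable_orthogonal_involution_sphere:
  assumes "orthogonal_involution R"
  shows "R \<in> sphere_measure \<rightarrow>\<^sub>M sphere_measure"
proof -
  have "R \<in> restrict_space borel (sphere 0 1) \<rightarrow>\<^sub>M restrict_space borel (sphere 0 1)"
    using orthogonal_involutionD[OF assms] by (intro measurable_restrict_space3) auto
  then show ?thesis by (simp cong: measurable_cong_sets add: measurable_cong_sets[OF sets_sphere_measure sets_sphere_measure])
qed

lemma sphere_measure_invariant:
  fixes R :: "'a::euclidean_space \<Rightarrow> 'a"
  assumes R: "orthogonal_involution R"
  shows "distr sphere_measure sphere_measure R = sphere_measure"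
proof (rule measure_eqI)
  note RD = orthogonal_involutionD[OF R]
  note Rm = measurable_orthogonal_involution_sphere[OF R]
  fix A :: "'a set" assume "A \<in> sets (distr sphere_measure sphere_measure R)"
  then have A: "A \<in> sets sphere_measure" by simp
  let ?B = "cball (0::'a) 1 - {0}"
  let ?A' = "R -` A \<inter> space sphere_measure"
  have A': "?A' \<in> sets sphere_measure" by (rule measurable_sets[OF Rm A])
  have "emeasure (distr sphere_measure sphere_measure R) A = emeasure sphere_measure ?A'"
    by (rule emeasure_distr[OF Rm A])
  also have "\<dots> = emeasure lborel {z \<in> ?B. sgn z \<in> ?A'} / emeasure lborel ?B"
    by (rule emeasure_sphere_measure[OF A'])
  also have "{z \<in> ?B. sgn z \<in> ?A'} = R -` {z \<in> ?B. sgn z \<in> A}"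
    using RD by (auto simp: norm_sgn)
  also have "emeasure lborel (R -` {z \<in> ?B. sgn z \<in> A}) = emeasure lborel {z \<in> ?B. sgn z \<in> A}"
    by (rule emeasure_lborel_vimage_orthogonal_involution[OF R emeasure_sphere_measure(1)[OF A]])
  also have "\<dots> / emeasure lborel ?B = emeasure sphere_measure A"
    by (rule emeasure_sphere_measure(2)[OF A, symmetric])
  finally show "emeasure (distr sphere_measure sphere_measure R) A = emeasure sphere_measure A" .
qed simp

lemma sphere_integral_invariant:
  fixes f :: "'a::euclidean_space \<Rightarrow> real"
  assumes R: "orthogonal_involution R" and f: "f \<in> borel_measurable sphere_measure"
  shows "(\<integral>x. f (R x) \<partial>sphere_measure) = (\<integral>x. f x \<partial>sphere_measure)"
  using integral_distr[OF measurable_orthogonal_involution_sphere[OF R] f]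
  by (simp add: sphere_measure_invariant[OF R])

lemma borel_measurable_sphere:
  fixes f :: "'a::euclidean_space \<Rightarrow> real"
  assumes "continuous_on (sphere 0 1) f"
  shows "f \<in> borel_measurable sphere_measure"
  using borel_measurable_continuous_on_restrict[OF assms]
  by (simp add: measurable_cong_sets[OF sets_sphere_measure refl])

lemma integrable_sphere:
  fixes f :: "'a::euclidean_space \<Rightarrow> real"
  assumes f: "continuous_on (sphere 0 1) f"
  shows "integrable sphere_measure f"
proof -
  have "bounded (f ` sphere 0 1)"
    by (intro compact_imp_bounded compact_continuous_image[OF f]) simp
  then obtain B where "\<forall>x\<in>sphere 0 1. norm (f x) \<le> B" by (auto simp only: bounded_iff ball_simps)
  then show ?thesis
    by (intro sphere.integrable_const_bound[of _ B] borel_measurable_sphere[OF f]) auto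
qed

section \<open>Eigenfunctions and the addition theorem\<close>

lemma laplacian_eq_trace:
  fixes f :: "'a::euclidean_space \<Rightarrow> real" and f' :: "'a \<Rightarrow> 'a \<Rightarrow>\<^sub>L real"
  assumes U: "open U" "x \<in> U"
    and f: "\<And>z. z \<in> U \<Longrightarrow> (f has_derivative blinfun_apply (f' z)) (at z)"
    and f': "(f' has_derivative D) (at x)"
  shows "laplacian f x = (\<Sum>b\<in>Basis. blinfun_apply (D b) b)"
  unfolding laplacian_def
proof (rule sum.cong[OF refl])
  fix b :: 'a
  let ?l = "\<lambda>t::real. x + t *\<^sub>R b"
  have l: "(?l has_derivative (\<lambda>h. h *\<^sub>R b)) (at t)" for t
    by (auto intro!: derivative_eq_intros)
  have d1: "((\<lambda>t. f (?l t)) has_real_derivative blinfun_apply (f' (?l t)) b) (at t)" if "?l t \<in> U" for t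
    using has_derivative_compose[OF l f[OF that]]
    by (simp add: has_field_derivative_def blinfun.scaleR_right mult_commute_abs)
  have "open (?l -` U)" by (intro open_vimage U(1) continuous_intros)
  then have "\<forall>\<^sub>F t in nhds 0. ?l t \<in> U"
    unfolding eventually_nhds using U(2) by (intro exI[of _ "?l -` U"]) auto
  then have "\<forall>\<^sub>F t in nhds 0. deriv (\<lambda>t. f (?l t)) t = blinfun_apply (f' (?l t)) b"
    by eventually_elim (rule DERIV_imp_deriv[OF d1])
  then have "(deriv ^^ 2) (\<lambda>t. f (?l t)) 0 = deriv (\<lambda>t. blinfun_apply (f' (?l t)) b) 0"
    by (simp add: numeral_2_eq_2) (rule deriv_cong_ev, auto)
  also have "\<dots> = blinfun_apply (D b) b"
  proof (rule DERIV_imp_deriv)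
    have "(f' has_derivative D) (at (?l 0))" using f' by simp
    from has_derivative_compose[OF l this]
    have "((\<lambda>t. blinfun_apply (f' (?l t)) b) has_derivative (\<lambda>h. blinfun_apply (D (h *\<^sub>R b)) b)) (at 0)"
      by (rule bounded_linear.has_derivative[OF blinfun.bounded_linear_left])
    moreover have "D (h *\<^sub>R b) = h *\<^sub>R D b" for h
      using has_derivative_bounded_linear[OF f'] by (simp add: linear_simps(5))
    ultimately show "((\<lambda>t. blinfun_apply (f' (?l t)) b) has_real_derivative blinfun_apply (D b) b) (at 0)"
      by (simp add: has_field_derivative_def blinfun.scaleR_left mult_commute_abs)
  qed
  finally show "(deriv ^^ 2) (\<lambda>t. f (?l t)) 0 = blinfun_apply (D b) b" .
qed

text \<open>
  The trace of a bilinear form is the same in every orthonormal basis; this is what makes the Laplacian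
  invariant under \<open>R\<close>.
\<close>

lemma trace_orthogonal_involution:
  fixes D :: "'a::euclidean_space \<Rightarrow>\<^sub>L 'a \<Rightarrow>\<^sub>L real"
  assumes R: "orthogonal_involution R"
  shows "(\<Sum>b\<in>Basis. D (R b) (R b)) = (\<Sum>b\<in>Basis. D b b)"
proof -
  note RD = orthogonal_involutionD[OF R]
  have expand: "D v v = (\<Sum>c\<in>Basis. \<Sum>d\<in>Basis. (v \<bullet> c) * (v \<bullet> d) * D c d)" for v
  proof -
    have "D v v = D (\<Sum>c\<in>Basis. (v \<bullet> c) *\<^sub>R c) (\<Sum>d\<in>Basis. (v \<bullet> d) *\<^sub>R d)"
      by (simp add: euclidean_representation)
    also have "\<dots> = (\<Sum>c\<in>Basis. \<Sum>d\<in>Basis. (v \<bullet> c) * (v \<bullet> d) * D c d)"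
      by (simp only: blinfun.sum_right blinfun.sum_left blinfun.scaleR_left blinfun.scaleR_right
            real_scaleR_def sum_distrib_left mult.assoc)
         (subst sum.swap, simp add: mult_ac)
    finally show ?thesis .
  qed
  have inner: "(\<Sum>b\<in>Basis. (R b \<bullet> c) * (R b \<bullet> d)) = c \<bullet> d" for c d
  proof -
    have "R b \<bullet> c = R c \<bullet> b" for b c using RD(4)[of b c] by (simp add: inner_commute)
    then show ?thesis using euclidean_inner[of "R c" "R d"] unfolding RD(3) by simp
  qed
  have "(\<Sum>b\<in>Basis. D (R b) (R b)) = (\<Sum>c\<in>Basis. \<Sum>d\<in>Basis. \<Sum>b\<in>Basis. (R b \<bullet> c) * (R b \<bullet> d) * D c d)"
    unfolding expand[of "R _"]
    by (subst sum.swap, rule sum.cong[OF refl], subst sum.swap) simp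
  also have "\<dots> = (\<Sum>c\<in>Basis. \<Sum>d\<in>Basis. (c \<bullet> d) * D c d)"
    by (simp only: sum_distrib_right[symmetric] inner)
  also have "\<dots> = (\<Sum>c\<in>Basis. \<Sum>d\<in>Basis. (if c = d then D c d else 0))"
    by (intro sum.cong refl) (auto simp: inner_Basis)
  also have "\<dots> = (\<Sum>b\<in>Basis. D b b)" by simp
  finally show ?thesis .
qed

lemma eigenspace_derivativesE:
  assumes "f \<in> laplace_beltrami_eigenspace c"
  obtains f' f'' where
    "\<forall>x. x \<noteq> 0 \<longrightarrow> ((\<lambda>x. f (sgn x)) has_derivative blinfun_apply (f' x)) (at x)"
    "\<forall>x. x \<noteq> 0 \<longrightarrow> (f' has_derivative blinfun_apply (f'' x)) (at x)"
    "continuous_on (- {0}) f''"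
    "\<forall>x. norm x = 1 \<longrightarrow> (\<Sum>b\<in>Basis. blinfun_apply (blinfun_apply (f'' x) b) b) = c * f x"
proof -
  from assms have "C2_on (- {0}) (\<lambda>x. f (sgn x))"
    and eig: "\<forall>x. norm x = 1 \<longrightarrow> laplacian (\<lambda>x. f (sgn x)) x = c * f x"
    by (auto simp: laplace_beltrami_eigenspace_def laplace_beltrami_def)
  then obtain f' f'' where "\<forall>x\<in>- {0}. ((\<lambda>x. f (sgn x)) has_derivative blinfun_apply (f' x)) (at x)"
    "\<forall>x\<in>- {0}. (f' has_derivative blinfun_apply (f'' x)) (at x)" "continuous_on (- {0}) f''"
    unfolding C2_on_def by (elim exE conjE)
  then have *: "\<forall>x. x \<noteq> 0 \<longrightarrow> ((\<lambda>x. f (sgn x)) has_derivative blinfun_apply (f' x)) (at x)"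
    "\<forall>x. x \<noteq> 0 \<longrightarrow> (f' has_derivative blinfun_apply (f'' x)) (at x)"
    "continuous_on (- {0}) f''"
    by simp_all
  have "laplacian (\<lambda>x. f (sgn x)) x = (\<Sum>b\<in>Basis. blinfun_apply (blinfun_apply (f'' x) b) b)" if "norm x = 1" for x
  proof -
    have "x \<noteq> 0" using that by auto
    then show ?thesis by (intro laplacian_eq_trace[of "- {0}"]) (use * in auto)
  qed
  with eig show thesis by (intro that[OF *]) auto
qed

lemma eigenspace_continuous_on:
  assumes "f \<in> laplace_beltrami_eigenspace c"
  shows "continuous_on (sphere 0 1) f"
proof -
  obtain f' where d: "\<forall>x. x \<noteq> 0 \<longrightarrow> ((\<lambda>x. f (sgn x)) has_derivative blinfun_apply (f' x)) (at x)"
    by (rule eigenspace_derivativesE[OF assms])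
  have "continuous_on (sphere 0 1) (\<lambda>x. f (sgn x))"
    by (intro continuous_at_imp_continuous_on ballI has_derivative_continuous[OF d[rule_format]]) auto
  then show ?thesis by (rule continuous_on_eq) (simp add: sgn_div_norm)
qed

text \<open>
  The degree-0 extension of \<open>f \<circ> R\<close> is the extension of \<open>f\<close> composed with \<open>R\<close>, so the chain rule gives
  its second derivative as that of \<open>f\<close> at \<open>R x\<close>, with \<open>R\<close> applied to both arguments.
\<close>

lemma eigenspace_rotate:
  fixes f :: "'a::euclidean_space \<Rightarrow> real"
  assumes f: "f \<in> laplace_beltrami_eigenspace c" and R: "orthogonal_involution R"
  shows "(\<lambda>x. f (R x)) \<in> laplace_beltrami_eigenspace c"
proof -
  note RD = orthogonal_involutionD[OF R]
  let ?F = "\<lambda>x. f (sgn x)"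
  obtain f' f'' where d':
    "\<forall>x. x \<noteq> 0 \<longrightarrow> (?F has_derivative blinfun_apply (f' x)) (at x)"
    "\<forall>x. x \<noteq> 0 \<longrightarrow> (f' has_derivative blinfun_apply (f'' x)) (at x)"
    "continuous_on (- {0}) f''"
    "\<forall>x. norm x = 1 \<longrightarrow> (\<Sum>b\<in>Basis. f'' x b b) = c * f x"
    by (rule eigenspace_derivativesE[OF f])
  note d = d'[rule_format]
  define r where "r = Blinfun R"
  have r: "blinfun_apply r = R" unfolding r_def by (rule bounded_linear_Blinfun_apply[OF RD(6)])
  have bl: "bounded_linear (\<lambda>a :: 'a \<Rightarrow>\<^sub>L real. a o\<^sub>L r)"
    by (rule bounded_bilinear.bounded_linear_left[OF bounded_bilinear_blinfun_compose])
  define C where "C = Blinfun (\<lambda>a :: 'a \<Rightarrow>\<^sub>L real. a o\<^sub>L r)"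
  have C: "blinfun_apply C = (\<lambda>a. a o\<^sub>L r)" unfolding C_def by (rule bounded_linear_Blinfun_apply[OF bl])
  define g' where "g' x = f' (R x) o\<^sub>L r" for x
  define g'' where "g'' x = C o\<^sub>L (f'' (R x) o\<^sub>L r)" for x
  have Rd: "(R has_derivative R) (at x)" for x
    by (rule bounded_linear_imp_has_derivative[OF RD(6)])
  have eqF: "(\<lambda>x. f (R (sgn x))) = (\<lambda>x. ?F (R x))" by (simp add: RD)
  have g': "((\<lambda>x. f (R (sgn x))) has_derivative blinfun_apply (g' x)) (at x)" if "x \<noteq> 0" for x
  proof -
    have "blinfun_apply (g' x) = (\<lambda>h. f' (R x) (R h))" by (simp add: fun_eq_iff g'_def r)
    then show ?thesis unfolding eqF
      using has_derivative_compose[OF Rd d(1)[of "R x"]] that by (simp only: RD(11) simp_thms)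
  qed
  have g'': "(g' has_derivative blinfun_apply (g'' x)) (at x)" if "x \<noteq> 0" for x
  proof -
    have "((\<lambda>x. f' (R x)) has_derivative (\<lambda>h. f'' (R x) (R h))) (at x)"
      using has_derivative_compose[OF Rd d(2)[of "R x"]] that by (simp only: RD(11) simp_thms)
    from bounded_linear.has_derivative[OF bl this]
    have "(g' has_derivative (\<lambda>h. f'' (R x) (R h) o\<^sub>L r)) (at x)" by (simp only: g'_def[abs_def])
    moreover have "blinfun_apply (g'' x) = (\<lambda>h. f'' (R x) (R h) o\<^sub>L r)"
      by (simp add: fun_eq_iff g''_def C r)
    ultimately show ?thesis by simp
  qed
  have "continuous_on (- {0}) (\<lambda>x. f'' (R x))"
    by (rule continuous_on_compose2[OF d(3) RD(9)]) (auto simp: RD(11))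
  then have cont: "continuous_on (- {0}) g''"
    unfolding g''_def by (intro bounded_bilinear.continuous_on[OF bounded_bilinear_blinfun_compose] continuous_on_const)
  have "C2_on (- {0}) (\<lambda>x. f (R (sgn x)))"
    unfolding C2_on_def using g' g'' cont by blast
  moreover have "laplace_beltrami (\<lambda>x. f (R x)) x = c * f (R x)" if "x \<in> sphere 0 1" for x
  proof -
    have "x \<noteq> 0" using that by auto
    then have "laplace_beltrami (\<lambda>x. f (R x)) x = (\<Sum>b\<in>Basis. g'' x b b)"
      unfolding laplace_beltrami_def
      by (intro laplacian_eq_trace[of "- {0}"]) (use g' g'' in auto)
    also have "\<dots> = (\<Sum>b\<in>Basis. f'' (R x) (R b) (R b))" by (simp add: g''_def C r)
    also have "\<dots> = (\<Sum>b\<in>Basis. f'' (R x) b b)" by (rule trace_orthogonal_involution[OF R])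
    also have "\<dots> = c * f (R x)" using that by (intro d(4)) (simp add: RD(5))
    finally show ?thesis .
  qed
  ultimately show ?thesis by (simp add: laplace_beltrami_eigenspace_def)
qed

text \<open>
  The Laplacian of the combination is \<open>c k\<close> by linearity, and 0 because the extension of a constant
  function is constant near every point of the sphere.
\<close>

lemma eigenspace_constant_combination:
  fixes y :: "'i \<Rightarrow> 'a::euclidean_space \<Rightarrow> real"
  assumes c: "c \<noteq> 0" and y: "\<And>m. m \<in> I \<Longrightarrow> y m \<in> laplace_beltrami_eigenspace c"
    and const: "\<And>x. norm x = 1 \<Longrightarrow> (\<Sum>m\<in>I. a m * y m x) = k"
  shows "k = 0"
proof -
  have "\<forall>m\<in>I. \<exists>f' f''. (\<forall>x. x \<noteq> 0 \<longrightarrow> ((\<lambda>x. y m (sgn x)) has_derivative blinfun_apply (f' x)) (at x)) \<and>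
    (\<forall>x. x \<noteq> 0 \<longrightarrow> (f' has_derivative blinfun_apply (f'' x)) (at x)) \<and>
    (\<forall>x. norm x = 1 \<longrightarrow> (\<Sum>b\<in>Basis. blinfun_apply (blinfun_apply (f'' x) b) b) = c * y m x)"
    (is "\<forall>m\<in>I. \<exists>f' f''. ?P m f' f''")
  proof
    fix m assume "m \<in> I"
    from y[OF this] obtain f' f'' where "?P m f' f''" by (rule eigenspace_derivativesE) blast
    then show "\<exists>f' f''. ?P m f' f''" by (intro exI)
  qed
  from bchoice[OF this] obtain f' where "\<forall>m\<in>I. \<exists>f''. ?P m (f' m) f''" ..
  from bchoice[OF this] obtain f'' where "\<forall>m\<in>I. ?P m (f' m) (f'' m)" ..
  then have d:
    "\<And>m x. m \<in> I \<Longrightarrow> x \<noteq> 0 \<Longrightarrow> ((\<lambda>x. y m (sgn x)) has_derivative blinfun_apply (f' m x)) (at x)"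
    "\<And>m x. m \<in> I \<Longrightarrow> x \<noteq> 0 \<Longrightarrow> (f' m has_derivative blinfun_apply (f'' m x)) (at x)"
    "\<And>m x. m \<in> I \<Longrightarrow> norm x = 1 \<Longrightarrow> (\<Sum>b\<in>Basis. blinfun_apply (blinfun_apply (f'' m x) b) b) = c * y m x"
    by simp_all
  obtain e :: 'a where "e \<in> Basis" using nonempty_Basis by blast
  then have e: "norm e = 1" by simp
  then have e0: "e \<noteq> 0" by auto
  let ?F = "\<lambda>x. \<Sum>m\<in>I. a m * y m (sgn x)"
  have "laplacian ?F e = (\<Sum>b\<in>Basis. blinfun_apply (\<Sum>m\<in>I. a m *\<^sub>R blinfun_apply (f'' m e) b) b)"
  proof (rule laplacian_eq_trace[of "- {0}"])
    show "(?F has_derivative blinfun_apply (\<Sum>m\<in>I. a m *\<^sub>R f' m z)) (at z)" if "z \<in> - {0}" for z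
    proof -
      have "(?F has_derivative (\<lambda>h. \<Sum>m\<in>I. a m * f' m z h)) (at z)"
        using that by (intro has_derivative_sum has_derivative_mult_right d) auto
      moreover have "blinfun_apply (\<Sum>m\<in>I. a m *\<^sub>R f' m z) = (\<lambda>h. \<Sum>m\<in>I. a m * f' m z h)"
        by (simp add: fun_eq_iff blinfun.sum_left blinfun.scaleR_left)
      ultimately show ?thesis by simp
    qed
    show "((\<lambda>z. \<Sum>m\<in>I. a m *\<^sub>R f' m z) has_derivative (\<lambda>b. \<Sum>m\<in>I. a m *\<^sub>R blinfun_apply (f'' m e) b)) (at e)"
      using e0 by (intro has_derivative_sum has_derivative_scaleR_right d)
  qed (use e0 in auto)
  also have "\<dots> = (\<Sum>b\<in>Basis. \<Sum>m\<in>I. a m * f'' m e b b)"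
    by (simp add: blinfun.sum_left blinfun.scaleR_left)
  also have "\<dots> = (\<Sum>m\<in>I. a m * (\<Sum>b\<in>Basis. f'' m e b b))"
    by (subst sum.swap) (simp add: sum_distrib_left)
  also have "\<dots> = (\<Sum>m\<in>I. a m * (c * y m e))" by (intro sum.cong refl) (simp add: d(3) e)
  also have "\<dots> = c * (\<Sum>m\<in>I. a m * y m e)" by (simp add: sum_distrib_left mult.left_commute)
  also have "\<dots> = c * k" using const[OF e] by simp
  finally have "laplacian ?F e = c * k" .
  moreover have "laplacian ?F e = (\<Sum>b\<in>Basis. blinfun_apply 0 (b::'a))"
  proof (rule laplacian_eq_trace[of "- {0}" e _ "\<lambda>_. 0"])
    show "(?F has_derivative blinfun_apply 0) (at z)" if z: "z \<in> - {0}" for z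
    proof (rule has_derivative_transform_within_open[of "\<lambda>_. k" _ _ _ "- {0}"])
      show "((\<lambda>_. k) has_derivative blinfun_apply 0) (at z)"
        by (simp add: zero_blinfun.rep_eq)
      show "k = ?F x" if "x \<in> - {0}" for x
        using that by (intro const[symmetric]) (simp add: norm_sgn)
    qed (use z in auto)
  qed (use e0 in auto)
  ultimately show ?thesis using c by simp
qed

text \<open>
  Composition with \<open>R\<close> acts on the eigenspace by a matrix \<open>A\<close> with entries
  \<open>A m k = \<integral> y m (R x) y k x dx\<close>. It is orthogonal since \<open>R\<close> preserves the measure, and symmetric since
  \<open>R\<close> is an involution, so that its columns, and not only its rows, are orthonormal. Orthonormal
  columns are what removes \<open>R\<close> from the kernel.
\<close>

lemma reproducing_kernel_invariant:
  fixes y :: "nat \<Rightarrow> 'a::euclidean_space \<Rightarrow> real"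
  assumes y: "orthonormal_basis_on_sphere n y (laplace_beltrami_eigenspace c)"
    and R: "orthogonal_involution R" and x: "norm x = 1" and x': "norm x' = 1"
  shows "(\<Sum>m=1..n. y m (R x) * y m (R x')) = (\<Sum>m=1..n. y m x * y m x')"
proof -
  note RD = orthogonal_involutionD[OF R]
  let ?I = "{1..n}"
  let ?V = "laplace_beltrami_eigenspace c :: ('a \<Rightarrow> real) set"
  have V: "y m \<in> ?V" if "m \<in> ?I" for m using y that by (auto simp: orthonormal_basis_on_sphere_def)
  have orth: "(\<integral>x. y m x * y k x \<partial>sphere_measure) = (if m = k then 1 else 0)" if "m \<in> ?I" "k \<in> ?I" for m k
    using y that unfolding orthonormal_basis_on_sphere_def by blast
  have cont: "continuous_on (sphere 0 1) (y m)" "continuous_on (sphere 0 1) (\<lambda>x. y m (R x))" if "m \<in> ?I" for m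
    using eigenspace_continuous_on[OF V] eigenspace_continuous_on[OF eigenspace_rotate[OF V R]] that by auto
  have "\<forall>m\<in>?I. \<exists>b. \<forall>x\<in>sphere 0 1. y m (R x) = (\<Sum>k\<in>?I. b k * y k x)"
    using y eigenspace_rotate[OF V R] by (auto simp: orthonormal_basis_on_sphere_def)
  from bchoice[OF this] obtain A where "\<forall>m\<in>?I. \<forall>x\<in>sphere 0 1. y m (R x) = (\<Sum>k\<in>?I. A m k * y k x)" ..
  then have A: "y m (R x) = (\<Sum>k\<in>?I. A m k * y k x)" if "m \<in> ?I" "norm x = 1" for m x
    using that by simp
  have int: "integrable sphere_measure (\<lambda>x. y m x * y k x)" if "m \<in> ?I" "k \<in> ?I" for m k
    using that by (intro integrable_sphere continuous_on_mult cont)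
  have expand: "(\<integral>x. y m (R x) * f x \<partial>sphere_measure) = (\<Sum>j\<in>?I. A m j * (\<integral>x. y j x * f x \<partial>sphere_measure))"
    if "m \<in> ?I" "continuous_on (sphere 0 1) f" for m f
  proof -
    have "(\<integral>x. y m (R x) * f x \<partial>sphere_measure) = (\<integral>x. (\<Sum>j\<in>?I. A m j * (y j x * f x)) \<partial>sphere_measure)"
      using that by (intro Bochner_Integration.integral_cong) (auto simp: A sum_distrib_right mult.assoc)
    also have "\<dots> = (\<Sum>j\<in>?I. A m j * (\<integral>x. y j x * f x \<partial>sphere_measure))"
      using that
      by (subst Bochner_Integration.integral_sum)
         (auto intro!: integrable_mult_right integrable_sphere continuous_on_mult cont simp del: atLeastAtMost_iff)
    finally show ?thesis .
  qed
  have Aint: "A m k = (\<integral>x. y m (R x) * y k x \<partial>sphere_measure)" if "m \<in> ?I" "k \<in> ?I" for m k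
  proof -
    have "(\<Sum>j\<in>?I. A m j * (\<integral>x. y j x * y k x \<partial>sphere_measure)) = (\<Sum>j\<in>?I. if j = k then A m j else 0)"
      using that by (intro sum.cong refl) (simp add: orth del: atLeastAtMost_iff)
    also have "\<dots> = A m k" using that by (subst sum.delta) auto
    finally show ?thesis using expand[OF that(1) cont(1)[OF that(2)]] by simp
  qed
  have sym: "A m k = A k m" if "m \<in> ?I" "k \<in> ?I" for m k
  proof -
    have "A m k = (\<integral>x. y m (R (R x)) * y k (R x) \<partial>sphere_measure)"
      unfolding Aint[OF that]
      by (rule sphere_integral_invariant[OF R, symmetric])
         (intro borel_measurable_sphere continuous_on_mult cont that)
    also have "\<dots> = (\<integral>x. y k (R x) * y m x \<partial>sphere_measure)" by (simp only: RD(2) mult.commute)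
    also have "\<dots> = A k m" by (rule Aint[OF that(2,1), symmetric])
    finally show ?thesis .
  qed
  have orthA: "(\<Sum>m\<in>?I. A m k * A m j) = (if k = j then 1 else 0)" if "k \<in> ?I" "j \<in> ?I" for k j
  proof -
    have "(\<Sum>m\<in>?I. A m k * A m j) = (\<Sum>m\<in>?I. A k m * (\<integral>x. y m x * y j (R x) \<partial>sphere_measure))"
      using that by (intro sum.cong refl) (simp add: sym[of _ k] sym[of _ j] Aint[of j] mult.commute del: atLeastAtMost_iff)
    also have "\<dots> = (\<integral>x. y k (R x) * y j (R x) \<partial>sphere_measure)"
      by (rule expand[symmetric]) (use that cont in auto)
    also have "\<dots> = (\<integral>x. y k x * y j x \<partial>sphere_measure)"
      by (rule sphere_integral_invariant[OF R, of "\<lambda>x. y k x * y j x"])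
         (intro borel_measurable_sphere continuous_on_mult cont that)
    finally show ?thesis using orth[OF that] by simp
  qed
  have "(\<Sum>m\<in>?I. y m (R x) * y m (R x')) = (\<Sum>m\<in>?I. \<Sum>k\<in>?I. \<Sum>j\<in>?I. (A m k * A m j) * (y k x * y j x'))"
    by (intro sum.cong refl) (simp add: A x x' sum_product mult_ac del: atLeastAtMost_iff)
  also have "\<dots> = (\<Sum>k\<in>?I. \<Sum>j\<in>?I. (\<Sum>m\<in>?I. A m k * A m j) * (y k x * y j x'))"
    unfolding sum_distrib_right
    by (subst sum.swap, rule sum.cong[OF refl], subst sum.swap) (rule refl)
  also have "\<dots> = (\<Sum>k\<in>?I. \<Sum>j\<in>?I. if k = j then y k x * y j x' else 0)"
    by (intro sum.cong refl) (simp only: orthA, simp)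
  also have "\<dots> = (\<Sum>m\<in>?I. y m x * y m x')" by simp
  finally show ?thesis .
qed

text \<open>
  Since reflections act transitively, the kernel is constant on the diagonal, and the constant is its
  integral, a sum of \<open>n\<close> ones.
\<close>

lemma addition_theorem:
  fixes y :: "nat \<Rightarrow> 'a::euclidean_space \<Rightarrow> real"
  assumes y: "orthonormal_basis_on_sphere n y (laplace_beltrami_eigenspace c)" and x: "norm x = 1"
  shows "(\<Sum>m=1..n. (y m x)\<^sup>2) = real n"
proof -
  let ?I = "{1..n}"
  have V: "y m \<in> laplace_beltrami_eigenspace c" if "m \<in> ?I" for m using y that by (auto simp: orthonormal_basis_on_sphere_def)
  have orth: "(\<integral>x. y m x * y m x \<partial>sphere_measure) = 1" if "m \<in> ?I" for m
    using y that unfolding orthonormal_basis_on_sphere_def by simp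
  have const: "(\<Sum>m\<in>?I. (y m z)\<^sup>2) = (\<Sum>m\<in>?I. (y m x)\<^sup>2)" if z: "norm z = 1" for z
  proof -
    obtain R where R: "orthogonal_involution R" "R x = z" by (rule reflection_exists[of x z]) (use x z in auto)
    show ?thesis using reproducing_kernel_invariant[OF y R(1) x x] by (simp add: R(2) power2_eq_square)
  qed
  have "(\<Sum>m\<in>?I. (y m x)\<^sup>2) = (\<integral>z. (\<Sum>m\<in>?I. (y m x)\<^sup>2) \<partial>(sphere_measure :: 'a measure))"
    using sphere.prob_space[where 'a = 'a] by simp
  also have "\<dots> = (\<integral>z. (\<Sum>m\<in>?I. y m z * y m z) \<partial>sphere_measure)"
  proof (rule Bochner_Integration.integral_cong[OF refl])
    fix z :: 'a assume "z \<in> space sphere_measure"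
    then have "norm z = 1" by simp
    from const[OF this] show "(\<Sum>m\<in>?I. (y m x)\<^sup>2) = (\<Sum>m\<in>?I. y m z * y m z)"
      by (simp add: power2_eq_square)
  qed
  also have "\<dots> = (\<Sum>m\<in>?I. 1)"
    by (subst Bochner_Integration.integral_sum)
       (auto intro!: integrable_sphere continuous_on_mult eigenspace_continuous_on[OF V] simp: orth simp del: atLeastAtMost_iff)
  finally show ?thesis by simp
qed

text \<open>
  Integrating the invariant kernel in one variable leaves an invariant, hence constant, function
  \<open>f = \<Sum> e m y m\<close>, where \<open>e m\<close> is the mean of \<open>y m\<close>. A constant in an eigenspace with nonzero
  eigenvalue is 0, and then every coefficient \<open>e m\<close> vanishes by orthonormality.
\<close>

lemma integral_eigenfunction_zero:
  fixes y :: "nat \<Rightarrow> 'a::euclidean_space \<Rightarrow> real"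
  assumes y: "orthonormal_basis_on_sphere n y (laplace_beltrami_eigenspace c)" and c: "c \<noteq> 0" and k: "k \<in> {1..n}"
  shows "(\<integral>x. y k x \<partial>sphere_measure) = 0"
proof -
  let ?I = "{1..n}"
  have V: "y m \<in> laplace_beltrami_eigenspace c" if "m \<in> ?I" for m using y that by (auto simp: orthonormal_basis_on_sphere_def)
  have cont: "continuous_on (sphere 0 1) (y m)" if "m \<in> ?I" for m using eigenspace_continuous_on[OF V] that .
  have orth: "(\<integral>x. y m x * y k x \<partial>sphere_measure) = (if m = k then 1 else 0)" if "m \<in> ?I" "k \<in> ?I" for m k
    using y that unfolding orthonormal_basis_on_sphere_def by blast
  define e where "e m = (\<integral>x. y m x \<partial>sphere_measure)" for m
  define f where "f x = (\<Sum>m\<in>?I. e m * y m x)" for x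
  have f_int: "f x = (\<integral>z. (\<Sum>m\<in>?I. y m x * y m z) \<partial>sphere_measure)" for x
    unfolding f_def e_def
    by (subst Bochner_Integration.integral_sum)
       (auto intro!: integrable_mult_right integrable_sphere cont simp: mult.commute simp del: atLeastAtMost_iff)
  have inv: "f (R x) = f x" if R: "orthogonal_involution R" and x: "norm x = 1" for R x
  proof -
    have "f (R x) = (\<integral>z. (\<Sum>m\<in>?I. y m (R x) * y m (R z)) \<partial>sphere_measure)"
      unfolding f_int
      by (rule sphere_integral_invariant[OF R, symmetric])
         (intro borel_measurable_sphere continuous_on_sum continuous_on_mult continuous_on_const cont)
    also have "\<dots> = f x"
      unfolding f_int
      by (rule Bochner_Integration.integral_cong[OF refl], rule reproducing_kernel_invariant[OF y R x]) simp
    finally show ?thesis .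
  qed
  obtain b :: 'a where "b \<in> Basis" using nonempty_Basis by blast
  then have b: "norm b = 1" by simp
  have const: "f x = f b" if x: "norm x = 1" for x
  proof -
    obtain R where R: "orthogonal_involution R" "R b = x" by (rule reflection_exists[of b x]) (use x b in auto)
    show ?thesis using inv[OF R(1) b] R(2) by simp
  qed
  have "f b = 0"
  proof (rule eigenspace_constant_combination[OF c])
    show "(\<Sum>m\<in>?I. e m * y m x) = f b" if "norm x = 1" for x
      using const[OF that] by (simp only: f_def)
  qed (rule V)
  with const have f0: "f x = 0" if "norm x = 1" for x using that by simp
  have "0 = (\<integral>x. f x * y k x \<partial>sphere_measure)"
    by (subst Bochner_Integration.integral_cong[OF refl, of _ _ "\<lambda>_. 0"]) (auto simp: f0)
  also have "\<dots> = (\<integral>x. (\<Sum>m\<in>?I. e m * (y m x * y k x)) \<partial>sphere_measure)"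
    by (simp add: f_def sum_distrib_right mult.assoc)
  also have "\<dots> = (\<Sum>m\<in>?I. e m * (if m = k then 1 else 0))"
    using k by (subst Bochner_Integration.integral_sum)
       (auto intro!: integrable_mult_right integrable_sphere continuous_on_mult cont simp: orth simp del: atLeastAtMost_iff)
  also have "\<dots> = e k" using k by (simp add: if_distrib[of "(*) _"] cong: if_cong)
  finally show ?thesis by (simp add: e_def)
qed

section \<open>Distribution functions and the Kolmogorov distance\<close>

lemma Phi_quantile:
  assumes "0 < p" "p < 1"
  obtains q where "Phi q = p"
proof -
  have "\<forall>\<^sub>F x in at_bot. Phi x < p"
    using std_normal.cdf_lim_at_bot assms(1) by (rule order_tendstoD)
  then obtain a where a: "Phi a < p" by (auto simp: eventually_at_bot_linorder)
  have "\<forall>\<^sub>F x in at_top. Phi x > p"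
    using std_normal.cdf_lim_at_top_prob assms(2) by (rule order_tendstoD)
  then obtain b where b: "p < Phi b" by (auto simp: eventually_at_top_linorder)
  have "a \<le> b"
    using a b std_normal.cdf_nondecreasing[of b a] by linarith
  then show thesis
    using IVT[of Phi a p b] a b isCont_Phi that by (auto simp: less_imp_le)
qed

text \<open>
  Between two consecutive quantiles \<open>\<Phi>\<close> increases by \<open>1 / K\<close>, and \<open>F\<close> is monotone; beyond the outermost
  quantiles, \<open>0 \<le> F \<le> 1\<close> takes the place of an estimate at a quantile.
\<close>

lemma uniform_bound_from_quantiles:
  fixes F :: "real \<Rightarrow> real"
  assumes F: "mono F" "\<And>u. 0 \<le> F u" "\<And>u. F u \<le> 1" and K: "K \<ge> 1" and \<delta>: "\<delta> \<ge> 0"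
    and q: "\<And>k. k \<in> {1..<K} \<Longrightarrow> Phi (q k) = real k / real K"
    and close: "\<And>k. k \<in> {1..<K} \<Longrightarrow> \<bar>F (q k) - Phi (q k)\<bar> \<le> \<delta>"
  shows "\<bar>F u - Phi u\<bar> \<le> \<delta> + 1 / real K"
proof -
  have K0: "real K > 0" using K by simp
  have mono_q: "u \<le> v" if "Phi u < Phi v" for u v
    using that std_normal.cdf_nondecreasing[of v u] by linarith
  have up: "F u \<le> Phi u + \<delta> + 1 / real K"
  proof -
    \<comment> \<open>the first quantile strictly to the right of \<open>u\<close>; there is none if \<open>j \<ge> K\<close>\<close>
    define j where "j = nat \<lfloor>real K * Phi u\<rfloor> + 1"
    have j: "real j - 1 \<le> real K * Phi u" "real K * Phi u < real j"
    proof -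
      have "0 \<le> real K * Phi u" using K0 Phi_bounds[of u] by simp
      then show "real j - 1 \<le> real K * Phi u" "real K * Phi u < real j"
        unfolding j_def by linarith+
    qed
    have j1: "real j / real K \<le> Phi u + 1 / real K" "Phi u < real j / real K"
      using j K0 by (auto simp: field_simps)
    show ?thesis
    proof (cases "j < K")
      case True
      then have "j \<in> {1..<K}" by (simp add: j_def)
      then have "u \<le> q j" using j1 q by (intro mono_q) simp
      then have "F u \<le> F (q j)" by (rule monoD[OF F(1)])
      moreover have "F (q j) \<le> real j / real K + \<delta>"
        using close[of j] q[of j] \<open>j \<in> {1..<K}\<close> by linarith
      ultimately show ?thesis using j1 by linarith
    next
      case False
      then have "1 \<le> real j / real K" using K0 by simp
      then show ?thesis using j1 F(3)[of u] \<delta> by linarith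
    qed
  qed
  have down: "Phi u \<le> F u + \<delta> + 1 / real K"
  proof -
    \<comment> \<open>the last quantile strictly to the left of \<open>u\<close>; \<open>k = 0\<close> if there is none\<close>
    define k where "k = nat (\<lceil>real K * Phi u\<rceil> - 1)"
    have Kp: "0 \<le> real K * Phi u" using K0 Phi_bounds[of u] by simp
    show ?thesis
    proof (cases "k = 0")
      case True
      then have "\<lceil>real K * Phi u\<rceil> \<le> 1" by (simp add: k_def)
      then have "real K * Phi u \<le> 1" by linarith
      then have "Phi u \<le> 1 / real K" using K0 by (simp add: field_simps)
      then show ?thesis using F(2)[of u] \<delta> by linarith
    next
      case False
      then have k: "real k < real K * Phi u" "real K * Phi u \<le> real k + 1"
        unfolding k_def by linarith+
      have "real K * Phi u \<le> real K * 1" using K0 Phi_bounds[of u] by (intro mult_left_mono) auto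
      then have "k \<in> {1..<K}" using k False by auto
      have k1: "real k / real K < Phi u" "Phi u \<le> real k / real K + 1 / real K"
        using k K0 by (auto simp: field_simps)
      have "q k \<le> u" using k1 q[of k] \<open>k \<in> {1..<K}\<close> by (intro mono_q) simp
      then have "F (q k) \<le> F u" by (rule monoD[OF F(1)])
      moreover have "real k / real K - \<delta> \<le> F (q k)"
        using close[of k] q[of k] \<open>k \<in> {1..<K}\<close> by linarith
      ultimately show ?thesis using k1 by linarith
    qed
  qed
  show ?thesis using up down by linarith
qed

definition sphere_cdf :: "('a::euclidean_space \<Rightarrow> real) \<Rightarrow> real \<Rightarrow> real" where
  "sphere_cdf h u = (\<integral>x. indicator {..u} (h x) \<partial>sphere_measure)"

lemma sphere_cdf_eq_cdf:
  fixes h :: "'a::euclidean_space \<Rightarrow> real"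
  assumes h[measurable]: "h \<in> borel_measurable sphere_measure"
  shows "sphere_cdf h = cdf (distr sphere_measure borel h)"
    and "real_distribution (distr sphere_measure borel h)"
proof -
  show "real_distribution (distr sphere_measure borel h)"
    by (rule sphere.real_distribution_distr) fact
  show "sphere_cdf h = cdf (distr sphere_measure borel h)"
  proof
    fix u
    have "sphere_cdf h u = (\<integral>x. indicator (h -` {..u} \<inter> space sphere_measure) x \<partial>sphere_measure)"
      unfolding sphere_cdf_def by (intro Bochner_Integration.integral_cong) (auto simp: indicator_def)
    also have "\<dots> = measure sphere_measure (h -` {..u} \<inter> space sphere_measure)"
      by (simp add: Int_absorb2)
    finally show "sphere_cdf h u = cdf (distr sphere_measure borel h) u"
      by (simp add: cdf_def measure_distr)
  qed
qed

lemma sphere_cdf_props: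
  fixes h :: "'a::euclidean_space \<Rightarrow> real"
  assumes h: "h \<in> borel_measurable sphere_measure"
  shows "mono (sphere_cdf h)" "0 \<le> sphere_cdf h u" "sphere_cdf h u \<le> 1"
    "(sphere_cdf h \<longlongrightarrow> sphere_cdf h u) (at_right u)"
proof -
  interpret D: real_distribution "distr sphere_measure borel h" by (rule sphere_cdf_eq_cdf(2)[OF h])
  note [simp] = sphere_cdf_eq_cdf(1)[OF h]
  show "mono (sphere_cdf h)" by (auto intro!: monoI D.cdf_nondecreasing)
  show "0 \<le> sphere_cdf h u" "sphere_cdf h u \<le> 1" by (simp_all add: D.cdf_nonneg D.cdf_bounded_prob)
  show "(sphere_cdf h \<longlongrightarrow> sphere_cdf h u) (at_right u)"
    using D.cdf_is_right_cont[of u] by (simp add: continuous_within)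
qed

lemma d_Kol_eq: "d_Kol h = (SUP u. \<bar>sphere_cdf h u - Phi u\<bar>)"
  by (simp add: d_Kol_def sphere_cdf_def)

lemma sphere_cdf_minus_Phi_le_1:
  assumes "h \<in> borel_measurable sphere_measure"
  shows "\<bar>sphere_cdf h u - Phi u\<bar> \<le> 1"
  using sphere_cdf_props(2,3)[OF assms, of u] Phi_bounds[of u] by linarith

lemma d_Kol_le:
  assumes "\<And>u. \<bar>sphere_cdf h u - Phi u\<bar> \<le> b"
  shows "d_Kol h \<le> b"
  unfolding d_Kol_eq by (rule cSUP_least) (use assms in auto)

text \<open>
  Both distribution functions are right-continuous, so a large deviation at \<open>u\<close> persists at rational
  points slightly to the right of \<open>u\<close>. This turns the supremum over the reals into a countable one and
  makes the event measurable.
\<close>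

lemma d_Kol_greater_iff_rat:
  fixes h :: "'a::euclidean_space \<Rightarrow> real"
  assumes h: "h \<in> borel_measurable sphere_measure"
  shows "d_Kol h > e \<longleftrightarrow> (\<exists>r::rat. \<bar>sphere_cdf h (of_rat r) - Phi (of_rat r)\<bar> > e)"
proof -
  have bdd: "bdd_above (range (\<lambda>u. \<bar>sphere_cdf h u - Phi u\<bar>))"
    using sphere_cdf_minus_Phi_le_1[OF h] by (intro bdd_aboveI[of _ 1]) auto
  have "d_Kol h > e \<longleftrightarrow> (\<exists>u. \<bar>sphere_cdf h u - Phi u\<bar> > e)"
    unfolding d_Kol_eq using less_cSUP_iff[OF UNIV_not_empty bdd, of e] by simp
  also have "\<dots> \<longleftrightarrow> (\<exists>r::rat. \<bar>sphere_cdf h (of_rat r) - Phi (of_rat r)\<bar> > e)"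
  proof safe
    fix u assume u: "\<bar>sphere_cdf h u - Phi u\<bar> > e"
    have "(Phi \<longlongrightarrow> Phi u) (at_right u)"
      using isCont_Phi[of u] by (simp add: continuous_at filterlim_at_split)
    then have "((\<lambda>v. \<bar>sphere_cdf h v - Phi v\<bar>) \<longlongrightarrow> \<bar>sphere_cdf h u - Phi u\<bar>) (at_right u)"
      by (intro tendsto_intros sphere_cdf_props(4)[OF h])
    from order_tendstoD(1)[OF this u] obtain b where b: "b > u" "\<And>v. u < v \<Longrightarrow> v < b \<Longrightarrow> e < \<bar>sphere_cdf h v - Phi v\<bar>"
      by (auto simp: eventually_at_right_field)
    obtain r :: rat where "u < of_rat r" "of_rat r < b" using of_rat_dense[OF b(1)] by blast
    then show "\<exists>r::rat. \<bar>sphere_cdf h (of_rat r) - Phi (of_rat r)\<bar> > e" using b(2) by blast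
  qed auto
  finally show ?thesis .
qed

lemma sphere_pair_product:
  fixes f g :: "'a::euclidean_space \<Rightarrow> real"
  assumes f: "continuous_on (sphere 0 1) f" and g: "continuous_on (sphere 0 1) g"
  shows "integrable (sphere_measure \<Otimes>\<^sub>M sphere_measure) (\<lambda>z. f (fst z) * g (snd z))"
    and "(\<integral>z. f (fst z) * g (snd z) \<partial>(sphere_measure \<Otimes>\<^sub>M sphere_measure)) =
      (\<integral>x. f x \<partial>sphere_measure) * (\<integral>x. g x \<partial>sphere_measure)"
proof -
  let ?\<sigma> = "sphere_measure :: 'a measure"
  interpret P: pair_prob_space ?\<sigma> ?\<sigma> by unfold_locales
  have [measurable]: "f \<in> borel_measurable ?\<sigma>" "g \<in> borel_measurable ?\<sigma>"
    using f g by (auto intro: borel_measurable_sphere)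
  have bdd: "\<exists>B. \<forall>x\<in>sphere 0 1. \<bar>h x\<bar> \<le> B" if "continuous_on (sphere 0 1) h" for h :: "'a \<Rightarrow> real"
    using compact_imp_bounded[OF compact_continuous_image[OF that compact_sphere]] by (auto simp only: bounded_iff ball_simps real_norm_def)
  obtain B C where B: "\<forall>x\<in>sphere 0 1. \<bar>f x\<bar> \<le> B" and C: "\<forall>x\<in>sphere 0 1. \<bar>g x\<bar> \<le> C"
    using bdd[OF f] bdd[OF g] by blast
  show int: "integrable (?\<sigma> \<Otimes>\<^sub>M ?\<sigma>) (\<lambda>z. f (fst z) * g (snd z))"
  proof (rule P.integrable_const_bound[of _ "B * C"])
    show "AE z in ?\<sigma> \<Otimes>\<^sub>M ?\<sigma>. norm (f (fst z) * g (snd z)) \<le> B * C"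
    proof (rule AE_I2)
      fix z assume "z \<in> space (?\<sigma> \<Otimes>\<^sub>M ?\<sigma>)"
      then have z: "fst z \<in> sphere 0 1" "snd z \<in> sphere 0 1" by (auto simp: space_pair_measure)
      from z(1) B have "\<bar>f (fst z)\<bar> \<le> B" by blast
      moreover from z(2) C have "\<bar>g (snd z)\<bar> \<le> C" by blast
      ultimately show "norm (f (fst z) * g (snd z)) \<le> B * C"
        unfolding real_norm_def abs_mult by (intro mult_mono) auto
    qed
  qed measurable
  show "(\<integral>z. f (fst z) * g (snd z) \<partial>(?\<sigma> \<Otimes>\<^sub>M ?\<sigma>)) = (\<integral>x. f x \<partial>?\<sigma>) * (\<integral>x. g x \<partial>?\<sigma>)"
    using P.integral_fst'[OF int] by simp
qed

section \<open>The Gaussian field\<close>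

text \<open>
  The random eigenfunction with independent standard Gaussian coefficients, normalized by the addition
  theorem to have variance 1 at each point of the sphere.
\<close>

definition gauss_field :: "nat \<Rightarrow> (nat \<Rightarrow> 'a \<Rightarrow> real) \<Rightarrow> (nat \<Rightarrow> real) \<Rightarrow> 'a \<Rightarrow> real" where
  "gauss_field n y g x = (\<Sum>m=1..n. (y m x / sqrt (real n)) * g m)"

text \<open>
  The squared difference is a double integral over the sphere. After exchanging it with the expectation,
  the integrand is the covariance of two level events, at most \<open>\<kappa> \<rho> + 8 \<rho>\<^sup>2\<close>, where \<open>\<rho>\<close> has integral 0
  and \<open>\<rho>\<^sup>2\<close> has integral \<open>1 / n\<close>.
\<close>

lemma gauss_field_cdf_second_moment:
  fixes y :: "nat \<Rightarrow> 'a::euclidean_space \<Rightarrow> real"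
  assumes n: "n \<ge> 1" and c: "c \<noteq> 0"
    and y: "orthonormal_basis_on_sphere n y (laplace_beltrami_eigenspace c)"
  shows "(\<lambda>g. sphere_cdf (gauss_field n y g) u) \<in> borel_measurable (gauss {1..n})"
    and "integrable (gauss {1..n}) (\<lambda>g. (sphere_cdf (gauss_field n y g) u - Phi u)\<^sup>2)"
    and "(\<integral>g. (sphere_cdf (gauss_field n y g) u - Phi u)\<^sup>2 \<partial>gauss {1..n}) \<le> 8 / real n"
proof -
  let ?I = "{1..n}"
  let ?\<sigma> = "sphere_measure :: 'a measure"
  let ?P = "?\<sigma> \<Otimes>\<^sub>M ?\<sigma>"
  let ?G = "gauss ?I"
  let ?W = "gauss_field n y"
  interpret P: pair_prob_space ?\<sigma> ?\<sigma> by unfold_locales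
  interpret G: prob_space ?G by (rule prob_space_gauss)
  interpret GP: pair_prob_space ?G ?P by unfold_locales
  have V: "y m \<in> laplace_beltrami_eigenspace c" if "m \<in> ?I" for m using y that by (auto simp: orthonormal_basis_on_sphere_def)
  have cont: "continuous_on (sphere 0 1) (y m)" if "m \<in> ?I" for m using eigenspace_continuous_on[OF V] that .
  have orth: "(\<integral>x. y m x * y k x \<partial>?\<sigma>) = (if m = k then 1 else 0)" if "m \<in> ?I" "k \<in> ?I" for m k
    using y that unfolding orthonormal_basis_on_sphere_def by blast
  have ym[measurable]: "y m \<in> borel_measurable ?\<sigma>" if "m \<in> ?I" for m by (rule borel_measurable_sphere[OF cont[OF that]])
  have W[measurable]: "(\<lambda>z. ?W (fst z) (snd z)) \<in> borel_measurable (?G \<Otimes>\<^sub>M ?\<sigma>)"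
    unfolding gauss_field_def by (intro borel_measurable_sum borel_measurable_times borel_measurable_divide) (auto intro: measurable_compose[OF measurable_snd ym])
  have W1: "?W g \<in> borel_measurable ?\<sigma>" for g
    unfolding gauss_field_def by (intro borel_measurable_sum borel_measurable_times borel_measurable_divide ym) auto
  define X where "X g x = indicator {..u} (?W g x) - Phi u" for g x
  have X1: "\<bar>X g x\<bar> \<le> 1" for g x unfolding X_def by (rule abs_indicator_minus_Phi_le_1)
  have X[measurable]: "(\<lambda>z. X (fst z) (snd z)) \<in> borel_measurable (?G \<Otimes>\<^sub>M ?\<sigma>)"
    unfolding X_def by measurable
  have Xg[measurable]: "X g \<in> borel_measurable ?\<sigma>" for g
    unfolding X_def using W1[of g] by measurable
  have intX: "integrable ?\<sigma> (X g)" for g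
    by (rule sphere.integrable_const_bound[of _ 1]) (use X1 in auto)
  have cdf_X: "sphere_cdf (?W g) u - Phi u = (\<integral>x. X g x \<partial>?\<sigma>)" for g
  proof -
    have "integrable ?\<sigma> (\<lambda>x. indicator {..u} (?W g x) :: real)"
      using W1[of g] by (intro sphere.integrable_const_bound[of _ 1]) (auto simp: indicator_def)
    then show ?thesis unfolding X_def sphere_cdf_def using sphere.prob_space[where 'a = 'a] by simp
  qed
  have mX: "(\<lambda>g. \<integral>x. X g x \<partial>?\<sigma>) \<in> borel_measurable ?G"
    using X by (intro sphere.borel_measurable_lebesgue_integral) (simp add: case_prod_unfold)
  have "(\<lambda>g. (\<integral>x. X g x \<partial>?\<sigma>) + Phi u) \<in> borel_measurable ?G" using mX by measurable
  then show meas: "(\<lambda>g. sphere_cdf (?W g) u) \<in> borel_measurable ?G"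
    unfolding cdf_X[symmetric] by simp
  show "integrable ?G (\<lambda>g. (sphere_cdf (?W g) u - Phi u)\<^sup>2)"
  proof (rule G.integrable_const_bound[of _ 1])
    show "AE g in ?G. norm ((sphere_cdf (?W g) u - Phi u)\<^sup>2) \<le> 1"
      using sphere_cdf_minus_Phi_le_1[OF W1] by (auto simp: abs_square_le_1)
    show "(\<lambda>g. (sphere_cdf (?W g) u - Phi u)\<^sup>2) \<in> borel_measurable ?G" using meas by measurable
  qed
  define H where "H g z = X g (fst z) * X g (snd z)" for g z
  have H1: "\<bar>H g z\<bar> \<le> 1" for g z unfolding H_def by (intro abs_mult_le_1 X1)
  have H[measurable]: "case_prod H \<in> borel_measurable (?G \<Otimes>\<^sub>M ?P)"
  proof -
    have 1: "(\<lambda>w. (fst w, fst (snd w))) \<in> ?G \<Otimes>\<^sub>M ?P \<rightarrow>\<^sub>M ?G \<Otimes>\<^sub>M ?\<sigma>"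
      and 2: "(\<lambda>w. (fst w, snd (snd w))) \<in> ?G \<Otimes>\<^sub>M ?P \<rightarrow>\<^sub>M ?G \<Otimes>\<^sub>M ?\<sigma>" by measurable
    show ?thesis
      unfolding H_def case_prod_unfold
      using measurable_compose[OF 1 X] measurable_compose[OF 2 X] by simp
  qed
  have intH: "integrable (?G \<Otimes>\<^sub>M ?P) (case_prod H)"
    by (rule GP.integrable_const_bound[OF _ H, of 1]) (use H1 in \<open>simp add: case_prod_unfold\<close>)
  have sq: "(sphere_cdf (?W g) u - Phi u)\<^sup>2 = (\<integral>z. H g z \<partial>?P)" for g
  proof -
    have int: "integrable ?P (\<lambda>z. H g z)"
      unfolding H_def by (rule P.integrable_const_bound[of _ 1]) (auto intro!: abs_mult_le_1 X1 simp: real_norm_def)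
    show ?thesis using P.integral_fst'[OF int] by (simp add: cdf_X H_def power2_eq_square)
  qed
  define \<rho> where "\<rho> z = (\<Sum>m\<in>?I. (y m (fst z) / sqrt (real n)) * (y m (snd z) / sqrt (real n)))" for z
  have norm1: "(\<Sum>m\<in>?I. (y m x / sqrt (real n))\<^sup>2) = 1" if "norm x = 1" for x
    using addition_theorem[OF y that] n by (simp add: power_divide sum_divide_distrib[symmetric])
  have cov: "(\<integral>g. H g z \<partial>?G) \<le> level_coeff u * \<rho> z + 8 * (\<rho> z)\<^sup>2" if z: "z \<in> space ?P" for z
  proof -
    have "norm (fst z) = 1" "norm (snd z) = 1" using z by (auto simp: space_pair_measure)
    then have "\<bar>(\<integral>g. H g z \<partial>?G) - level_coeff u * \<rho> z\<bar> \<le> 8 * (\<rho> z)\<^sup>2"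
      unfolding H_def X_def gauss_field_def \<rho>_def
      by (intro gauss_level_covariance norm1) auto
    then show ?thesis by linarith
  qed
  have \<rho>_eq: "\<rho> z = (\<Sum>m\<in>?I. (1 / real n) * (y m (fst z) * y m (snd z)))" for z
    unfolding \<rho>_def using n by (intro sum.cong refl) (simp add: real_sqrt_mult_self field_simps)
  have \<rho>2_eq: "(\<rho> z)\<^sup>2 = (\<Sum>m\<in>?I. \<Sum>k\<in>?I. (1 / real n)\<^sup>2 * ((y m (fst z) * y k (fst z)) * (y m (snd z) * y k (snd z))))" for z
    unfolding \<rho>_eq power2_eq_square sum_product by (intro sum.cong refl) (simp add: mult_ac)
  have int\<rho>: "integrable ?P \<rho>"
    unfolding \<rho>_eq[abs_def]
    by (intro Bochner_Integration.integrable_sum integrable_mult_right sphere_pair_product cont)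
  have int\<rho>2: "integrable ?P (\<lambda>z. (\<rho> z)\<^sup>2)"
    unfolding \<rho>2_eq
    by (intro Bochner_Integration.integrable_sum integrable_mult_right
      sphere_pair_product(1)[of "\<lambda>x. y _ x * y _ x" "\<lambda>x. y _ x * y _ x"] continuous_on_mult cont)
  have E\<rho>: "(\<integral>z. \<rho> z \<partial>?P) = 0"
  proof -
    have "(\<integral>z. \<rho> z \<partial>?P) = (\<Sum>m\<in>?I. (1 / real n) * ((\<integral>x. y m x \<partial>?\<sigma>) * (\<integral>x. y m x \<partial>?\<sigma>)))"
      unfolding \<rho>_eq
      by (subst Bochner_Integration.integral_sum)
         (auto intro!: integrable_mult_right sphere_pair_product(1) cont sum.cong simp: sphere_pair_product(2)[OF cont cont] simp del: atLeastAtMost_iff)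
    then show ?thesis using integral_eigenfunction_zero[OF y c] by simp
  qed
  have E\<rho>2: "(\<integral>z. (\<rho> z)\<^sup>2 \<partial>?P) = 1 / real n"
  proof -
    have pp: "integrable ?P (\<lambda>z. (y m (fst z) * y k (fst z)) * (y m (snd z) * y k (snd z)))"
      "(\<integral>z. (y m (fst z) * y k (fst z)) * (y m (snd z) * y k (snd z)) \<partial>?P) = (if m = k then 1 else 0)"
      if "m \<in> ?I" "k \<in> ?I" for m k
      using sphere_pair_product[of "\<lambda>x. y m x * y k x" "\<lambda>x. y m x * y k x"] that orth[OF that]
      by (simp_all add: continuous_on_mult cont del: atLeastAtMost_iff)
    have "(\<integral>z. (\<rho> z)\<^sup>2 \<partial>?P) = (\<Sum>m\<in>?I. \<Sum>k\<in>?I. (1 / real n)\<^sup>2 * (if m = k then 1 else 0))"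
    proof -
      have "(\<integral>z. (\<rho> z)\<^sup>2 \<partial>?P) = (\<Sum>m\<in>?I. \<Sum>k\<in>?I. (\<integral>z. (1 / real n)\<^sup>2 * ((y m (fst z) * y k (fst z)) * (y m (snd z) * y k (snd z))) \<partial>?P))"
        unfolding \<rho>2_eq
        by (subst Bochner_Integration.integral_sum,
            intro Bochner_Integration.integrable_sum integrable_mult_right pp(1), assumption, assumption)
          (intro sum.cong refl Bochner_Integration.integral_sum integrable_mult_right pp(1))
      also have "\<dots> = (\<Sum>m\<in>?I. \<Sum>k\<in>?I. (1 / real n)\<^sup>2 * (if m = k then 1 else 0))"
        by (intro sum.cong refl) (simp only: integral_mult_right_zero pp(2))
      finally show ?thesis .
    qed
    also have "\<dots> = real n * (1 / real n)\<^sup>2"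
      by (simp add: sum_distrib_left[symmetric])
    also have "\<dots> = 1 / real n" using n by (simp add: power2_eq_square)
    finally show ?thesis .
  qed
  have "(\<integral>g. (sphere_cdf (?W g) u - Phi u)\<^sup>2 \<partial>?G) = (\<integral>g. (\<integral>z. H g z \<partial>?P) \<partial>?G)"
    by (simp only: sq)
  also have "\<dots> = (\<integral>z. (\<integral>g. H g z \<partial>?G) \<partial>?P)"
    by (rule GP.Fubini_integral[OF intH, symmetric])
  also have "\<dots> \<le> (\<integral>z. level_coeff u * \<rho> z + 8 * (\<rho> z)\<^sup>2 \<partial>?P)"
    using GP.integrable_snd[OF intH] int\<rho> int\<rho>2 cov by (intro integral_mono) auto
  also have "\<dots> = 8 / real n" using int\<rho> int\<rho>2 E\<rho> E\<rho>2 by simp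
  finally show "(\<integral>g. (sphere_cdf (?W g) u - Phi u)\<^sup>2 \<partial>?G) \<le> 8 / real n" .
qed

section \<open>Tail bound and Borel--Cantelli\<close>

lemma spherical_comb_measurable:
  fixes y :: "nat \<Rightarrow> 'a::euclidean_space \<Rightarrow> real"
  assumes y: "\<And>m. m \<in> {1..n} \<Longrightarrow> y m \<in> borel_measurable sphere_measure"
  shows "spherical_comb n y a \<in> borel_measurable sphere_measure"
    and "(\<lambda>z. spherical_comb n y (fst z) (snd z)) \<in> borel_measurable (coord_sphere_measure n \<Otimes>\<^sub>M sphere_measure)"
proof -
  have comp: "(\<lambda>a. a m) \<in> borel_measurable (coord_sphere_measure n)" if "m \<in> {1..n}" for m
  proof -
    have "(\<lambda>a. a m) \<in> borel_measurable (restrict_space (PiM {1..n} (\<lambda>_. borel)) (coord_sphere n))"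
      by (rule measurable_restrict_space1[OF measurable_component_singleton[OF that]])
    then show ?thesis by (simp add: coord_sphere_measure_def Let_def cong: measurable_cong_sets)
  qed
  show "spherical_comb n y a \<in> borel_measurable sphere_measure"
    unfolding spherical_comb_def by (intro borel_measurable_sum borel_measurable_times y) auto
  show "(\<lambda>z. spherical_comb n y (fst z) (snd z)) \<in> borel_measurable (coord_sphere_measure n \<Otimes>\<^sub>M sphere_measure)"
    unfolding spherical_comb_def
    by (intro borel_measurable_sum borel_measurable_times
          measurable_compose[OF measurable_fst comp] measurable_compose[OF measurable_snd y])
qed

lemma d_Kol_event_measurable:
  fixes y :: "nat \<Rightarrow> 'a::euclidean_space \<Rightarrow> real"
  assumes y: "\<And>m. m \<in> {1..n} \<Longrightarrow> y m \<in> borel_measurable sphere_measure"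
  shows "{a \<in> space (coord_sphere_measure n). d_Kol (spherical_comb n y a) > e} \<in> sets (coord_sphere_measure n)"
proof -
  note m = spherical_comb_measurable[of n y, OF y]
  have [measurable]: "(\<lambda>a. sphere_cdf (spherical_comb n y a) u) \<in> borel_measurable (coord_sphere_measure n)" for u
    unfolding sphere_cdf_def
    using m(2) by (intro sphere.borel_measurable_lebesgue_integral) (simp add: case_prod_unfold)
  have "{a \<in> space (coord_sphere_measure n). \<exists>r::rat. \<bar>sphere_cdf (spherical_comb n y a) (of_rat r) - Phi (of_rat r)\<bar> > e}
      \<in> sets (coord_sphere_measure n)"
    by measurable
  then show ?thesis by (simp only: d_Kol_greater_iff_rat[OF m(1)])
qed

text \<open>
  Normalizing the coefficient vector divides the field by \<open>|g| / n\<^sup>1\<^sup>/\<^sup>2\<close>, a factor that does not depend on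
  the point of the sphere, so it can be moved into the argument of the distribution function.
\<close>

lemma sphere_cdf_direction:
  assumes n: "n \<ge> 1" and g: "L2_set g {1..n} > 0"
  shows "sphere_cdf (spherical_comb n y (direction n g)) u =
    sphere_cdf (gauss_field n y g) (u * (L2_set g {1..n} / sqrt (real n)))"
proof -
  let ?L = "L2_set g {1..n}"
  have "spherical_comb n y (direction n g) x = gauss_field n y g x / (?L / sqrt (real n))" for x
  proof -
    have "spherical_comb n y (direction n g) x = (\<Sum>m=1..n. (y m x / sqrt (real n) * g m) / (?L / sqrt (real n)))"
      unfolding spherical_comb_def by (intro sum.cong refl) (use n in \<open>simp add: direction_def\<close>)
    then show ?thesis unfolding gauss_field_def sum_divide_distrib .
  qed
  moreover have "?L / sqrt (real n) > 0" using n g by simp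
  ultimately have "spherical_comb n y (direction n g) x \<le> u \<longleftrightarrow> gauss_field n y g x \<le> u * (?L / sqrt (real n))" for x
    by (simp only: pos_divide_le_eq)
  then show ?thesis unfolding sphere_cdf_def by (simp add: indicator_def)
qed

text \<open>
  The three error terms come from the deviation at the quantiles, the spacing of the quantiles, and the
  deviation of \<open>|g|\<^sup>2 / n\<close> from 1.
\<close>

lemma d_Kol_direction_le:
  fixes y :: "nat \<Rightarrow> 'a::euclidean_space \<Rightarrow> real"
  assumes n: "n \<ge> 1" and g: "L2_set g {1..n} > 0"
    and meas: "gauss_field n y g \<in> borel_measurable sphere_measure"
    and K: "K \<ge> 1" and \<delta>: "\<delta> \<ge> 0"
    and q: "\<And>k. k \<in> {1..<K} \<Longrightarrow> Phi (q k) = real k / real K"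
    and close: "\<And>k. k \<in> {1..<K} \<Longrightarrow> \<bar>sphere_cdf (gauss_field n y g) (q k) - Phi (q k)\<bar> \<le> \<delta>"
  shows "d_Kol (spherical_comb n y (direction n g)) \<le> \<delta> + 1 / real K + 2 * \<bar>(\<Sum>i=1..n. (g i)\<^sup>2 - 1)\<bar> / real n"
proof (rule d_Kol_le)
  fix u
  define R where "R = L2_set g {1..n} / sqrt (real n)"
  have R: "R > 0" using n g by (simp add: R_def)
  have "R\<^sup>2 = (\<Sum>i=1..n. (g i)\<^sup>2) / real n"
    by (simp add: R_def power_divide L2_set_def sum_nonneg)
  then have "R\<^sup>2 - 1 = (\<Sum>i=1..n. (g i)\<^sup>2 - 1) / real n"
    using n by (simp add: sum_subtractf field_simps)
  then have R2: "2 * \<bar>R\<^sup>2 - 1\<bar> = 2 * \<bar>(\<Sum>i=1..n. (g i)\<^sup>2 - 1)\<bar> / real n" by simp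
  have "\<bar>sphere_cdf (gauss_field n y g) (u * R) - Phi (u * R)\<bar> \<le> \<delta> + 1 / real K"
    by (rule uniform_bound_from_quantiles[OF sphere_cdf_props(1-3)[OF meas] K \<delta> q close])
  moreover have "\<bar>Phi (u * R) - Phi u\<bar> \<le> 2 * \<bar>R\<^sup>2 - 1\<bar>" by (rule Phi_scale[OF R])
  ultimately show "\<bar>sphere_cdf (spherical_comb n y (direction n g)) u - Phi u\<bar> \<le>
      \<delta> + 1 / real K + 2 * \<bar>(\<Sum>i=1..n. (g i)\<^sup>2 - 1)\<bar> / real n"
    unfolding sphere_cdf_direction[OF n g] R_def[symmetric] R2 by linarith
qed

text \<open>
  The error \<open>\<epsilon>\<close> is shared out as \<open>\<epsilon>/4\<close> at the quantiles, \<open>\<epsilon>/4\<close> for their spacing, and \<open>\<epsilon>/2\<close> for the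
  length of the Gaussian vector. At most \<open>4 / \<epsilon>\<close> quantiles with failure probability \<open>128 / (n \<epsilon>\<^sup>2)\<close> each
  contribute \<open>512 / (n \<epsilon>\<^sup>3)\<close>, and the length contributes \<open>32 / (n \<epsilon>\<^sup>2)\<close>. For \<open>\<epsilon> > 1\<close> the event is
  empty.
\<close>

lemma d_Kol_tail:
  fixes y :: "nat \<Rightarrow> 'a::euclidean_space \<Rightarrow> real"
  assumes n: "n \<ge> 1" and c: "c \<noteq> 0" and e: "e > 0"
    and y: "orthonormal_basis_on_sphere n y (laplace_beltrami_eigenspace c)"
  shows "measure (coord_sphere_measure n) {a \<in> space (coord_sphere_measure n). d_Kol (spherical_comb n y a) > e}
     \<le> 544 / (real n * e ^ 3)"
proof (cases "e \<le> 1")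
  case e1: True
  let ?I = "{1..n}"
  let ?G = "gauss ?I"
  let ?F = "\<lambda>g. sphere_cdf (gauss_field n y g)"
  let ?S = "\<lambda>g. \<Sum>i=1..n. (g i)\<^sup>2 - 1 :: real"
  interpret G: prob_space ?G by (rule prob_space_gauss)
  have ym: "y m \<in> borel_measurable sphere_measure" if "m \<in> ?I" for m
    using y that by (intro borel_measurable_sphere eigenspace_continuous_on) (auto simp: orthonormal_basis_on_sphere_def)
  have W: "gauss_field n y g \<in> borel_measurable sphere_measure" for g
    unfolding gauss_field_def by (intro borel_measurable_sum borel_measurable_times borel_measurable_divide ym) auto
  note F = gauss_field_cdf_second_moment[OF n c y]
  define E where "E = {a \<in> space (coord_sphere_measure n). d_Kol (spherical_comb n y a) > e}"
  have E: "E \<in> sets (coord_sphere_measure n)" unfolding E_def by (rule d_Kol_event_measurable[OF ym])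
  define K where "K = nat \<lceil>4 / e\<rceil>"
  have "4 / e > 0" using e by simp
  then have K: "K \<ge> 1" "4 / e \<le> real K" "real K - 1 \<le> 4 / e" unfolding K_def by linarith+
  have "\<forall>k\<in>{1..<K}. \<exists>q. Phi q = real k / real K"
    using Phi_quantile[of "real _ / real K"] by (metis (no_types) K(1) atLeastLessThan_iff divide_less_eq_1_pos
      less_le_trans of_nat_0_less_iff of_nat_less_iff zero_less_divide_iff zero_less_one)
  from bchoice[OF this] obtain q where q: "\<forall>k\<in>{1..<K}. Phi (q k) = real k / real K" ..
  define B where "B k = {g \<in> space ?G. \<bar>?F g (q k) - Phi (q k)\<bar> \<ge> e / 4}" for k
  define D where "D = {g \<in> space ?G. \<bar>?S g\<bar> \<ge> real n * e / 4}"
  have Sm[measurable]: "?S \<in> borel_measurable ?G" by measurable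
  have B: "B k \<in> sets ?G" for k
  proof -
    note F(1)[of "q k", measurable]
    show ?thesis unfolding B_def by measurable
  qed
  have D: "D \<in> sets ?G" unfolding D_def by measurable
  have Bm: "measure ?G (B k) \<le> 128 / (real n * e\<^sup>2)" for k
  proof -
    have "measure ?G (B k) \<le> (\<integral>g. (?F g (q k) - Phi (q k))\<^sup>2 \<partial>?G) / (e / 4)\<^sup>2"
      unfolding B_def using F(1,2)[of "q k"] e by (intro G.second_moment_method) auto
    also have "\<dots> \<le> (8 / real n) / (e / 4)\<^sup>2"
      by (intro divide_right_mono F(3)) auto
    finally show ?thesis by (simp add: power_divide)
  qed
  have Dm: "measure ?G D \<le> 32 / (real n * e\<^sup>2)"
  proof -
    have "measure ?G D \<le> (\<integral>g. (?S g)\<^sup>2 \<partial>?G) / (real n * e / 4)\<^sup>2"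
      unfolding D_def using gauss_centered_norm_second_moment(1)[of ?I] e n by (intro G.second_moment_method) auto
    also have "\<dots> = 2 * real n / (real n * e / 4)\<^sup>2"
      by (subst gauss_centered_norm_second_moment(2)) simp_all
    also have "\<dots> = 32 / (real n * e\<^sup>2)"
      using n e by (simp add: power2_eq_square field_simps)
    finally show ?thesis .
  qed
  have "measure (coord_sphere_measure n) E = measure ?G {g \<in> space ?G. L2_set g ?I > 0 \<and> direction n g \<in> E}"
    using emeasure_coord_sphere_measure(1)[OF n E] by (simp only: measure_def)
  also have "\<dots> \<le> measure ?G ((\<Union>k\<in>{1..<K}. B k) \<union> D)"
  proof (rule G.finite_measure_mono)
    show "(\<Union>k\<in>{1..<K}. B k) \<union> D \<in> sets ?G" using B D by auto
    show "{g \<in> space ?G. L2_set g ?I > 0 \<and> direction n g \<in> E} \<subseteq> (\<Union>k\<in>{1..<K}. B k) \<union> D"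
    proof (rule subsetI, rule ccontr)
      fix g assume g: "g \<in> {g \<in> space ?G. L2_set g ?I > 0 \<and> direction n g \<in> E}"
        and "g \<notin> (\<Union>k\<in>{1..<K}. B k) \<union> D"
      then have notB: "\<bar>?F g (q k) - Phi (q k)\<bar> \<le> e / 4" if "k \<in> {1..<K}" for k
        using that by (force simp: B_def)
      have notD: "\<bar>?S g\<bar> < real n * e / 4"
        using g \<open>g \<notin> _\<close> by (simp add: D_def)
      have "d_Kol (spherical_comb n y (direction n g)) \<le> e / 4 + 1 / real K + 2 * \<bar>?S g\<bar> / real n"
        by (rule d_Kol_direction_le[OF n _ W K(1)]) (use g e q notB in auto)
      moreover have "1 / real K \<le> e / 4" using K(1,2) e by (simp add: field_simps)
      moreover have "2 * \<bar>?S g\<bar> / real n \<le> e / 2" using notD n by (simp add: field_simps)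
      ultimately have "d_Kol (spherical_comb n y (direction n g)) \<le> e" by linarith
      then show False using g by (simp add: E_def)
    qed
  qed
  also have "\<dots> \<le> measure ?G (\<Union>k\<in>{1..<K}. B k) + measure ?G D"
    using B D by (intro measure_Un_le) auto
  also have "measure ?G (\<Union>k\<in>{1..<K}. B k) \<le> (\<Sum>k\<in>{1..<K}. measure ?G (B k))"
    using B by (intro measure_UNION_le) auto
  also have "\<dots> \<le> (\<Sum>k\<in>{1..<K}. 128 / (real n * e\<^sup>2))"
    by (intro sum_mono Bm)
  also have "\<dots> = (real K - 1) * (128 / (real n * e\<^sup>2))"
    using K(1) by (simp add: of_nat_diff)
  also have "\<dots> \<le> (4 / e) * (128 / (real n * e\<^sup>2))"
    using e by (intro mult_right_mono K(3)) auto
  also have "\<dots> = 512 / (real n * e ^ 3)"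
    by (simp add: power2_eq_square power3_eq_cube)
  also have "measure ?G D \<le> 32 / (real n * e ^ 3)"
  proof -
    have "e ^ 3 \<le> e\<^sup>2" using e e1 by (intro power_decreasing) auto
    then have "32 / (real n * e\<^sup>2) \<le> 32 / (real n * e ^ 3)"
      using n e by (intro divide_left_mono mult_left_mono) auto
    then show ?thesis using Dm by linarith
  qed
  finally show ?thesis unfolding E_def by (simp add: add_divide_distrib[symmetric])
next
  case False
  have ym: "y m \<in> borel_measurable sphere_measure" if "m \<in> {1..n}" for m
    using y that by (intro borel_measurable_sphere eigenspace_continuous_on) (auto simp: orthonormal_basis_on_sphere_def)
  have "d_Kol (spherical_comb n y a) \<le> e" for a
  proof -
    have "d_Kol (spherical_comb n y a) \<le> 1"
      by (intro d_Kol_le sphere_cdf_minus_Phi_le_1 spherical_comb_measurable ym)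
    then show ?thesis using False by linarith
  qed
  then have empty: "{a \<in> space (coord_sphere_measure n). d_Kol (spherical_comb n y a) > e} = {}"
    by (auto simp: not_less)
  show ?thesis unfolding empty using e by simp
qed

lemma eigenspace_dim_ge_1:
  assumes "l \<ge> 1" "d \<ge> 2"
  shows "eigenspace_dim l d \<ge> 1"
proof -
  have "real (eigenspace_dim l d) > 0"
    unfolding real_eigenspace_dim[OF assms] using assms by (intro mult_pos_pos divide_pos_pos) auto
  then show ?thesis by simp
qed

theorem proposition18:
  fixes d :: nat
    and Y :: "nat \<Rightarrow> nat \<Rightarrow> 'a::euclidean_space \<Rightarrow> real"
    and \<epsilon> :: "nat \<Rightarrow> real"
  assumes "d \<ge> 2" and "DIM('a) = d + 1"
    and "\<And>l. l \<ge> 1 \<Longrightarrow>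
           orthonormal_basis_on_sphere (eigenspace_dim l d) (Y l)
             (laplace_beltrami_eigenspace (- (real l * (real l + real d - 1))))"
    and "\<And>l. l \<ge> 1 \<Longrightarrow> \<epsilon> l > 0"
    and "(\<lambda>l. 1 / (real (eigenspace_dim l d) * \<epsilon> l ^ 3)) summable_on {1..}"
  shows "{\<alpha> \<in> space (coeff_measure d).
            infinite {l. l \<ge> 1 \<and> d_Kol (spherical_comb (eigenspace_dim l d) (Y l) (\<alpha> l)) > \<epsilon> l}}
         \<in> null_sets (coeff_measure d)"
proof -
  define N where "N l = eigenspace_dim l d" for l
  define M where "M l = coord_sphere_measure (N l)" for l
  define E where "E l = {a \<in> space (M l). d_Kol (spherical_comb (N l) (Y l) a) > \<epsilon> l}" for l
  define A where "A l = (if l \<ge> 1 then {\<alpha> \<in> space (coeff_measure d). \<alpha> l \<in> E l} else {})" for l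
  have N1: "N l \<ge> 1" if "l \<ge> 1" for l unfolding N_def by (rule eigenspace_dim_ge_1[OF that assms(1)])
  have basis: "orthonormal_basis_on_sphere (N l) (Y l) (laplace_beltrami_eigenspace (- (real l * (real l + real d - 1))))"
    if "l \<ge> 1" for l unfolding N_def by (rule assms(3)[OF that])
  have ps: "prob_space (M l)" if "l \<in> {1..}" for l
    unfolding M_def using N1 that by (intro prob_space_coord_sphere_measure) auto
  have coeff: "coeff_measure d = PiM {1..} M" by (simp add: coeff_measure_def M_def[abs_def] N_def[abs_def])
  interpret C: prob_space "coeff_measure d" unfolding coeff by (rule prob_space_PiM[OF ps])
  have E: "E l \<in> sets (M l)" if "l \<ge> 1" for l
    unfolding E_def M_def
  proof (rule d_Kol_event_measurable)
    fix m assume "m \<in> {1..N l}"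
    then show "Y l m \<in> borel_measurable sphere_measure"
      using basis[OF that]
      by (intro borel_measurable_sphere eigenspace_continuous_on) (auto simp: orthonormal_basis_on_sphere_def)
  qed
  have comp: "(\<lambda>\<alpha>. \<alpha> l) \<in> coeff_measure d \<rightarrow>\<^sub>M M l" if "l \<ge> 1" for l
    unfolding coeff using that by (intro measurable_component_singleton) auto
  have A_eq: "A l = (\<lambda>\<alpha>. \<alpha> l) -` E l \<inter> space (coeff_measure d)" if "l \<ge> 1" for l
    using that by (auto simp: A_def)
  have A: "A l \<in> sets (coeff_measure d)" for l
  proof (cases "l \<ge> 1")
    case True
    show ?thesis unfolding A_eq[OF True] by (rule measurable_sets[OF comp[OF True] E[OF True]])
  qed (simp add: A_def)
  have bound: "measure (coeff_measure d) (A l) \<le> 544 * (1 / (real (N l) * \<epsilon> l ^ 3))" if l: "l \<ge> 1" for l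
  proof -
    have "measure (coeff_measure d) (A l) = measure (distr (coeff_measure d) (M l) (\<lambda>\<alpha>. \<alpha> l)) (E l)"
      unfolding A_eq[OF l] by (rule measure_distr[OF comp[OF l] E[OF l], symmetric])
    also have "distr (coeff_measure d) (M l) (\<lambda>\<alpha>. \<alpha> l) = M l"
      unfolding coeff using l by (intro distr_PiM_component ps) auto
    also have "measure (M l) (E l) \<le> 544 / (real (N l) * \<epsilon> l ^ 3)"
      unfolding E_def M_def
      by (rule d_Kol_tail[OF N1[OF l] _ assms(4)[OF l] basis[OF l]]) (use l assms(1) in auto)
    finally show ?thesis by simp
  qed
  \<comment> \<open>the summability over \<open>{1..}\<close>, extended by 0 to all of \<open>nat\<close>\<close>
  define s where "s l = (if l \<ge> 1 then 1 / (real (N l) * \<epsilon> l ^ 3) else 0)" for l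
  have s0: "s l \<ge> 0" for l using assms(4)[of l] by (auto simp: s_def)
  have "s summable_on UNIV \<longleftrightarrow> (\<lambda>l. 1 / (real (N l) * \<epsilon> l ^ 3)) summable_on {1..}"
    by (rule summable_on_cong_neutral) (auto simp: s_def)
  then have "summable s"
    using assms(5) s0 by (simp add: N_def summable_on_UNIV_nonneg_real_iff)
  then have "summable (\<lambda>l. 544 * s l)" by (rule summable_mult)
  then have "summable (\<lambda>l. measure (coeff_measure d) (A l))"
  proof (rule summable_comparison_test')
    fix l :: nat
    show "norm (measure (coeff_measure d) (A l)) \<le> 544 * s l"
      using bound[of l] by (auto simp: s_def A_def)
  qed
  then have "limsup A \<in> null_sets (coeff_measure d)"
    by (intro borel_cantelli_limsup1 A) (auto simp: less_top[symmetric])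
  also have "limsup A = {\<alpha> \<in> space (coeff_measure d).
      infinite {l. l \<ge> 1 \<and> d_Kol (spherical_comb (eigenspace_dim l d) (Y l) (\<alpha> l)) > \<epsilon> l}}"
  proof -
    have sub: "{l. \<alpha> \<in> A l} = {l. l \<ge> 1 \<and> d_Kol (spherical_comb (eigenspace_dim l d) (Y l) (\<alpha> l)) > \<epsilon> l}"
      if "\<alpha> \<in> space (coeff_measure d)" for \<alpha>
      using that measurable_space[OF comp that] by (auto simp: A_def E_def N_def)
    have "\<alpha> \<in> limsup A \<longleftrightarrow> infinite {l. \<alpha> \<in> A l}" for \<alpha>
      using frequently_cofinite[of "\<lambda>l. \<alpha> \<in> A l"] unfolding cofinite_eq_sequentially mem_limsup_iff .
    moreover have "\<alpha> \<in> space (coeff_measure d)" if "\<alpha> \<in> A l" for \<alpha> l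
      using that by (auto simp: A_def split: if_splits)
    then have "\<alpha> \<in> space (coeff_measure d)" if "infinite {l. \<alpha> \<in> A l}" for \<alpha>
      using that by (metis (mono_tags, lifting) empty_Collect_eq finite.emptyI)
    ultimately show ?thesis by (intro set_eqI) (metis (no_types, lifting) mem_Collect_eq sub)
  qed
  finally show ?thesis .
qed

end
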